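(* Let $(V,\omega)$ be a $2n$-dimensional real symplectic vector space, let $\lambda:[a,b]\to\Lambda(V,\omega)$ be a continuous path and let $\mu_1,\mu_2\in\Lambda(V,\omega)$. Define the subspaces $$\epsilon_1=\lambda(a)\cap\lambda(b)+\lambda(b)\cap\mu_1,\quad \epsilon_2=\lambda(a)\cap\lambda(b)+\lambda(b)\cap\mu_2,$$ $$\delta_1=\lambda(a)\cap\mu_1+\mu_1\cap\mu_2,\quad \delta_2=\lambda(b)\cap\mu_1+\mu_1\cap\mu_2,$$ and set $k_1=\min\{\dim\epsilon_1,\dim\epsilon_2\}$, $k_2=\min\{\dim\delta_1,\dim\delta_2\}$, $k=\max\{k_1,k_2\}$. Then $$\Big|\iota^{\mathrm{CLM}}\big(\mu_2,\lambda(t);t\in[a,b]\big)-\iota^{\mathrm{CLM}}\big(\mu_1,\lambda(t);t\in[a,b]\big)\Big|\le n-k.$$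
   Context: Let $(V,\omega)$ be a real symplectic vector space of dimension $2n$ and $\Lambda(V,\omega)$ its Lagrangian Grassmannian (the $n$-dimensional subspaces $L$ with $\omega|_{L\times L}=0$). For $L_0\in\Lambda(V,\omega)$ and a continuous path $\ell:[a,b]\to\Lambda(V,\omega)$, $\iota^{\mathrm{CLM}}(L_0,\ell(t);t\in[a,b])\in\mathbb Z$ denotes the Cappell–Lee–Miller Maslov index: the intersection index of $\ell$ with the Maslov cycle $\Sigma(L_0)=\{L\in\Lambda(V,\omega): L\cap L_0\neq\{0\}\}$; it is invariant under homotopies of $\ell$ with fixed endpoints, additive under concatenation of paths, and for $\mathscr C^1$ paths all of whose crossings are regular it is given by $\iota^{\mathrm{CLM}}(L_0,\ell(t);t\in[a,b])=n_+\big(\Gamma(\ell,L_0,a)\big)+\sum_{a<t<b}\operatorname{sgn}\Gamma(\ell,L_0,t)-n_-\big(\Gamma(\ell,L_0,b)\big)$. Here a crossing is an instant $t_0$ with $\ell(t_0)\cap L_0\neq\{0\}$; the crossing form $\Gamma(\ell,L_0,t_0)$ is the quadratic form on $\ell(t_0)\cap L_0$ defined by choosing $W\in\Lambda(V,\omega)$ transversal to $\ell(t_0)$, letting, for $v\in\ell(t_0)$ and $t$ near $t_0$, $w(t)\in W$ be the unique vector with $v+w(t)\in\ell(t)$, and setting $\Gamma(\ell,L_0,t_0)[v]=\frac{d}{dt}\big|_{t=t_0}\omega(v,w(t))$; a crossing is regular if this form is nondegenerate; $n_+,n_-$ denote positive and negative inertia indices and $\operatorname{sgn}=n_+-n_-$.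 *)

theory Defs
  imports "HOL-Analysis.Analysis"
begin

text \<open>Real symplectic vector space: a finite-dimensional real vector space (carried by a
type of class euclidean_space; the inner product is only used to put the standard
topology on the Grassmannian) with a skew-symmetric nondegenerate bilinear form.\<close>

definition symplectic_form :: "('v::euclidean_space \<Rightarrow> 'v \<Rightarrow> real) \<Rightarrow> bool" where
  "symplectic_form \<omega> \<longleftrightarrow> bilinear \<omega> \<and> (\<forall>u v. \<omega> u v = - \<omega> v u)
     \<and> (\<forall>u. (\<forall>v. \<omega> u v = 0) \<longrightarrow> u = 0)"

definition lagrangian :: "('v::euclidean_space \<Rightarrow> 'v \<Rightarrow> real) \<Rightarrow> nat \<Rightarrow> 'v set \<Rightarrow> bool" where
  "lagrangian \<omega> n L \<longleftrightarrow> subspace L \<and> dim L = n \<and> (\<forall>u\<in>L. \<forall>v\<in>L. \<omega> u v = 0)"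

definition ssum :: "'v::real_vector set \<Rightarrow> 'v set \<Rightarrow> 'v set" where
  "ssum A B = {x + y | x y. x \<in> A \<and> y \<in> B}"

text \<open>Topology on the Grassmannian: via orthogonal projections (closest_point onto a
subspace is the orthogonal projection).  A path is continuous iff all the maps
t \<mapsto> P_{l(t)} v are continuous; it is C^1 iff they are continuously differentiable.\<close>
definition lag_path :: "('v::euclidean_space \<Rightarrow> 'v \<Rightarrow> real) \<Rightarrow> nat \<Rightarrow> (real \<Rightarrow> 'v set)
    \<Rightarrow> real \<Rightarrow> real \<Rightarrow> bool" where
  "lag_path \<omega> n l a b \<longleftrightarrow> (\<forall>t\<in>{a..b}. lagrangian \<omega> n (l t))
     \<and> (\<forall>v. continuous_on {a..b} (\<lambda>t. closest_point (l t) v))"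

definition lag_path_C1 :: "('v::euclidean_space \<Rightarrow> 'v \<Rightarrow> real) \<Rightarrow> nat \<Rightarrow> (real \<Rightarrow> 'v set)
    \<Rightarrow> real \<Rightarrow> real \<Rightarrow> bool" where
  "lag_path_C1 \<omega> n l a b \<longleftrightarrow> (\<forall>t\<in>{a..b}. lagrangian \<omega> n (l t))
     \<and> (\<forall>v. \<exists>D. (\<forall>t\<in>{a..b}. ((\<lambda>s. closest_point (l s) v) has_vector_derivative D t)
                                   (at t within {a..b})) \<and> continuous_on {a..b} D)"

definition lag_homotopic :: "('v::euclidean_space \<Rightarrow> 'v \<Rightarrow> real) \<Rightarrow> nat \<Rightarrow> (real \<Rightarrow> 'v set)
    \<Rightarrow> (real \<Rightarrow> 'v set) \<Rightarrow> real \<Rightarrow> real \<Rightarrow> bool" where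
  "lag_homotopic \<omega> n l l' a b \<longleftrightarrow> (\<exists>H :: real \<Rightarrow> real \<Rightarrow> 'v set.
      (\<forall>s\<in>{0..1}. \<forall>t\<in>{a..b}. lagrangian \<omega> n (H s t))
    \<and> (\<forall>v. continuous_on ({0..1} \<times> {a..b}) (\<lambda>(s,t). closest_point (H s t) v))
    \<and> (\<forall>t\<in>{a..b}. H 0 t = l t \<and> H 1 t = l' t)
    \<and> (\<forall>s\<in>{0..1}. H s a = l a \<and> H s b = l b))"

text \<open>Crossing form Gamma(l, L0, t0)[v] (as a function of v; it is considered on
l(t0) \<inter> L0).  It is independent of the auxiliary Lagrangian W transversal to l(t0).\<close>
definition crossing_form :: "('v::euclidean_space \<Rightarrow> 'v \<Rightarrow> real) \<Rightarrow> nat \<Rightarrow> (real \<Rightarrow> 'v set)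
    \<Rightarrow> real \<Rightarrow> real \<Rightarrow> real \<Rightarrow> 'v \<Rightarrow> real" where
  "crossing_form \<omega> n l a b t0 v = (THE q. \<exists>W. lagrangian \<omega> n W \<and> W \<inter> l t0 = {0} \<and>
      ((\<lambda>t. \<omega> v (THE w. w \<in> W \<and> v + w \<in> l t)) has_real_derivative q) (at t0 within {a..b}))"

definition pos_index :: "('v::euclidean_space \<Rightarrow> real) \<Rightarrow> 'v set \<Rightarrow> nat" where
  "pos_index Q S = Max {dim U | U. subspace U \<and> U \<subseteq> S \<and> (\<forall>u\<in>U. u \<noteq> 0 \<longrightarrow> Q u > 0)}"

definition neg_index :: "('v::euclidean_space \<Rightarrow> real) \<Rightarrow> 'v set \<Rightarrow> nat" where
  "neg_index Q S = Max {dim U | U. subspace U \<and> U \<subseteq> S \<and> (\<forall>u\<in>U. u \<noteq> 0 \<longrightarrow> Q u < 0)}"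

definition qsgn :: "('v::euclidean_space \<Rightarrow> real) \<Rightarrow> 'v set \<Rightarrow> int" where
  "qsgn Q S = int (pos_index Q S) - int (neg_index Q S)"

definition nondegenerate :: "('v::euclidean_space \<Rightarrow> real) \<Rightarrow> 'v set \<Rightarrow> bool" where
  "nondegenerate Q S \<longleftrightarrow> (\<forall>u\<in>S. (\<forall>v\<in>S. Q (u + v) - Q u - Q v = 0) \<longrightarrow> u = 0)"

definition crossings :: "(real \<Rightarrow> 'v::euclidean_space set) \<Rightarrow> 'v set \<Rightarrow> real \<Rightarrow> real \<Rightarrow> real set" where
  "crossings l L0 a b = {t\<in>{a..b}. l t \<inter> L0 \<noteq> {0}}"

definition regular_path :: "('v::euclidean_space \<Rightarrow> 'v \<Rightarrow> real) \<Rightarrow> nat \<Rightarrow> 'v set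
    \<Rightarrow> (real \<Rightarrow> 'v set) \<Rightarrow> real \<Rightarrow> real \<Rightarrow> bool" where
  "regular_path \<omega> n L0 l a b \<longleftrightarrow> lag_path_C1 \<omega> n l a b
     \<and> (\<forall>t\<in>crossings l L0 a b. nondegenerate (crossing_form \<omega> n l a b t) (l t \<inter> L0))"

definition clm_formula :: "('v::euclidean_space \<Rightarrow> 'v \<Rightarrow> real) \<Rightarrow> nat \<Rightarrow> 'v set
    \<Rightarrow> (real \<Rightarrow> 'v set) \<Rightarrow> real \<Rightarrow> real \<Rightarrow> int" where
  "clm_formula \<omega> n L0 l a b =
     int (pos_index (crossing_form \<omega> n l a b a) (l a \<inter> L0))
     + (\<Sum>t\<in>crossings l L0 a b \<inter> {a<..<b}. qsgn (crossing_form \<omega> n l a b t) (l t \<inter> L0))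
     - int (neg_index (crossing_form \<omega> n l a b b) (l b \<inter> L0))"

text \<open>Cappell--Lee--Miller Maslov index of a continuous Lagrangian path: the value of the
crossing formula on any regular C^1 path homotopic to it with fixed endpoints
(well defined by homotopy invariance; such paths exist).\<close>
definition clm_index :: "('v::euclidean_space \<Rightarrow> 'v \<Rightarrow> real) \<Rightarrow> nat \<Rightarrow> 'v set
    \<Rightarrow> (real \<Rightarrow> 'v set) \<Rightarrow> real \<Rightarrow> real \<Rightarrow> int" where
  "clm_index \<omega> n L0 l a b = (THE m. \<exists>l'. lag_homotopic \<omega> n l l' a b
       \<and> regular_path \<omega> n L0 l' a b \<and> finite (crossings l' L0 a b)
       \<and> m = clm_formula \<omega> n L0 l' a b)"

end

theory Submission
  imports Defs
begin

text \<open>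
  A Lagrangian \<open>L\<close> transversal to \<open>W\<close> is the graph of a symmetric form on \<open>V/W\<close>, so two Lagrangians
  \<open>L, M\<close> transversal to \<open>W\<close> have a difference form; let \<open>N\<^sub>W(L, M)\<close> be its positive inertia index.
  Along a regular path the crossing formula adds up exactly the jumps of \<open>N\<^sub>W(l(t), L\<^sub>0)\<close>. Kashiwara's
  form shows that \<open>T(X, Y, Z) = N\<^sub>W(X, Y) + N\<^sub>W(Y, Z) - N\<^sub>W(X, Z)\<close> does not depend on \<open>W\<close>; hence the local
  increments of \<open>N\<^sub>W(l(t), L\<^sub>0)\<close> do not depend on \<open>W\<close> either, they integrate to an index for every
  continuous path, and this index is homotopy invariant. A regular representative of a path is found by
  replacing it by a \<open>C\<^sup>1\<close> path and rotating that path quickly forth and back by \<open>exp (\<theta> J)\<close>, with \<open>J\<close> a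
  compatible complex structure: crossings are then definite except at the turning point, where
  there is none.

  The difference of the indices for \<open>\<mu>\<^sub>1\<close> and \<open>\<mu>\<^sub>2\<close> telescopes to
  \<open>T(\<lambda>(a), \<mu>\<^sub>1, \<mu>\<^sub>2) - T(\<lambda>(b), \<mu>\<^sub>1, \<mu>\<^sub>2) = T(\<lambda>(a), \<lambda>(b), \<mu>\<^sub>2) - T(\<lambda>(a), \<lambda>(b), \<mu>\<^sub>1)\<close>, and
  \<open>0 \<le> T(X, Y, Z) \<le> n - dim (X \<inter> Y + Y \<inter> Z)\<close> by linear algebra.
\<close>

subsection \<open>Inertia indices of symmetric forms\<close>

text \<open>\<open>clm_index\<close> is a definite description, so the proof needs the existence of
  a regular path in the homotopy class and the equality of the crossing sums of all such paths. One
  fixed \<open>W\<close> cannot serve a whole path, as no Lagrangian need be transversal to all its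
  members; therefore only increments near each instant are compared, and then joined along the
  interval. The positive index, rather than half the signature, fits the endpoint convention: just
  after a regular crossing it exceeds its value at the crossing by the positive inertia index of the
  crossing form, just before by the negative one. So the positive part is counted on leaving an
  instant and the negative part on arriving.

  The regular representative meets one obstacle. A rotation that keeps both ends fixed has to turn
  back, and where its speed vanishes it cannot dominate the crossing form of the path itself. For
  this reason the path is made to rest at its last point during the turn, and the angle reached
  there is chosen such that the rotated last point is transversal to the given Lagrangian.\<close>

lemma pos_index_finite:
  "finite {dim U | U. subspace U \<and> U \<subseteq> S \<and> (\<forall>u\<in>U. u \<noteq> 0 \<longrightarrow> Q u > (0::real))}"
  for S :: "'a::euclidean_space set"
  by (rule finite_subset[of _ "{..DIM('a)}"]) (auto intro: dim_subset_UNIV)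

lemma pos_index_ge:
  fixes U :: "'a::euclidean_space set"
  assumes "subspace U" "U \<subseteq> S" "\<And>u. u \<in> U \<Longrightarrow> u \<noteq> 0 \<Longrightarrow> Q u > 0"
  shows "dim U \<le> pos_index Q S"
  unfolding pos_index_def by (rule Max_ge[OF pos_index_finite]) (use assms in auto)

lemma pos_index_witness:
  fixes S :: "'a::euclidean_space set"
  assumes "0 \<in> S"
  obtains U where "subspace U" "U \<subseteq> S" "\<And>u. u \<in> U \<Longrightarrow> u \<noteq> 0 \<Longrightarrow> Q u > 0" "dim U = pos_index Q S"
proof -
  have "{dim U | U. subspace U \<and> U \<subseteq> S \<and> (\<forall>u\<in>U. u \<noteq> 0 \<longrightarrow> Q u > 0)} \<noteq> {}"
    using assms by (auto intro!: exI[of _ "{0}"])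
  from Max_in[OF pos_index_finite this] show thesis
    using that unfolding pos_index_def by auto
qed

lemma neg_index_eq: "neg_index Q S = pos_index (\<lambda>x. - Q x) S"
  by (simp add: neg_index_def pos_index_def)

lemma pos_index_cong:
  assumes "\<And>x. x \<in> S \<Longrightarrow> Q x = Q' x"
  shows "pos_index Q S = pos_index Q' S"
proof -
  have "{dim U |U. subspace U \<and> U \<subseteq> S \<and> (\<forall>u\<in>U. u \<noteq> 0 \<longrightarrow> 0 < Q u)}
      = {dim U |U. subspace U \<and> U \<subseteq> S \<and> (\<forall>u\<in>U. u \<noteq> 0 \<longrightarrow> 0 < Q' u)}"
    using assms by (metis (mono_tags, lifting) subsetD)
  then show ?thesis by (simp add: pos_index_def)
qed

text \<open>The kernel of \<open>f\<close> does no harm. A right inverse on the image carries a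
  positive subspace back to \<open>S\<close>, and a subspace on which the pulled-back form is
  positive meets the kernel only in 0 because \<open>Q 0 = 0\<close>.\<close>

lemma pos_index_image:
  fixes f :: "'a::euclidean_space \<Rightarrow> 'b::euclidean_space"
  assumes f: "linear f" and S: "subspace S" and Q0: "Q 0 = 0"
  shows "pos_index Q (f ` S) = pos_index (\<lambda>x. Q (f x)) S"
proof (rule antisym)
  have "0 \<in> f ` S" using S f by (metis image_eqI linear_0 subspace_0)
  from pos_index_witness[OF this, of Q]
  obtain U where U: "subspace U" "U \<subseteq> f ` S" "\<And>u. u \<in> U \<Longrightarrow> u \<noteq> 0 \<Longrightarrow> Q u > 0"
    "dim U = pos_index Q (f ` S)" by metis
  obtain g where g: "range g \<subseteq> S" "linear g" "\<And>x. x \<in> f ` S \<Longrightarrow> f (g x) = x"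
    using linear_exists_right_inverse_on[OF f S] by auto
  have "inj_on g U" using g(3) U(2) by (metis inj_on_def subsetD)
  then have "dim (g ` U) = dim U" using g U(1) by (metis dim_image_eq span_eq_iff)
  moreover have "dim (g ` U) \<le> pos_index (\<lambda>x. Q (f x)) S"
  proof (rule pos_index_ge)
    show "subspace (g ` U)" using g U linear_subspace_image by blast
    show "g ` U \<subseteq> S" using g by auto
    fix v assume "v \<in> g ` U" "v \<noteq> 0"
    then obtain u where "u \<in> U" "v = g u" "u \<noteq> 0" using linear_0[OF g(2)] by blast
    then show "0 < Q (f v)" using U g(3) by force
  qed
  ultimately show "pos_index Q (f ` S) \<le> pos_index (\<lambda>x. Q (f x)) S" using U(4) by simp
next
  obtain U where U: "subspace U" "U \<subseteq> S" "\<And>u. u \<in> U \<Longrightarrow> u \<noteq> 0 \<Longrightarrow> Q (f u) > 0"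
    "dim U = pos_index (\<lambda>x. Q (f x)) S"
    using pos_index_witness[of S "\<lambda>x. Q (f x)"] S subspace_0 by blast
  have "inj_on f U"
    by (rule linear_injective_on_subspace_0[OF f U(1), THEN iffD2]) (use U(3) Q0 in fastforce)
  then have "dim (f ` U) = dim U" using f U(1)
    by (metis dim_image_eq span_eq_iff)
  moreover have "dim (f ` U) \<le> pos_index Q (f ` S)"
    by (rule pos_index_ge) (use U f Q0 linear_0 in \<open>auto simp: linear_subspace_image\<close>)
  ultimately show "pos_index (\<lambda>x. Q (f x)) S \<le> pos_index Q (f ` S)" using U(4) by simp
qed

section \<open>Sums of subspaces and annihilators\<close>

lemma ssum_mem_left: "subspace B \<Longrightarrow> x \<in> A \<Longrightarrow> x \<in> ssum A B"
  unfolding ssum_def by (force dest: subspace_0)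

lemma ssum_mem_right: "subspace A \<Longrightarrow> x \<in> B \<Longrightarrow> x \<in> ssum A B"
  unfolding ssum_def by (force dest: subspace_0)

lemma subspace_ssum: "subspace A \<Longrightarrow> subspace B \<Longrightarrow> subspace (ssum A B)"
  unfolding ssum_def by (rule subspace_sums)

lemma ssum_subset: "subspace E \<Longrightarrow> A \<subseteq> E \<Longrightarrow> B \<subseteq> E \<Longrightarrow> ssum A B \<subseteq> E"
  unfolding ssum_def by (auto intro!: subspace_add)

lemma dim_ssum:
  fixes A :: "'a::euclidean_space set"
  shows "subspace A \<Longrightarrow> subspace B \<Longrightarrow> dim (ssum A B) + dim (A \<inter> B) = dim A + dim B"
  unfolding ssum_def by (rule dim_sums_Int)

lemma dim_Int_trivial_le:
  fixes A :: "'a::euclidean_space set"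
  assumes "subspace A" "subspace B" "subspace E" "A \<subseteq> E" "B \<subseteq> E" "A \<inter> B \<subseteq> {0}"
  shows "dim A + dim B \<le> dim E"
proof -
  have "ssum A B \<subseteq> E" using assms by (intro ssum_subset) auto
  then have "dim (ssum A B) \<le> dim E" by (rule dim_subset)
  moreover have "dim (A \<inter> B) = 0" using assms(6) dim_eq_0 by blast
  ultimately show ?thesis using dim_ssum[OF assms(1,2)] by linarith
qed

text \<open>Every dimension of \<open>U\<close> costs at most one linear condition on
  \<open>E\<close>. Representing the form by the inner product turns the annihilator into an
  orthogonal complement.\<close>

lemma dim_annihilator_ge:
  fixes B :: "'a::euclidean_space \<Rightarrow> 'a \<Rightarrow> real"
  assumes B: "bilinear B" and E: "subspace E" and U: "subspace U"
  shows "dim E \<le> dim U + dim {v\<in>E. \<forall>u\<in>U. B u v = 0}"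
proof -
  define H where "H u = (\<Sum>i\<in>Basis. B u i *\<^sub>R i)" for u
  have Hi: "H u \<bullet> v = B u v" for u v
  proof -
    have "B u v = B u (\<Sum>i\<in>Basis. (v \<bullet> i) *\<^sub>R i)" by (simp add: euclidean_representation)
    also have "\<dots> = (\<Sum>i\<in>Basis. (v \<bullet> i) * B u i)"
      using B by (simp add: bilinear_def linear_sum linear_cmul)
    finally show ?thesis by (simp add: H_def inner_sum_left inner_sum_right inner_commute[of _ v] mult.commute)
  qed
  have linH: "linear H"
    by (rule linearI; rule euclidean_eqI)
      (use B in \<open>simp_all add: Hi inner_add_left bilinear_ladd bilinear_lmul\<close>)
  let ?C = "{v. \<forall>x\<in>H ` U. orthogonal x v}"
  have C: "subspace ?C" by (rule subspace_orthogonal_to_vectors)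
  have "dim {y \<in> UNIV. \<forall>x\<in>H ` U. orthogonal x y} + dim (H ` U) = dim (UNIV::'a set)"
    using dim_subspace_orthogonal_to_vectors[of "H ` U" UNIV] linH U
    by (simp add: linear_subspace_image)
  then have 1: "dim ?C + dim (H ` U) = DIM('a)" by simp
  have 2: "dim (H ` U) \<le> dim U" by (rule dim_image_le[OF linH])
  have 3: "dim (ssum E ?C) + dim (E \<inter> ?C) = dim E + dim ?C" by (rule dim_ssum[OF E C])
  have 4: "dim (ssum E ?C) \<le> DIM('a)" by (rule dim_subset_UNIV)
  have "E \<inter> ?C = {v\<in>E. \<forall>u\<in>U. B u v = 0}" by (auto simp: orthogonal_def Hi)
  then show ?thesis using 1 2 3 4 by simp
qed

section \<open>Sylvester's law and inertia indices of sums of forms\<close>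

definition form_radical :: "('a \<Rightarrow> 'a \<Rightarrow> real) \<Rightarrow> 'a set \<Rightarrow> 'a set" where
  "form_radical B E = {u\<in>E. \<forall>v\<in>E. B u v = 0}"

lemma bilinear_simps:
  assumes "bilinear B"
  shows "B (x + y) z = B x z + B y z" "B z (x + y) = B z x + B z y"
    "B (x - y) z = B x z - B y z" "B z (x - y) = B z x - B z y"
    "B (c *\<^sub>R x) z = c *\<^sub>R B x z" "B z (c *\<^sub>R x) = c *\<^sub>R B z x"
    "B 0 z = 0" "B z 0 = 0" "B (- x) z = - B x z" "B z (- x) = - B z x"
  using assms
  by (auto simp: bilinear_ladd bilinear_radd bilinear_lsub bilinear_rsub bilinear_lmul bilinear_rmul
      bilinear_lzero bilinear_rzero bilinear_lneg bilinear_rneg)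

lemma subspace_radical:
  assumes "bilinear B" "subspace E" shows "subspace (form_radical B E)"
  using assms unfolding form_radical_def subspace_def by (auto simp: bilinear_simps)

lemma bilinear_uminus: "bilinear B \<Longrightarrow> bilinear (\<lambda>x y. - B x y)" for B :: "_ \<Rightarrow> _ \<Rightarrow> real"
  unfolding bilinear_def by (auto intro: linear_compose_neg)

text \<open>Moving \<open>v\<close> along \<open>u\<close> changes the quadratic form affinely, with
  slope \<open>2 * B u v\<close>; an affine function that is bounded above is constant.\<close>

lemma semidefinite_null_in_radical:
  fixes B :: "'a::euclidean_space \<Rightarrow> 'a \<Rightarrow> real"
  assumes B: "bilinear B" and E: "subspace E" and sym: "\<And>u v. u \<in> E \<Longrightarrow> v \<in> E \<Longrightarrow> B u v = B v u"
    and neg: "\<And>v. v \<in> E \<Longrightarrow> B v v \<le> 0" and u: "u \<in> E" "B u u = 0" and v: "v \<in> E"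
  shows "B u v = 0"
proof (rule ccontr)
  assume nz: "B u v \<noteq> 0"
  have "2 * t * B u v + B v v \<le> 0" for t
  proof -
    have "t *\<^sub>R u + v \<in> E" using E u v by (simp add: subspace_add subspace_scale)
    from neg[OF this] show ?thesis using u v sym[OF u(1) v] by (simp add: bilinear_simps[OF B])
  qed
  \<comment> \<open>At this parameter the affine function takes the value 1.\<close>
  note this[of "(1 - B v v) / (2 * B u v)"]
  moreover have "2 * ((1 - B v v) / (2 * B u v)) * B u v = 1 - B v v" using nz by simp
  ultimately show False by linarith
qed

text \<open>The annihilator \<open>M\<close> of a maximal positive subspace \<open>U\<close> carries
  a nonpositive form, since a positive vector in it would enlarge \<open>U\<close>. A null vector of
  \<open>M\<close> is annihilated by \<open>M\<close> and by \<open>U\<close>, hence lies in the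
  radical, so a complement of the radical in \<open>M\<close> is negative definite.\<close>

theorem sylvester:
  fixes B :: "'a::euclidean_space \<Rightarrow> 'a \<Rightarrow> real"
  assumes B: "bilinear B" and E: "subspace E" and sym: "\<And>u v. u \<in> E \<Longrightarrow> v \<in> E \<Longrightarrow> B u v = B v u"
  shows "pos_index (\<lambda>v. B v v) E + neg_index (\<lambda>v. B v v) E + dim (form_radical B E) = dim E"
proof -
  obtain U where U: "subspace U" "U \<subseteq> E" "\<And>u. u \<in> U \<Longrightarrow> u \<noteq> 0 \<Longrightarrow> B u u > 0"
    "dim U = pos_index (\<lambda>v. B v v) E"
    using pos_index_witness[of E "\<lambda>v. B v v"] E subspace_0 by blast
  define M where "M = {v\<in>E. \<forall>u\<in>U. B u v = 0}"
  have M: "subspace M" "M \<subseteq> E"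
    using E unfolding M_def subspace_def by (auto simp: bilinear_simps[OF B])
  have dM: "dim E \<le> dim U + dim M" using dim_annihilator_ge[OF B E U(1)] by (simp add: M_def)
  have Mneg: "B v v \<le> 0" if v: "v \<in> M" for v
  proof (rule ccontr)
    assume pos: "\<not> B v v \<le> 0"
    have vE: "v \<in> E" using v M by auto
    have "v \<notin> U" using pos v by (auto simp: M_def)
    have sv: "subspace (span {v})" by simp
    have int: "U \<inter> span {v} \<subseteq> {0}"
    proof
      fix x assume "x \<in> U \<inter> span {v}"
      then obtain c where c: "x = c *\<^sub>R v" "x \<in> U" by (auto simp: span_singleton)
      then have "B x v = 0" using v by (auto simp: M_def)
      then have "c * B v v = 0" using c by (simp add: bilinear_simps[OF B])
      then show "x \<in> {0}" using pos c by auto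
    qed
    have "dim (span {v}) = 1" using pos by (auto simp: bilinear_simps[OF B])
    have "dim (U \<inter> span {v}) = 0" using int dim_eq_0 by blast
    then have "dim (ssum U (span {v})) = dim U + 1"
      using dim_ssum[OF U(1) sv] \<open>dim (span {v}) = 1\<close> by linarith
    moreover have "dim (ssum U (span {v})) \<le> pos_index (\<lambda>v. B v v) E"
    proof (rule pos_index_ge)
      show "subspace (ssum U (span {v}))" using U(1) sv by (rule subspace_ssum)
      show "ssum U (span {v}) \<subseteq> E" using U E vE
        by (auto simp: ssum_def span_singleton intro!: subspace_add subspace_scale)
      fix x assume "x \<in> ssum U (span {v})" "x \<noteq> 0"
      then obtain u c where x: "x = u + c *\<^sub>R v" "u \<in> U" by (auto simp: ssum_def span_singleton)
      have z: "B u v = 0" using v x by (auto simp: M_def)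
      then have z': "B v u = 0" using sym[of u v] x(2) U(2) vE by auto
      have e: "B x x = B u u + c * c * B v v" using z z' x by (simp add: bilinear_simps[OF B])
      show "0 < B x x"
      proof (cases "u = 0")
        case True
        then have "c \<noteq> 0" using \<open>x \<noteq> 0\<close> x by auto
        then show ?thesis using e pos True
          by (metis add_0 bilinear_simps(7)[OF B] linorder_not_le mult_pos_pos not_real_square_gt_zero)
      next
        case False
        have "c * c * B v v \<ge> 0" using pos by simp
        then show ?thesis using e U(3)[OF x(2) False] by linarith
      qed
    qed
    ultimately show False using U(4) by simp
  qed
  let ?R = "form_radical B E"
  have R: "subspace ?R" by (rule subspace_radical[OF B E])
  have RM: "?R \<subseteq> M" using sym U by (auto simp: M_def form_radical_def)
  \<comment> \<open>The inner product serves here only to select a complement of the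
    radical.\<close>
  define N where "N = {v\<in>M. \<forall>x\<in>?R. orthogonal x v}"
  have N: "subspace N" "N \<subseteq> M"
    using M unfolding N_def subspace_def orthogonal_def by (auto simp: inner_add_right)
  have dN: "dim N + dim ?R = dim M"
    unfolding N_def by (rule dim_subspace_orthogonal_to_vectors[OF R M(1) RM])
  have "dim N \<le> neg_index (\<lambda>v. B v v) E"
    unfolding neg_index_eq
  proof (rule pos_index_ge)
    show "subspace N" by fact
    show "N \<subseteq> E" using N M by auto
    fix v assume v: "v \<in> N" "v \<noteq> 0"
    have "B v v \<noteq> 0"
    proof
      assume z: "B v v = 0"
      have vM: "v \<in> M" using v N by auto
      have *: "B v x = 0" if "x \<in> M" for x
        by (rule semidefinite_null_in_radical[OF B M(1) _ _ vM z that])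
          (use sym M Mneg in auto)
      have "B v x = 0" if "x \<in> E" for x
      proof -
        have UM: "U \<inter> M \<subseteq> {0}" using U(3) by (fastforce simp: M_def)
        have "dim (U \<inter> M) = 0" using UM dim_eq_0 by blast
        then have "dim (ssum U M) = dim U + dim M" using dim_ssum[OF U(1) M(1)] by linarith
        moreover have "ssum U M \<subseteq> E" using U M E
          by (intro ssum_subset) auto
        ultimately have "ssum U M = E"
          using subspace_dim_equal[OF subspace_ssum[OF U(1) M(1)] E] dM by simp
        then have "x \<in> ssum U M" using that by simp
        then obtain u m where "x = u + m" "u \<in> U" "m \<in> M" by (auto simp: ssum_def)
        moreover have "B v u = 0" using \<open>u \<in> U\<close> vM U(2) M(2) sym[of v u] by (auto simp: M_def)
        ultimately show ?thesis using * by (simp add: bilinear_simps[OF B])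
      qed
      then have "v \<in> ?R" using vM M by (auto simp: form_radical_def)
      then have "orthogonal v v" using v by (auto simp: N_def)
      then show False using v by (simp add: orthogonal_def)
    qed
    moreover have "B v v \<le> 0" using Mneg v N by auto
    ultimately show "0 < - B v v" by linarith
  qed
  then have ge: "dim E \<le> pos_index (\<lambda>v. B v v) E + neg_index (\<lambda>v. B v v) E + dim ?R"
    using dM dN U(4) by linarith
  \<comment> \<open>Converse inequality: a maximal negative subspace together with the radical
    carries a nonpositive form, so it meets \<open>U\<close> only in 0.\<close>
  obtain V where V: "subspace V" "V \<subseteq> E" "\<And>u. u \<in> V \<Longrightarrow> u \<noteq> 0 \<Longrightarrow> - B u u > 0"
    "dim V = neg_index (\<lambda>v. B v v) E"
    using pos_index_witness[of E "\<lambda>v. - B v v"] E subspace_0 unfolding neg_index_eq by blast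
  have sVR: "subspace (ssum V ?R)" by (rule subspace_ssum[OF V(1) R])
  have form: "B (v + r) (v + r) = B v v" if "v \<in> E" "r \<in> ?R" for v r
    using that sym[of v r] by (simp add: bilinear_simps[OF B] form_radical_def)
  have "V \<inter> ?R \<subseteq> {0}" using V(3) by (fastforce simp: form_radical_def)
  then have "dim (V \<inter> ?R) = 0" using dim_eq_0 by blast
  then have "dim (ssum V ?R) = dim V + dim ?R" using dim_ssum[OF V(1) R] by linarith
  moreover have "dim U + dim (ssum V ?R) \<le> dim E"
  proof (rule dim_Int_trivial_le[OF U(1) sVR E U(2)])
    show "ssum V ?R \<subseteq> E" using V E by (intro ssum_subset) (auto simp: form_radical_def)
    show "U \<inter> ssum V ?R \<subseteq> {0}"
    proof
      fix x assume x: "x \<in> U \<inter> ssum V ?R"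
      then obtain v r where vr: "x = v + r" "v \<in> V" "r \<in> ?R" by (auto simp: ssum_def)
      then have "B x x = B v v" using form V(2) by auto
      also have "\<dots> \<le> 0" using V(3)[OF vr(2)] by (cases "v = 0") (auto simp: bilinear_simps[OF B])
      finally show "x \<in> {0}" using U(3)[of x] x by auto
    qed
  qed
  ultimately have "pos_index (\<lambda>v. B v v) E + neg_index (\<lambda>v. B v v) E + dim ?R \<le> dim E"
    using U(4) V(4) by linarith
  with ge show ?thesis by linarith
qed

lemma dim_image_subspace:
  fixes f :: "'a::euclidean_space \<Rightarrow> 'b::euclidean_space"
  assumes "linear f" "subspace S" "inj_on f S"
  shows "dim (f ` S) = dim S"
  using assms by (metis dim_image_eq span_eq_iff)

lemma pos_index_witness_UNIV:
  fixes Q :: "'a::euclidean_space \<Rightarrow> real"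
  obtains U where "subspace U" "\<And>u. u \<in> U \<Longrightarrow> u \<noteq> 0 \<Longrightarrow> Q u > 0" "dim U = pos_index Q UNIV"
  by (rule pos_index_witness[of UNIV Q]) auto

text \<open>Products of definite subspaces give superadditivity of the positive and of the negative
  index, the scalar \<open>c\<close> covering both signs. Radicals and dimensions add up exactly, so
  Sylvester's law forces equality.\<close>

lemma pos_index_prod:
  fixes B1 :: "'a::euclidean_space \<Rightarrow> 'a \<Rightarrow> real" and B2 :: "'b::euclidean_space \<Rightarrow> 'b \<Rightarrow> real"
  assumes B1: "bilinear B1" and E1: "subspace E1"
    and sym1: "\<And>u v. u \<in> E1 \<Longrightarrow> v \<in> E1 \<Longrightarrow> B1 u v = B1 v u"
    and B2: "bilinear B2" and E2: "subspace E2"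
    and sym2: "\<And>u v. u \<in> E2 \<Longrightarrow> v \<in> E2 \<Longrightarrow> B2 u v = B2 v u"
  shows "pos_index (\<lambda>z. B1 (fst z) (fst z) + B2 (snd z) (snd z)) (E1 \<times> E2)
    = pos_index (\<lambda>v. B1 v v) E1 + pos_index (\<lambda>v. B2 v v) E2"
proof -
  define B where "B z z' = B1 (fst z) (fst z') + B2 (snd z) (snd z')" for z z'
  have B: "bilinear B"
    unfolding bilinear_def B_def
    by (auto intro!: linearI simp: bilinear_simps[OF B1] bilinear_simps[OF B2] algebra_simps)
  have E: "subspace (E1 \<times> E2)" using E1 E2 by (rule subspace_Times)
  have le: "pos_index (\<lambda>v. c * B1 v v) E1 + pos_index (\<lambda>v. c * B2 v v) E2 \<le> pos_index (\<lambda>z. c * B z z) (E1 \<times> E2)"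
    for c :: real
  proof -
    obtain U1 where U1: "subspace U1" "U1 \<subseteq> E1" "\<And>u. u \<in> U1 \<Longrightarrow> u \<noteq> 0 \<Longrightarrow> c * B1 u u > 0"
      "dim U1 = pos_index (\<lambda>v. c * B1 v v) E1"
      using pos_index_witness[of E1 "\<lambda>v. c * B1 v v"] E1 subspace_0 by blast
    obtain U2 where U2: "subspace U2" "U2 \<subseteq> E2" "\<And>u. u \<in> U2 \<Longrightarrow> u \<noteq> 0 \<Longrightarrow> c * B2 u u > 0"
      "dim U2 = pos_index (\<lambda>v. c * B2 v v) E2"
      using pos_index_witness[of E2 "\<lambda>v. c * B2 v v"] E2 subspace_0 by blast
    have "dim (U1 \<times> U2) \<le> pos_index (\<lambda>z. c * B z z) (E1 \<times> E2)"
    proof (rule pos_index_ge)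
      show "subspace (U1 \<times> U2)" using U1 U2 by (simp add: subspace_Times)
      show "U1 \<times> U2 \<subseteq> E1 \<times> E2" using U1 U2 by auto
      fix z assume z: "z \<in> U1 \<times> U2" "z \<noteq> 0"
      then have "c * B1 (fst z) (fst z) \<ge> 0" "c * B2 (snd z) (snd z) \<ge> 0"
        using U1(3)[of "fst z"] U2(3)[of "snd z"]
        by (cases "fst z = 0"; cases "snd z = 0"; auto simp: bilinear_simps[OF B1] bilinear_simps[OF B2])+
      moreover have "c * B1 (fst z) (fst z) > 0 \<or> c * B2 (snd z) (snd z) > 0"
        using z U1(3)[of "fst z"] U2(3)[of "snd z"] by (cases z) (auto simp: zero_prod_def)
      ultimately show "0 < c * B z z" by (auto simp: B_def algebra_simps)
    qed
    then show ?thesis using U1 U2 by (simp add: dim_Times)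
  qed
  have rad: "form_radical B (E1 \<times> E2) = form_radical B1 E1 \<times> form_radical B2 E2"
  proof -
    have "B1 u v = 0" "B2 u' v' = 0"
      if "\<forall>v\<in>E1 \<times> E2. B (u, u') v = 0" "v \<in> E1" "v' \<in> E2" for u u' v v'
    proof -
      have "B (u, u') (v, 0) = 0" "B (u, u') (0, v') = 0"
        using that E1 E2 by (auto simp: subspace_0)
      then show "B1 u v = 0" "B2 u' v' = 0"
        by (auto simp: B_def bilinear_simps[OF B1] bilinear_simps[OF B2])
    qed
    note rad = this
    show ?thesis
    proof (intro set_eqI iffI)
      fix z assume "z \<in> form_radical B (E1 \<times> E2)"
      then show "z \<in> form_radical B1 E1 \<times> form_radical B2 E2"
        using rad[of "fst z" "snd z"] subspace_0[OF E1] subspace_0[OF E2]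
        unfolding form_radical_def mem_Times_iff mem_Collect_eq prod.collapse by blast
    next
      fix z assume "z \<in> form_radical B1 E1 \<times> form_radical B2 E2"
      then show "z \<in> form_radical B (E1 \<times> E2)"
        by (auto simp: form_radical_def B_def)
    qed
  qed
  have "pos_index (\<lambda>z. B z z) (E1 \<times> E2) + neg_index (\<lambda>z. B z z) (E1 \<times> E2) + dim (form_radical B (E1 \<times> E2))
      = dim (E1 \<times> E2)"
    by (rule sylvester[OF B E]) (auto simp: B_def sym1 sym2)
  moreover have "pos_index (\<lambda>z. B1 z z) E1 + neg_index (\<lambda>z. B1 z z) E1 + dim (form_radical B1 E1) = dim E1"
    by (rule sylvester[OF B1 E1 sym1])
  moreover have "pos_index (\<lambda>z. B2 z z) E2 + neg_index (\<lambda>z. B2 z z) E2 + dim (form_radical B2 E2) = dim E2"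
    by (rule sylvester[OF B2 E2 sym2])
  moreover have "dim (form_radical B (E1 \<times> E2)) = dim (form_radical B1 E1) + dim (form_radical B2 E2)"
    unfolding rad using B1 B2 E1 E2 by (simp add: dim_Times subspace_radical)
  moreover have "dim (E1 \<times> E2) = dim E1 + dim E2" using E1 E2 by (rule dim_Times)
  ultimately have "pos_index (\<lambda>z. B z z) (E1 \<times> E2) = pos_index (\<lambda>z. B1 z z) E1 + pos_index (\<lambda>z. B2 z z) E2"
    using le[of 1] le[of "-1"] by (simp add: neg_index_eq)
  then show ?thesis by (simp add: B_def)
qed

text \<open>A maximal positive subspace plus the radical. It has the largest dimension that a
  nonnegative subspace can have, and its null vectors are exactly those of the radical.\<close>

lemma nonneg_subspace:
  fixes B :: "'a::euclidean_space \<Rightarrow> 'a \<Rightarrow> real"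
  assumes B: "bilinear B" and E: "subspace E" and sym: "\<And>u v. u \<in> E \<Longrightarrow> v \<in> E \<Longrightarrow> B u v = B v u"
  obtains M where "subspace M" "M \<subseteq> E" "form_radical B E \<subseteq> M" "\<And>v. v \<in> M \<Longrightarrow> B v v \<ge> 0"
    "\<And>v. v \<in> M \<Longrightarrow> B v v = 0 \<Longrightarrow> v \<in> form_radical B E"
    "dim M = pos_index (\<lambda>v. B v v) E + dim (form_radical B E)"
proof -
  obtain U where U: "subspace U" "U \<subseteq> E" "\<And>u. u \<in> U \<Longrightarrow> u \<noteq> 0 \<Longrightarrow> B u u > 0"
    "dim U = pos_index (\<lambda>v. B v v) E"
    using pos_index_witness[of E "\<lambda>v. B v v"] E subspace_0 by blast
  let ?R = "form_radical B E"
  have R: "subspace ?R" "?R \<subseteq> E" using subspace_radical[OF B E] by (auto simp: form_radical_def)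
  have form: "B (v + r) (v + r) = B v v" if "v \<in> E" "r \<in> ?R" for v r
    using that sym[of v r] by (simp add: bilinear_simps[OF B] form_radical_def)
  have nn: "B v v \<ge> 0 \<and> (B v v = 0 \<longrightarrow> v \<in> ?R)" if "v \<in> ssum U ?R" for v
  proof -
    obtain u r where ur: "v = u + r" "u \<in> U" "r \<in> ?R" using \<open>v \<in> ssum U ?R\<close> by (auto simp: ssum_def)
    then have "B v v = B u u" using form U(2) by auto
    then show ?thesis using U(3)[OF ur(2)] ur by (cases "u = 0") (auto simp: bilinear_simps[OF B])
  qed
  have "U \<inter> ?R \<subseteq> {0}" using U(3) by (fastforce simp: form_radical_def)
  then have "dim (U \<inter> ?R) = 0" using dim_eq_0 by blast
  then have "dim (ssum U ?R) = dim U + dim ?R" using dim_ssum[OF U(1) R(1)] by linarith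
  with U(4) have d: "dim (ssum U ?R) = pos_index (\<lambda>v. B v v) E + dim ?R" by simp
  have "?R \<subseteq> ssum U ?R" using ssum_mem_right[OF U(1)] by blast
  from that[OF subspace_ssum[OF U(1) R(1)] ssum_subset[OF E U(2) R(2)] this _ _ d] nn
  show thesis by blast
qed

text \<open>Two subspaces on which \<open>P\<close> and \<open>Q\<close> are nonpositive, with
  codimensions equal to the positive indices, meet in codimension at most the sum of these; a
  positive subspace of the sum avoids that intersection.\<close>

lemma pos_index_add_le:
  fixes P Q :: "'a::euclidean_space \<Rightarrow> 'a \<Rightarrow> real"
  assumes P: "bilinear P" "\<And>u v. P u v = P v u" and Q: "bilinear Q" "\<And>u v. Q u v = Q v u"
  shows "pos_index (\<lambda>v. P v v + Q v v) UNIV \<le> pos_index (\<lambda>v. P v v) UNIV + pos_index (\<lambda>v. Q v v) UNIV"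
proof -
  have *: "\<exists>M. subspace M \<and> (\<forall>v\<in>M. B v v \<le> 0) \<and> DIM('a) = dim M + pos_index (\<lambda>v. B v v) UNIV"
    if B: "bilinear B" "\<And>u v. B u v = B v u" for B :: "'a \<Rightarrow> 'a \<Rightarrow> real"
  proof -
    have B': "bilinear (\<lambda>u v. - B u v)" by (rule bilinear_uminus[OF B(1)])
    have sym: "- B u v = - B v u" for u v using B(2)[of u v] by simp
    obtain M where M: "subspace M" "M \<subseteq> UNIV" "form_radical (\<lambda>u v. - B u v) UNIV \<subseteq> M"
      "\<And>v. v \<in> M \<Longrightarrow> - B v v \<ge> 0" "\<And>v. v \<in> M \<Longrightarrow> - B v v = 0 \<Longrightarrow> v \<in> form_radical (\<lambda>u v. - B u v) UNIV"
      "dim M = pos_index (\<lambda>v. - B v v) UNIV + dim (form_radical (\<lambda>u v. - B u v) UNIV)"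
      using nonneg_subspace[OF B' subspace_UNIV sym] by blast
    moreover have "form_radical (\<lambda>u v. - B u v) UNIV = form_radical B UNIV" by (auto simp: form_radical_def)
    moreover have "pos_index (\<lambda>v. B v v) UNIV + neg_index (\<lambda>v. B v v) UNIV + dim (form_radical B UNIV) = dim (UNIV::'a set)"
      by (rule sylvester[OF B(1) subspace_UNIV]) (rule B(2))
    ultimately show ?thesis by (intro exI[of _ M]) (auto simp: neg_index_eq)
  qed
  obtain M where M: "subspace M" "\<forall>v\<in>M. P v v \<le> 0" "DIM('a) = dim M + pos_index (\<lambda>v. P v v) UNIV"
    using *[OF P] by blast
  obtain N where N: "subspace N" "\<forall>v\<in>N. Q v v \<le> 0" "DIM('a) = dim N + pos_index (\<lambda>v. Q v v) UNIV"
    using *[OF Q] by blast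
  obtain U where U: "subspace U" "\<And>u. u \<in> U \<Longrightarrow> u \<noteq> 0 \<Longrightarrow> P u u + Q u u > 0"
    "dim U = pos_index (\<lambda>v. P v v + Q v v) UNIV"
    using pos_index_witness_UNIV[of "\<lambda>v. P v v + Q v v"] by blast
  have "dim (ssum M N) + dim (M \<inter> N) = dim M + dim N" using dim_ssum[OF M(1) N(1)] .
  moreover have "dim (ssum M N) \<le> DIM('a)" by (rule dim_subset_UNIV)
  moreover have "dim U + dim (M \<inter> N) \<le> dim (UNIV :: 'a set)"
  proof (rule dim_Int_trivial_le[OF U(1) subspace_inter[OF M(1) N(1)] subspace_UNIV])
    show "U \<inter> (M \<inter> N) \<subseteq> {0}" using U(2) M(2) N(2) by fastforce
  qed auto
  ultimately show ?thesis using M(3) N(3) U(3) by simp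
qed

text \<open>This is the origin of the correction term in the final bound. On
  \<open>M \<inter> N\<close> both forms are nonnegative and their sum vanishes only on the common
  radical, so a complement of that radical is positive for the sum. Writing both intersections
  through sums of subspaces brings in the dimension of the sum of the radicals.\<close>

lemma pos_index_add_ge:
  fixes P Q :: "'a::euclidean_space \<Rightarrow> 'a \<Rightarrow> real"
  assumes P: "bilinear P" "\<And>u v. P u v = P v u" and Q: "bilinear Q" "\<And>u v. Q u v = Q v u"
  shows "pos_index (\<lambda>v. P v v) UNIV + pos_index (\<lambda>v. Q v v) UNIV + dim (ssum (form_radical P UNIV) (form_radical Q UNIV))
     \<le> pos_index (\<lambda>v. P v v + Q v v) UNIV + DIM('a)"
proof -
  let ?R = "form_radical P UNIV" and ?S = "form_radical Q UNIV"
  have R: "subspace ?R" "subspace ?S" using P Q by (auto intro: subspace_radical)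
  obtain M where M: "subspace M" "M \<subseteq> UNIV" "?R \<subseteq> M" "\<And>v. v \<in> M \<Longrightarrow> P v v \<ge> 0"
    "\<And>v. v \<in> M \<Longrightarrow> P v v = 0 \<Longrightarrow> v \<in> ?R" "dim M = pos_index (\<lambda>v. P v v) UNIV + dim ?R"
    using nonneg_subspace[OF P(1) subspace_UNIV P(2)] by blast
  obtain N where N: "subspace N" "N \<subseteq> UNIV" "?S \<subseteq> N" "\<And>v. v \<in> N \<Longrightarrow> Q v v \<ge> 0"
    "\<And>v. v \<in> N \<Longrightarrow> Q v v = 0 \<Longrightarrow> v \<in> ?S" "dim N = pos_index (\<lambda>v. Q v v) UNIV + dim ?S"
    using nonneg_subspace[OF Q(1) subspace_UNIV Q(2)] by blast
  let ?I = "?R \<inter> ?S"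
  define D where "D = {v\<in>M \<inter> N. \<forall>x\<in>?I. orthogonal x v}"
  have MN: "subspace (M \<inter> N)" using M N by (simp add: subspace_inter)
  have "dim D + dim ?I = dim (M \<inter> N)"
    unfolding D_def by (rule dim_subspace_orthogonal_to_vectors) (use M N R MN in \<open>auto intro: subspace_inter\<close>)
  moreover have "dim D \<le> pos_index (\<lambda>v. P v v + Q v v) UNIV"
  proof (rule pos_index_ge)
    show "subspace D"
      using MN unfolding D_def subspace_def orthogonal_def by (auto simp: inner_add_right)
    fix u assume u: "u \<in> D" "u \<noteq> 0"
    then have uM: "u \<in> M" "u \<in> N" by (auto simp: D_def)
    have "\<not> (P u u = 0 \<and> Q u u = 0)"
    proof
      assume "P u u = 0 \<and> Q u u = 0"
      then have "u \<in> ?I" using M(5) N(5) uM by blast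
      then have "orthogonal u u" using u by (auto simp: D_def)
      then show False using u by (simp add: orthogonal_def)
    qed
    then show "0 < P u u + Q u u" using M(4)[OF uM(1)] N(4)[OF uM(2)] by linarith
  qed auto
  moreover have "dim (ssum M N) + dim (M \<inter> N) = dim M + dim N" using dim_ssum[OF M(1) N(1)] .
  moreover have "dim (ssum ?R ?S) + dim ?I = dim ?R + dim ?S" using dim_ssum[OF R] .
  moreover have "dim (ssum M N) \<le> DIM('a)" by (rule dim_subset_UNIV)
  ultimately show ?thesis using M(6) N(6) by linarith
qed

section \<open>Inertia indices under perturbation\<close>

lemma pos_def_lower_bound:
  fixes G :: "'a::euclidean_space \<Rightarrow> 'a \<Rightarrow> real"
  assumes G: "bilinear G" and U: "subspace U" and pos: "\<And>u. u \<in> U \<Longrightarrow> u \<noteq> 0 \<Longrightarrow> G u u > 0"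
  obtains c where "c > 0" "\<And>u. u \<in> U \<Longrightarrow> c * (norm u)\<^sup>2 \<le> G u u"
proof -
  let ?S = "sphere 0 1 \<inter> U"
  have "\<exists>c>0. \<forall>x\<in>?S. c \<le> G x x"
  proof (cases "?S = {}")
    \<comment> \<open>Here \<open>U\<close> is zero and any positive constant will do.\<close>
    case True then show ?thesis by (intro exI[of _ 1]) auto
  next
    case False
    have "compact ?S" using closed_subspace[OF U] by (intro compact_Int_closed) auto
    moreover have "continuous_on ?S (\<lambda>x. G x x)"
      by (rule bilinear_continuous_on_compose[OF continuous_on_id continuous_on_id G])
    ultimately have "\<exists>z\<in>?S. \<forall>x\<in>?S. G z z \<le> G x x"
      using continuous_attains_inf[OF _ False] by blast
    then obtain z where z: "z \<in> ?S" "\<forall>x\<in>?S. G z z \<le> G x x" by blast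
    then have "z \<noteq> 0" by auto
    then have "G z z > 0" using pos[of z] z by blast
    then show ?thesis using z(2) by blast
  qed
  then obtain c where c: "c > 0" "\<And>x. x \<in> ?S \<Longrightarrow> c \<le> G x x" by blast
  have "c * (norm u)\<^sup>2 \<le> G u u" if u: "u \<in> U" for u
  proof (cases "u = 0")
    case False
    define x where "x = (1 / norm u) *\<^sub>R u"
    have "x \<in> ?S" using u U False by (auto simp: x_def subspace_scale)
    moreover have ux: "norm u *\<^sub>R x = u" using False by (simp add: x_def)
    have "G (norm u *\<^sub>R x) (norm u *\<^sub>R x) = (norm u)\<^sup>2 * G x x"
      by (simp only: bilinear_simps[OF G] power2_eq_square real_scaleR_def mult.assoc)
    then have "G u u = (norm u)\<^sup>2 * G x x" unfolding ux .
    ultimately show ?thesis using c(2)[of x] by (metis mult.commute mult_left_mono zero_le_power2)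
  qed (simp add: bilinear_simps[OF G])
  then show thesis using that c(1) by blast
qed

text \<open>On an orthonormal basis finitely many entries converge, which bounds the difference of
  the forms uniformly on the unit sphere, while a positive form is bounded away from 0 there.
  Convergence is asked on \<open>U\<close> alone, because rescaled forms can be expected to converge
  only on suitable subspaces.\<close>

lemma pos_def_eventually:
  fixes G :: "'a::euclidean_space \<Rightarrow> 'a \<Rightarrow> real"
  assumes G: "bilinear G" and Gi: "eventually (\<lambda>i. bilinear (H i)) F" and U: "subspace U"
    and conv: "\<And>x y. x \<in> U \<Longrightarrow> y \<in> U \<Longrightarrow> ((\<lambda>i. H i x y) \<longlongrightarrow> G x y) F"
    and pos: "\<And>u. u \<in> U \<Longrightarrow> u \<noteq> 0 \<Longrightarrow> G u u > 0"
  shows "eventually (\<lambda>i. \<forall>u\<in>U. u \<noteq> 0 \<longrightarrow> H i u u > 0) F"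
proof -
  obtain B where B: "B \<subseteq> U" "pairwise orthogonal B" "\<And>x. x \<in> B \<Longrightarrow> norm x = 1"
    "independent B" "span B = U"
    using orthonormal_basis_subspace[OF U] by metis
  have fB: "finite B" using B(4) independent_bound by blast
  have exp: "(\<Sum>b\<in>B. (x \<bullet> b) *\<^sub>R b) = x" if "x \<in> U" for x
    by (rule orthonormal_basis_expand) (use B that fB in auto)
  have formula: "A x x = (\<Sum>b\<in>B. \<Sum>c\<in>B. (x \<bullet> b) * (x \<bullet> c) * A b c)" if A: "bilinear A" and "x \<in> U"
    for A :: "'a \<Rightarrow> 'a \<Rightarrow> real" and x
  proof -
    have "A x x = A (\<Sum>b\<in>B. (x \<bullet> b) *\<^sub>R b) (\<Sum>b\<in>B. (x \<bullet> b) *\<^sub>R b)" using exp[OF \<open>x \<in> U\<close>] by simp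
    also have "\<dots> = (\<Sum>(b,c)\<in>B \<times> B. A ((x \<bullet> b) *\<^sub>R b) ((x \<bullet> c) *\<^sub>R c))"
      by (rule bilinear_sum[OF A])
    also have "\<dots> = (\<Sum>b\<in>B. \<Sum>c\<in>B. (x \<bullet> b) * (x \<bullet> c) * A b c)"
      by (simp add: sum.cartesian_product bilinear_simps[OF A] mult_ac)
    finally show ?thesis .
  qed
  define \<epsilon> where "\<epsilon> i = (\<Sum>b\<in>B. \<Sum>c\<in>B. \<bar>H i b c - G b c\<bar>)" for i
  have "(\<epsilon> \<longlongrightarrow> (\<Sum>b\<in>B. \<Sum>c\<in>B. \<bar>G b c - G b c\<bar>)) F"
    unfolding \<epsilon>_def by (intro tendsto_sum tendsto_rabs tendsto_diff conv tendsto_const) (use B in auto)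
  then have \<epsilon>: "(\<epsilon> \<longlongrightarrow> 0) F" by simp
  have bound: "\<bar>H i x x - G x x\<bar> \<le> \<epsilon> i" if "bilinear (H i)" "x \<in> U" "norm x = 1" for i x
  proof -
    have "\<bar>H i x x - G x x\<bar> = \<bar>\<Sum>b\<in>B. \<Sum>c\<in>B. (x \<bullet> b) * (x \<bullet> c) * (H i b c - G b c)\<bar>"
      using formula[OF that(1,2)] formula[OF G that(2)]
      by (simp add: sum_subtractf algebra_simps)
    also have "\<dots> \<le> (\<Sum>b\<in>B. \<Sum>c\<in>B. \<bar>(x \<bullet> b) * (x \<bullet> c) * (H i b c - G b c)\<bar>)"
      by (rule order_trans[OF sum_abs]) (intro sum_mono sum_abs)
    also have "\<dots> \<le> \<epsilon> i"
      unfolding \<epsilon>_def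
    proof (intro sum_mono)
      fix b c assume "b \<in> B" "c \<in> B"
      then have "\<bar>x \<bullet> b\<bar> \<le> 1" "\<bar>x \<bullet> c\<bar> \<le> 1"
        using Cauchy_Schwarz_ineq2[of x b] Cauchy_Schwarz_ineq2[of x c] B(3) that(3) by auto
      then have "\<bar>x \<bullet> b\<bar> * \<bar>x \<bullet> c\<bar> \<le> 1" by (simp add: mult_le_one)
      then show "\<bar>(x \<bullet> b) * (x \<bullet> c) * (H i b c - G b c)\<bar> \<le> \<bar>H i b c - G b c\<bar>"
        by (simp add: abs_mult mult_left_le_one_le)
    qed
    finally show ?thesis .
  qed
  obtain c where c: "c > 0" "\<And>u. u \<in> U \<Longrightarrow> c * (norm u)\<^sup>2 \<le> G u u"
    using pos_def_lower_bound[OF G U pos] by blast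
  have "eventually (\<lambda>i. \<epsilon> i < c) F" using \<epsilon> c(1) by (rule order_tendstoD(2))
  with Gi show ?thesis
  proof eventually_elim
    case (elim i)
    show ?case
    proof (intro ballI impI)
      fix u assume u: "u \<in> U" "u \<noteq> 0"
      define x where "x = (1 / norm u) *\<^sub>R u"
      have x: "x \<in> U" "norm x = 1" using u U by (auto simp: x_def subspace_scale)
      then have "H i x x > 0" using bound[OF elim(1) x] elim(2) c(2)[of x] by auto
      moreover have "H i x x = (1 / norm u)^2 * H i u u"
        by (simp add: x_def bilinear_simps[OF elim(1)] power2_eq_square)
      ultimately show "H i u u > 0" by (simp add: zero_less_mult_iff)
    qed
  qed
qed

text \<open>Positivity on a fixed subspace is an open condition, so passing to the limit may lower
  the index but cannot raise it.\<close>

lemma pos_index_lsc: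
  fixes S0 :: "'a::euclidean_space \<Rightarrow> 'a \<Rightarrow> real"
  assumes "bilinear S0" "eventually (\<lambda>i. bilinear (S i)) F" "\<And>x y. ((\<lambda>i. S i x y) \<longlongrightarrow> S0 x y) F"
  shows "eventually (\<lambda>i. pos_index (\<lambda>v. S0 v v) UNIV \<le> pos_index (\<lambda>v. S i v v) UNIV) F"
proof -
  obtain U where U: "subspace U" "\<And>u. u \<in> U \<Longrightarrow> u \<noteq> 0 \<Longrightarrow> S0 u u > 0"
    "dim U = pos_index (\<lambda>v. S0 v v) UNIV"
    using pos_index_witness_UNIV[of "\<lambda>v. S0 v v"] by blast
  have "eventually (\<lambda>i. \<forall>u\<in>U. u \<noteq> 0 \<longrightarrow> S i u u > 0) F"
    by (rule pos_def_eventually[OF assms(1,2) U(1) assms(3) U(2)])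
  then show ?thesis
  proof eventually_elim
    case (elim i)
    have "dim U \<le> pos_index (\<lambda>v. S i v v) UNIV"
      by (rule pos_index_ge[OF U(1)]) (use elim in auto)
    then show ?case using U(3) by simp
  qed
qed

text \<open>Rescaling \<open>K\<close> by \<open>1 / sqrt h\<close> makes the forms converge on \<open>U \<times> V\<close>, because the mixed terms are
  only of order \<open>sqrt h\<close>.\<close>

lemma pos_index_jump_ge:
  fixes S0 :: "'a::euclidean_space \<Rightarrow> 'a \<Rightarrow> real"
  assumes S0: "bilinear S0" and S: "eventually (\<lambda>i. bilinear (S i) \<and> (\<forall>u v. S i u v = S i v u)) F"
    and conv: "\<And>x y. ((\<lambda>i. S i x y) \<longlongrightarrow> S0 x y) F"
    and K: "subspace K" "K \<subseteq> form_radical S0 UNIV"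
    and h: "eventually (\<lambda>i. h i > 0) F" "(h \<longlongrightarrow> 0) F"
    and C: "bilinear C" and Cconv: "\<And>k u. k \<in> K \<Longrightarrow> ((\<lambda>i. S i k u / h i) \<longlongrightarrow> C k u) F"
  shows "eventually (\<lambda>i. pos_index (\<lambda>v. S0 v v) UNIV + pos_index (\<lambda>v. C v v) K
      \<le> pos_index (\<lambda>v. S i v v) UNIV) F"
proof -
  obtain U where U: "subspace U" "\<And>u. u \<in> U \<Longrightarrow> u \<noteq> 0 \<Longrightarrow> S0 u u > 0"
    "dim U = pos_index (\<lambda>v. S0 v v) UNIV"
    using pos_index_witness_UNIV[of "\<lambda>v. S0 v v"] by blast
  obtain V where V: "subspace V" "V \<subseteq> K" "\<And>u. u \<in> V \<Longrightarrow> u \<noteq> 0 \<Longrightarrow> C u u > 0"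
    "dim V = pos_index (\<lambda>v. C v v) K"
    using pos_index_witness[of K "\<lambda>v. C v v"] subspace_0[OF K(1)] by blast
  define f where "f i z = fst z + (1 / sqrt (h i)) *\<^sub>R snd z" for i and z :: "'a \<times> 'a"
  define G where "G z z' = S0 (fst z) (fst z') + C (snd z) (snd z')" for z z'
  have linf: "linear (f i)" for i
    by (rule linearI) (auto simp: f_def algebra_simps)
  have "eventually (\<lambda>i. \<forall>z\<in>U \<times> V. z \<noteq> 0 \<longrightarrow> S i (f i z) (f i z) > 0) F"
  proof (rule pos_def_eventually[where G = G and H = "\<lambda>i x y. S i (f i x) (f i y)"])
    show "bilinear G"
      unfolding bilinear_def G_def
      by (auto intro!: linearI simp: bilinear_simps[OF S0] bilinear_simps[OF C] algebra_simps)
    show "eventually (\<lambda>i. bilinear (\<lambda>x y. S i (f i x) (f i y))) F"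
      using S
    proof eventually_elim
      case (elim i)
      then show ?case using linf[of i]
        unfolding bilinear_def by (auto intro!: linear_compose[unfolded o_def, OF linf])
    qed
    show "subspace (U \<times> V)" using U V by (simp add: subspace_Times)
    show "0 < G u u" if "u \<in> U \<times> V" "u \<noteq> 0" for u
    proof -
      have "S0 (fst u) (fst u) \<ge> 0" "C (snd u) (snd u) \<ge> 0"
        using that U(2)[of "fst u"] V(3)[of "snd u"]
        by (cases "fst u = 0"; cases "snd u = 0"; auto simp: bilinear_simps[OF S0] bilinear_simps[OF C])+
      moreover have "S0 (fst u) (fst u) > 0 \<or> C (snd u) (snd u) > 0"
        using that U(2)[of "fst u"] V(3)[of "snd u"] by (cases u) (auto simp: zero_prod_def)
      ultimately show ?thesis by (auto simp: G_def)
    qed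
    fix x y assume xy: "x \<in> U \<times> V" "y \<in> U \<times> V"
    obtain u k u' k' where x: "x = (u, k)" "y = (u', k')" "k \<in> K" "k' \<in> K"
      using xy V(2) by (cases x; cases y) auto
    have sq: "((\<lambda>i. sqrt (h i)) \<longlongrightarrow> 0) F" using tendsto_real_sqrt[OF h(2)] by simp
    have "((\<lambda>i. S i u u' + sqrt (h i) * (S i k' u / h i) + sqrt (h i) * (S i k u' / h i) + S i k k' / h i)
        \<longlongrightarrow> S0 u u' + 0 * C k' u + 0 * C k u' + C k k') F"
      by (intro tendsto_add tendsto_mult conv Cconv sq x)
    then have "((\<lambda>i. S i u u' + sqrt (h i) * (S i k' u / h i) + sqrt (h i) * (S i k u' / h i) + S i k k' / h i)
        \<longlongrightarrow> G x y) F" by (simp add: G_def x)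
    then show "((\<lambda>i. S i (f i x) (f i y)) \<longlongrightarrow> G x y) F"
    proof (rule Lim_transform_eventually)
      show "eventually (\<lambda>i. S i u u' + sqrt (h i) * (S i k' u / h i) + sqrt (h i) * (S i k u' / h i) + S i k k' / h i
         = S i (f i x) (f i y)) F"
        using S h(1)
      proof eventually_elim
        case (elim i)
        have a: "sqrt (h i) * (t / h i) = t / sqrt (h i)" for t
          using elim(2) by (simp add: field_simps)
        have "S i u k' = S i k' u" using elim by blast
        with elim show ?case
          unfolding a by (simp add: x f_def bilinear_simps)
      qed
    qed
  qed
  with h(1) show ?thesis
  proof eventually_elim
    case (elim i)
    have "inj_on (f i) (U \<times> V)"
    proof (rule linear_injective_on_subspace_0[OF linf, THEN iffD2])
      show "subspace (U \<times> V)" using U V by (simp add: subspace_Times)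
      have UV: "U \<inter> V \<subseteq> {0}" using U(2) V(2) K(2) unfolding form_radical_def by fastforce
      show "\<forall>z\<in>U \<times> V. f i z = 0 \<longrightarrow> z = 0"
      proof safe
        fix u v assume uv: "u \<in> U" "v \<in> V" "f i (u, v) = 0"
        then have e: "u = - (1 / sqrt (h i)) *\<^sub>R v" by (simp add: f_def eq_neg_iff_add_eq_0)
        then have "u \<in> V" using uv V(1) by (simp add: subspace_neg subspace_scale)
        then have "u = 0" using uv UV by auto
        then show "(u, v) = 0" using e elim(1) by (auto simp: zero_prod_def)
      qed
    qed
    then have "dim (f i ` (U \<times> V)) = dim (U \<times> V)"
      by (rule dim_image_subspace[OF linf subspace_Times[OF U(1) V(1)]])
    moreover have "dim (f i ` (U \<times> V)) \<le> pos_index (\<lambda>v. S i v v) UNIV"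
    proof (rule pos_index_ge)
      show "subspace (f i ` (U \<times> V))" using linf U V by (intro linear_subspace_image subspace_Times) auto
      fix u assume "u \<in> f i ` (U \<times> V)" "u \<noteq> 0"
      then obtain z where z: "z \<in> U \<times> V" "u = f i z" by blast
      then have "z \<noteq> 0" using \<open>u \<noteq> 0\<close> linear_0[OF linf] by metis
      then show "0 < S i u u" using bspec[OF elim(2) z(1)] z(2) by simp
    qed auto
    ultimately show ?case using U V by (simp add: dim_Times)
  qed
qed

text \<open>The jump estimate bounds the positive index from below, and applied to the negated forms
  it does so for the negative index. \<open>R\<close> is the part of the radical that persists and
  \<open>K\<close> the part that splits up. Counted by Sylvester's law, these lower bounds exhaust
  the dimension, so all of them are equalities.\<close>

lemma index_jump:
  fixes S0 :: "'a::euclidean_space \<Rightarrow> 'a \<Rightarrow> real"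
  assumes S0: "bilinear S0" "\<And>u v. S0 u v = S0 v u"
    and S: "eventually (\<lambda>i. bilinear (S i) \<and> (\<forall>u v. S i u v = S i v u)) F"
    and conv: "\<And>x y. ((\<lambda>i. S i x y) \<longlongrightarrow> S0 x y) F"
    and K: "subspace K" "K \<subseteq> form_radical S0 UNIV"
    and h: "eventually (\<lambda>i. h i > 0) F" "(h \<longlongrightarrow> 0) F"
    and C: "bilinear C" "\<And>u v. u \<in> K \<Longrightarrow> v \<in> K \<Longrightarrow> C u v = C v u" "form_radical C K \<subseteq> {0}"
    and Cconv: "\<And>k u. k \<in> K \<Longrightarrow> ((\<lambda>i. S i k u / h i) \<longlongrightarrow> C k u) F"
    and R: "eventually (\<lambda>i. R \<subseteq> form_radical (S i) UNIV) F" "dim (form_radical S0 UNIV) = dim R + dim K"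
  shows "eventually (\<lambda>i. pos_index (\<lambda>v. S i v v) UNIV = pos_index (\<lambda>v. S0 v v) UNIV + pos_index (\<lambda>v. C v v) K
     \<and> dim (form_radical (S i) UNIV) = dim R) F"
proof -
  have p: "eventually (\<lambda>i. pos_index (\<lambda>v. S0 v v) UNIV + pos_index (\<lambda>v. C v v) K
      \<le> pos_index (\<lambda>v. S i v v) UNIV) F"
    by (rule pos_index_jump_ge[OF S0(1) S conv K h C(1) Cconv])
  have m: "eventually (\<lambda>i. pos_index (\<lambda>v. - S0 v v) UNIV + pos_index (\<lambda>v. - C v v) K
      \<le> pos_index (\<lambda>v. - S i v v) UNIV) F"
  proof (rule pos_index_jump_ge[where h = h and ?S0.0 = "\<lambda>u v. - S0 u v" and S = "\<lambda>i u v. - S i u v"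
        and C = "\<lambda>u v. - C u v"])
    show "eventually (\<lambda>i. bilinear (\<lambda>u v. - S i u v) \<and> (\<forall>u v. - S i u v = - S i v u)) F"
      using S by eventually_elim (auto intro: bilinear_uminus)
    show "((\<lambda>i. - S i k u / h i) \<longlongrightarrow> - C k u) F" if "k \<in> K" for k u
      using tendsto_minus[OF Cconv[OF that]] by simp
    show "bilinear (\<lambda>u v. - S0 u v)" "bilinear (\<lambda>u v. - C u v)"
      using S0(1) C(1) by (simp_all add: bilinear_uminus)
    show "((\<lambda>i. - S i x y) \<longlongrightarrow> - S0 x y) F" for x y by (rule tendsto_minus[OF conv])
    show "K \<subseteq> form_radical (\<lambda>u v. - S0 u v) UNIV" using K(2) by (simp add: form_radical_def)
  qed (fact K(1) h)+
  have e0: "pos_index (\<lambda>v. S0 v v) UNIV + neg_index (\<lambda>v. S0 v v) UNIV + dim (form_radical S0 UNIV) = DIM('a)"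
    using sylvester[OF S0(1) subspace_UNIV S0(2)] by simp
  have eC: "pos_index (\<lambda>v. C v v) K + neg_index (\<lambda>v. C v v) K + dim (form_radical C K) = dim K"
    using sylvester[OF C(1) K(1) C(2)] by simp
  have "dim (form_radical C K) = 0" using C(3) dim_eq_0 by blast
  show ?thesis
    using p m S R(1)
  proof eventually_elim
    case (elim i)
    have "pos_index (\<lambda>v. S i v v) UNIV + neg_index (\<lambda>v. S i v v) UNIV + dim (form_radical (S i) UNIV) = DIM('a)"
      using sylvester[of "S i" UNIV] elim(3) by simp
    moreover have "dim R \<le> dim (form_radical (S i) UNIV)" using elim(4) by (rule dim_subset)
    ultimately show ?case using elim(1,2) e0 eC \<open>dim (form_radical C K) = 0\<close> R(2)
      unfolding neg_index_eq by linarith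
  qed
qed

subsection \<open>Graph forms and the Kashiwara form\<close>

locale symplectic_space =
  fixes \<omega> :: "'v::euclidean_space \<Rightarrow> 'v \<Rightarrow> real" and n :: nat
  assumes symplectic: "symplectic_form \<omega>" and dimV: "DIM('v) = 2 * n"
begin

abbreviation "lag \<equiv> lagrangian \<omega> n"

lemma bil: "bilinear \<omega>" and skew: "\<omega> u v = - \<omega> v u"
  and nondeg: "(\<And>v. \<omega> u v = 0) \<Longrightarrow> u = 0"
proof -
  note s = symplectic[unfolded symplectic_form_def]
  show "bilinear \<omega>" by (rule conjunct1[OF s])
  show "\<omega> u v = - \<omega> v u" by (rule conjunct1[OF conjunct2[OF s], rule_format])
  show "u = 0" if "\<And>v. \<omega> u v = 0" by (rule conjunct2[OF conjunct2[OF s], rule_format]) (rule that)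
qed

lemmas \<omega>_simps = bilinear_simps[OF bil]

lemma \<omega>_self [simp]: "\<omega> v v = 0" using skew[of v v] by simp

lemma lag_subspace: "lag L \<Longrightarrow> subspace L" and lag_dim: "lag L \<Longrightarrow> dim L = n"
  and lag_iso: "lag L \<Longrightarrow> u \<in> L \<Longrightarrow> v \<in> L \<Longrightarrow> \<omega> u v = 0"
  by (auto simp: lagrangian_def)

definition transv :: "'v set \<Rightarrow> 'v set \<Rightarrow> bool" where
  "transv W L \<longleftrightarrow> lag W \<and> lag L \<and> W \<inter> L = {0}"

lemma transv_sym: "transv W L \<Longrightarrow> transv L W" by (auto simp: transv_def)

lemma transv_lag: "transv W L \<Longrightarrow> lag W" "transv W L \<Longrightarrow> lag L" by (auto simp: transv_def)

lemma transv_ssum: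
  assumes "transv W L" shows "ssum W L = UNIV"
proof -
  have s: "subspace W" "subspace L" and d: "dim W = n" "dim L = n"
    using assms by (auto simp: transv_def lag_subspace lag_dim)
  have "dim (W \<inter> L) = 0" using assms by (simp add: transv_def)
  then have "dim (ssum W L) = DIM('v)" using dim_ssum[OF s] d dimV by linarith
  then show ?thesis using subspace_ssum[OF s] by (metis dim_eq_full span_eq_iff)
qed

text \<open>Minus the projection to \<open>W\<close> along \<open>L\<close>. It occurs verbatim as
  the description inside \<open>crossing_form\<close>.\<close>

definition wpart :: "'v set \<Rightarrow> 'v set \<Rightarrow> 'v \<Rightarrow> 'v" where
  "wpart W L v = (THE w. w \<in> W \<and> v + w \<in> L)"

lemma wpart_eq:
  assumes "transv W L" "w \<in> W" "v + w \<in> L" shows "wpart W L v = w"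
  unfolding wpart_def
proof (rule the_equality)
  fix w' assume w': "w' \<in> W \<and> v + w' \<in> L"
  have s: "subspace W" "subspace L" using assms by (auto simp: transv_def lag_subspace)
  have "(v + w') - (v + w) \<in> L" using s w' assms by (metis subspace_diff)
  then have "w' - w \<in> W \<inter> L" using s w' assms by (simp add: subspace_diff)
  moreover have "W \<inter> L = {0}" using assms by (simp add: transv_def)
  ultimately have "w' - w = 0" by blast
  then show "w' = w" by simp
qed (use assms in auto)

lemma wpart_mem:
  assumes "transv W L" shows "wpart W L v \<in> W" "v + wpart W L v \<in> L"
proof -
  have s: "subspace W" using assms by (auto simp: transv_def lag_subspace)
  have "v \<in> ssum W L" using transv_ssum[OF assms] by simp
  then obtain w l where wl: "v = w + l" "w \<in> W" "l \<in> L" by (auto simp: ssum_def)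
  then have "wpart W L v = - w" using s by (intro wpart_eq[OF assms]) (auto simp: subspace_neg)
  then show "wpart W L v \<in> W" "v + wpart W L v \<in> L" using wl s by (auto simp: subspace_neg)
qed

lemma wpart_linear: assumes "transv W L" shows "linear (wpart W L)"
proof -
  have s: "subspace W" "subspace L" using assms by (auto simp: transv_def lag_subspace)
  show ?thesis
  proof (rule linearI)
    fix u v :: 'v and c :: real
    have "(u + wpart W L u) + (v + wpart W L v) \<in> L"
      using wpart_mem[OF assms] s by (metis subspace_add)
    then show "wpart W L (u + v) = wpart W L u + wpart W L v"
      using wpart_mem(1)[OF assms] s by (intro wpart_eq[OF assms]) (auto simp: subspace_add algebra_simps)
    have "c *\<^sub>R (v + wpart W L v) \<in> L" using wpart_mem[OF assms] s by (metis subspace_scale)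
    then show "wpart W L (c *\<^sub>R v) = c *\<^sub>R wpart W L v"
      using wpart_mem(1)[OF assms] s by (intro wpart_eq[OF assms]) (auto simp: subspace_scale algebra_simps)
  qed
qed

lemma wpart_in_W: "transv W L \<Longrightarrow> v \<in> W \<Longrightarrow> wpart W L v = - v"
  by (rule wpart_eq) (simp_all add: transv_def subspace_neg lag_subspace subspace_0)

lemma wpart_in_L: "transv W L \<Longrightarrow> v \<in> L \<Longrightarrow> wpart W L v = 0"
  by (rule wpart_eq) (simp_all add: transv_def lag_subspace subspace_0)

lemma linear_graph: assumes "transv W L" shows "linear (\<lambda>v. v + wpart W L v)"
  by (rule linearI)
    (simp_all add: linear_add[OF wpart_linear[OF assms]] linear_cmul[OF wpart_linear[OF assms]] algebra_simps)

lemma range_graph: assumes "transv W L" shows "range (\<lambda>v. v + wpart W L v) = L"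
proof
  show "range (\<lambda>v. v + wpart W L v) \<subseteq> L" using wpart_mem(2)[OF assms] by auto
  show "L \<subseteq> range (\<lambda>v. v + wpart W L v)"
  proof
    fix v assume "v \<in> L"
    then have "v = v + wpart W L v" using wpart_in_L[OF assms] by simp
    then show "v \<in> range (\<lambda>v. v + wpart W L v)" by (rule range_eqI)
  qed
qed

text \<open>Isotropy of \<open>L\<close> at two graph vectors, with the term inside \<open>W\<close>
  removed by isotropy of \<open>W\<close>. If \<open>u\<close> and \<open>v\<close> lie in a common
  Lagrangian, the defect vanishes and the graph map is symmetric.\<close>

lemma wpart_skew:
  assumes "transv W L" shows "\<omega> u (wpart W L v) = \<omega> v (wpart W L u) - \<omega> u v"
proof -
  have "\<omega> (u + wpart W L u) (v + wpart W L v) = 0" "\<omega> (wpart W L u) (wpart W L v) = 0"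
    using assms wpart_mem[OF assms] by (auto simp: transv_def intro: lag_iso)
  then show ?thesis using skew[of v "wpart W L u"] by (simp add: \<omega>_simps)
qed

text \<open>A Lagrangian transversal to \<open>W\<close> is the graph of a symmetric form over \<open>V/W\<close>; \<open>gform W L M\<close> is
  the difference of the forms of \<open>L\<close> and \<open>M\<close>, pulled back to \<open>V\<close>.\<close>

definition gform :: "'v set \<Rightarrow> 'v set \<Rightarrow> 'v set \<Rightarrow> 'v \<Rightarrow> 'v \<Rightarrow> real" where
  "gform W L M u v = \<omega> u (wpart W L v - wpart W M v)"

lemma gform_bilinear: assumes "transv W L" "transv W M" shows "bilinear (gform W L M)"
proof -
  note w = wpart_linear[OF assms(1)] wpart_linear[OF assms(2)]
  show ?thesis unfolding gform_def bilinear_def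
    by (auto intro!: linearI simp: w[THEN linear_add] w[THEN linear_cmul] \<omega>_simps algebra_simps)
qed

lemma gform_sym: assumes "transv W L" "transv W M" shows "gform W L M u v = gform W L M v u"
  using wpart_skew[OF assms(1), of u v] wpart_skew[OF assms(2), of u v] by (simp add: gform_def \<omega>_simps)

lemma gform_add: "gform W L M u v + gform W M N u v = gform W L N u v"
  by (simp add: gform_def \<omega>_simps)

lemma gform_uminus: "- gform W L M u v = gform W M L u v"
  by (simp add: gform_def \<omega>_simps)

text \<open>Nondegeneracy of the symplectic form turns membership in the radical into equality of
  the two graph maps at \<open>v\<close>; adding their common value to \<open>v\<close> then leads
  into \<open>L \<inter> M\<close>. \<open>W\<close> belongs to the radical because the form lives
  on \<open>V/W\<close>.\<close>

lemma gform_radical: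
  assumes L: "transv W L" and M: "transv W M"
  shows "form_radical (gform W L M) UNIV = ssum W (L \<inter> M)"
proof (intro set_eqI iffI)
  have s: "subspace W" using assms by (auto simp: transv_def lag_subspace)
  fix v assume "v \<in> form_radical (gform W L M) UNIV"
  then have "\<omega> u (wpart W L v - wpart W M v) = 0" for u
    using gform_sym[OF assms] by (auto simp: form_radical_def gform_def)
  then have "\<omega> (wpart W L v - wpart W M v) u = 0" for u using skew[of _ u] by (metis neg_equal_0_iff_equal)
  then have e: "wpart W L v = wpart W M v" using nondeg by (metis right_minus_eq)
  then have "v + wpart W L v \<in> L \<inter> M" "- wpart W L v \<in> W"
    using wpart_mem[OF L, of v] wpart_mem[OF M, of v] s by (auto simp: subspace_neg)
  moreover have "v = - wpart W L v + (v + wpart W L v)" by simp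
  ultimately show "v \<in> ssum W (L \<inter> M)" unfolding ssum_def by blast
next
  fix v assume "v \<in> ssum W (L \<inter> M)"
  then obtain w x where v: "v = w + x" "w \<in> W" "x \<in> L" "x \<in> M" by (auto simp: ssum_def)
  then have "wpart W L v = wpart W M v"
    using linear_add[OF wpart_linear[OF L], of w x] linear_add[OF wpart_linear[OF M], of w x] wpart_in_W[OF L] wpart_in_W[OF M] wpart_in_L[OF L] wpart_in_L[OF M]
    by simp
  then show "v \<in> form_radical (gform W L M) UNIV"
    using gform_sym[OF assms, of v] by (auto simp: form_radical_def gform_def \<omega>_simps)
qed

lemma dim_ssum_transv:
  assumes "transv W L" "subspace A" "A \<subseteq> L"
  shows "dim (ssum W A) = n + dim A"
proof -
  have s: "subspace W" "dim W = n" using assms by (auto simp: transv_def lag_subspace lag_dim)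
  have "W \<inter> A \<subseteq> {0}" using assms by (auto simp: transv_def)
  then have "dim (W \<inter> A) = 0" using dim_eq_0 by blast
  then show ?thesis using dim_ssum[OF s(1) assms(2)] s(2) by linarith
qed

lemma dim_gform_radical:
  assumes "transv W L" "transv W M"
  shows "dim (form_radical (gform W L M) UNIV) = n + dim (L \<inter> M)"
  unfolding gform_radical[OF assms]
  by (rule dim_ssum_transv[OF assms(1)]) (use assms in \<open>simp_all add: transv_def lag_subspace subspace_inter\<close>)

text \<open>Computed on the whole space instead of \<open>V/W\<close>: enlarging the radical leaves
  a positive index unchanged.\<close>

definition gind :: "'v set \<Rightarrow> 'v set \<Rightarrow> 'v set \<Rightarrow> nat" where
  "gind W L M = pos_index (\<lambda>v. gform W L M v v) UNIV"

text \<open>Sylvester's law in dimension 2n. The radical contains \<open>W\<close>, which accounts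
  for half of the dimension and leaves n on the right.\<close>

lemma gind_swap:
  assumes "transv W L" "transv W M"
  shows "gind W L M + gind W M L + dim (L \<inter> M) = n"
proof -
  have "pos_index (\<lambda>v. gform W L M v v) UNIV + neg_index (\<lambda>v. gform W L M v v) UNIV
     + dim (form_radical (gform W L M) UNIV) = dim (UNIV :: 'v set)"
    by (rule sylvester[OF gform_bilinear[OF assms] subspace_UNIV gform_sym[OF assms]])
  then show ?thesis
    using dimV by (simp add: dim_gform_radical[OF assms] gind_def neg_index_eq gform_uminus)
qed

text \<open>The graph forms of \<open>X, Y\<close> and of \<open>Y, Z\<close> add up to that of
  \<open>X, Z\<close>. Both radicals contain \<open>W\<close>, which adds n to the dimension of
  their sum and so reduces 2n to n in the second bound.\<close>

lemma gind_triangle: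
  assumes X: "transv W X" and Y: "transv W Y" and Z: "transv W Z"
  shows "gind W X Z \<le> gind W X Y + gind W Y Z"
    and "gind W X Y + gind W Y Z + dim (ssum (X \<inter> Y) (Y \<inter> Z)) \<le> gind W X Z + n"
proof -
  note XY = gform_bilinear[OF X Y] gform_sym[OF X Y] and YZ = gform_bilinear[OF Y Z] gform_sym[OF Y Z]
  show "gind W X Z \<le> gind W X Y + gind W Y Z"
    using pos_index_add_le[OF XY YZ] by (simp add: gind_def gform_add)
  have s: "subspace W" "subspace X" "subspace Y" "subspace Z"
    using X Y Z by (auto simp: transv_def lag_subspace)
  have si: "subspace (X \<inter> Y)" "subspace (Y \<inter> Z)" using s by (auto intro: subspace_inter)
  have sub: "ssum (X \<inter> Y) (Y \<inter> Z) \<subseteq> Y" using s by (intro ssum_subset) auto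
  have "ssum W (ssum (X \<inter> Y) (Y \<inter> Z)) \<subseteq> ssum (ssum W (X \<inter> Y)) (ssum W (Y \<inter> Z))"
  proof
    fix v assume "v \<in> ssum W (ssum (X \<inter> Y) (Y \<inter> Z))"
    then obtain w x y where v: "v = w + (x + y)" "w \<in> W" "x \<in> X \<inter> Y" "y \<in> Y \<inter> Z"
      unfolding ssum_def by blast
    have "w + x \<in> ssum W (X \<inter> Y)" using v unfolding ssum_def by blast
    moreover have "y \<in> ssum W (Y \<inter> Z)" using v s by (intro ssum_mem_right) auto
    moreover have "v = (w + x) + y" using v by simp
    ultimately show "v \<in> ssum (ssum W (X \<inter> Y)) (ssum W (Y \<inter> Z))" unfolding ssum_def[of "ssum W (X \<inter> Y)"] by blast
  qed
  then have "dim (ssum W (ssum (X \<inter> Y) (Y \<inter> Z))) \<le> dim (ssum (ssum W (X \<inter> Y)) (ssum W (Y \<inter> Z)))"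
    by (rule dim_subset)
  moreover have "dim (ssum W (ssum (X \<inter> Y) (Y \<inter> Z))) = n + dim (ssum (X \<inter> Y) (Y \<inter> Z))"
    by (rule dim_ssum_transv[OF Y subspace_ssum[OF si] sub])
  ultimately show "gind W X Y + gind W Y Z + dim (ssum (X \<inter> Y) (Y \<inter> Z)) \<le> gind W X Z + n"
    using pos_index_add_ge[OF XY YZ] dimV
    by (simp add: gind_def gform_add gform_radical[OF X Y] gform_radical[OF Y Z])
qed

section \<open>Kashiwara's form and independence of the base\<close>

text \<open>Kashiwara's form enters through its positive index. No \<open>W\<close> occurs in it,
  and that is the reason for introducing it.\<close>

definition kash :: "'v set \<Rightarrow> 'v set \<Rightarrow> 'v set \<Rightarrow> nat" where
  "kash X Y Z = pos_index (\<lambda>(x, y, z). \<omega> x y + \<omega> y z + \<omega> z x) (X \<times> Y \<times> Z)"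

text \<open>The pairing of \<open>X\<close> with \<open>Y\<close> read in the common chart over
  \<open>V/W\<close>; \<open>p\<close> and \<open>q\<close> stand for classes modulo
  \<open>W\<close>.\<close>

lemma \<omega>_wpart:
  assumes "transv W X" "transv W Y"
  shows "\<omega> (p + wpart W X p) (q + wpart W Y q) = gform W Y X p q"
proof -
  have "\<omega> (wpart W X p) (wpart W Y q) = 0"
    using assms wpart_mem(1)[OF assms(1)] wpart_mem(1)[OF assms(2)] by (auto simp: transv_def intro: lag_iso)
  then show ?thesis
    using wpart_skew[OF assms(1), of p q] skew[of "wpart W X p" q] by (simp add: gform_def \<omega>_simps)
qed

text \<open>The substitution \<open>p = y + z, q = z + x, r = x + y\<close> diagonalises Kashiwara's form because the three
  graph forms add up to zero.\<close>

lemma kash_eq: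
  assumes X: "transv W X" and Y: "transv W Y" and Z: "transv W Z"
  shows "kash X Y Z = gind W Y X + gind W Z Y + gind W X Z"
proof -
  define g where "g V v = v + wpart W V v" for V v
  have ling: "linear (g V)" if "transv W V" for V
    unfolding g_def by (rule linear_graph[OF that])
  have range_g: "range (g V) = V" if "transv W V" for V
    unfolding g_def by (rule range_graph[OF that])
  define f where "f = (\<lambda>(x, y, z). (g X (y + z), g Y (z + x), g Z (x + y)))"
  have linf: "linear f"
  proof (rule linearI)
    fix u v :: "'v \<times> 'v \<times> 'v" and c :: real
    note l = ling[OF X] ling[OF Y] ling[OF Z]
    show "f (u + v) = f u + f v"
      by (simp add: f_def case_prod_beta l[THEN linear_add] algebra_simps)
    show "f (c *\<^sub>R u) = c *\<^sub>R f u"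
      by (simp add: f_def case_prod_beta l[THEN linear_add] l[THEN linear_cmul] algebra_simps)
  qed
  have "range f = X \<times> Y \<times> Z"
  proof
    show "range f \<subseteq> X \<times> Y \<times> Z"
      using range_g[OF X] range_g[OF Y] range_g[OF Z] unfolding f_def by auto
    show "X \<times> Y \<times> Z \<subseteq> range f"
    proof safe
      fix x y z assume xyz: "x \<in> X" "y \<in> Y" "z \<in> Z"
      obtain p where p: "x = g X p" using xyz range_g[OF X] by blast
      obtain q where q: "y = g Y q" using xyz range_g[OF Y] by blast
      obtain r where r: "z = g Z r" using xyz range_g[OF Z] by blast
      have half: "(1/2) *\<^sub>R a + (1/2) *\<^sub>R a = a" for a :: 'v by (simp flip: scaleR_add_left)
      have "f ((1/2) *\<^sub>R (q + r - p), (1/2) *\<^sub>R (r + p - q), (1/2) *\<^sub>R (p + q - r)) = (x, y, z)"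
      proof -
        have "(1/2) *\<^sub>R (a + b - c) + (1/2) *\<^sub>R (c + a - b) = a" for a b c :: 'v
          by (simp add: half flip: scaleR_add_right)
        from this[of p q r] this[of q r p] this[of r p q] show ?thesis
          unfolding f_def p q r by (simp add: add.commute)
      qed
      then show "(x, y, z) \<in> range f" by (rule range_eqI[OF sym])
    qed
  qed
  then have "kash X Y Z = pos_index (\<lambda>(x, y, z). \<omega> x y + \<omega> y z + \<omega> z x) (f ` UNIV)"
    by (simp add: kash_def)
  also have "\<dots> = pos_index (\<lambda>v. (\<lambda>(x, y, z). \<omega> x y + \<omega> y z + \<omega> z x) (f v)) UNIV"
    by (rule pos_index_image[OF linf subspace_UNIV]) (simp add: zero_prod_def)
  also have "\<dots> = pos_index (\<lambda>v. gform W Z Y (fst v) (fst v) + (\<lambda>v. gform W X Z (fst v) (fst v)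
      + gform W Y X (snd v) (snd v)) (snd v)) (UNIV \<times> UNIV)"
    unfolding UNIV_Times_UNIV
  proof (rule pos_index_cong)
    fix v :: "'v \<times> 'v \<times> 'v"
    obtain x y z where v: "v = (x, y, z)" by (cases v) auto
    have "gform W Z Y a b = - gform W Y X a b - gform W X Z a b" for a b
      using gform_add[of W Z Y a b X] gform_uminus[of W X Z a b] by simp
    then show "(\<lambda>(x, y, z). \<omega> x y + \<omega> y z + \<omega> z x) (f v) = gform W Z Y (fst v) (fst v)
       + (\<lambda>v. gform W X Z (fst v) (fst v) + gform W Y X (snd v) (snd v)) (snd v)"
      using gform_sym[OF Y X, of x y] gform_sym[OF Y X, of x z] gform_sym[OF Y X, of y z]
        gform_sym[OF X Z, of x y] gform_sym[OF X Z, of x z] gform_sym[OF X Z, of y z]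
      by (simp add: v f_def g_def \<omega>_wpart X Y Z bilinear_simps[OF gform_bilinear[OF Y X]]
          bilinear_simps[OF gform_bilinear[OF X Z]])
  qed
  also have "\<dots> = gind W Z Y + (gind W X Z + gind W Y X)"
  proof -
    define B where "B u v = gform W X Z (fst u) (fst v) + gform W Y X (snd u) (snd v)" for u v
    have B: "bilinear B" "B u v = B v u" for u v
      using gform_sym[OF X Z, of "fst u" "fst v"] gform_sym[OF Y X, of "snd u" "snd v"]
      by (auto simp: B_def bilinear_def intro!: linearI simp: bilinear_simps[OF gform_bilinear[OF X Z]]
          bilinear_simps[OF gform_bilinear[OF Y X]] algebra_simps)
    have "pos_index (\<lambda>v. gform W Z Y (fst v) (fst v) + B (snd v) (snd v)) (UNIV \<times> UNIV)
       = gind W Z Y + pos_index (\<lambda>v. B v v) UNIV"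
      unfolding gind_def
      by (rule pos_index_prod[OF gform_bilinear[OF Z Y] subspace_UNIV gform_sym[OF Z Y] B(1) subspace_UNIV B(2)])
    moreover have "pos_index (\<lambda>v. B v v) (UNIV \<times> UNIV) = gind W X Z + gind W Y X"
      unfolding gind_def B_def
      by (rule pos_index_prod[OF gform_bilinear[OF X Z] subspace_UNIV gform_sym[OF X Z]
          gform_bilinear[OF Y X] subspace_UNIV gform_sym[OF Y X]])
    ultimately show ?thesis by (simp add: B_def)
  qed
  finally show ?thesis by simp
qed

text \<open>The pairing is nondegenerate because \<open>X\<close> and \<open>W\<close> span the
  space, and its positive and negative indices agree by symmetry, so each is half of 2n.\<close>

lemma pos_index_pairing:
  assumes "transv X W"
  shows "pos_index (\<lambda>z. \<omega> (fst z) (snd z)) (X \<times> W) = n"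
proof -
  have s: "subspace X" "subspace W" "dim X = n" "dim W = n"
    using assms by (auto simp: transv_def lag_subspace lag_dim)
  have sP: "subspace (X \<times> W)" using s by (simp add: subspace_Times)
  define B where "B u v = (\<omega> (fst u) (snd v) + \<omega> (fst v) (snd u)) / 2" for u v
  have B: "bilinear B"
    unfolding B_def bilinear_def by (auto intro!: linearI simp: \<omega>_simps algebra_simps add_divide_distrib)
  have Bq: "B v v = \<omega> (fst v) (snd v)" for v by (simp add: B_def)
  have "form_radical B (X \<times> W) \<subseteq> {0}"
  proof
    fix z assume z: "z \<in> form_radical B (X \<times> W)"
    then have m: "fst z \<in> X" "snd z \<in> W" and r: "\<And>v. v \<in> X \<times> W \<Longrightarrow> B z v = 0"
      by (auto simp: form_radical_def)
    have V: "\<exists>x w. x \<in> X \<and> w \<in> W \<and> v = x + w" for v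
      using transv_ssum[OF assms] unfolding ssum_def by blast
    have "\<omega> (fst z) v = 0" for v
    proof -
      obtain x w where xw: "x \<in> X" "w \<in> W" "v = x + w" using V by blast
      have "B z (0, w) = 0" using r xw s by (simp add: subspace_0)
      then have "\<omega> (fst z) w = 0" by (simp add: B_def \<omega>_simps)
      moreover have "\<omega> (fst z) x = 0" using m xw assms by (auto simp: transv_def intro: lag_iso)
      ultimately show ?thesis using xw by (simp add: \<omega>_simps)
    qed
    moreover have "\<omega> (snd z) v = 0" for v
    proof -
      obtain x w where xw: "x \<in> X" "w \<in> W" "v = x + w" using V by blast
      have "B z (x, 0) = 0" using r xw s by (simp add: subspace_0)
      then have "\<omega> (snd z) x = 0" using skew[of "snd z" x] by (simp add: B_def \<omega>_simps)
      moreover have "\<omega> (snd z) w = 0" using m xw assms by (auto simp: transv_def intro: lag_iso)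
      ultimately show ?thesis using xw by (simp add: \<omega>_simps)
    qed
    ultimately show "z \<in> {0}" using nondeg by (cases z) (auto simp: zero_prod_def)
  qed
  then have "dim (form_radical B (X \<times> W)) = 0" using dim_eq_0 by blast
  moreover have "pos_index (\<lambda>v. B v v) (X \<times> W) + neg_index (\<lambda>v. B v v) (X \<times> W)
      + dim (form_radical B (X \<times> W)) = dim (X \<times> W)"
    by (rule sylvester[OF B sP]) (simp add: B_def)
  moreover have "dim (X \<times> W) = 2 * n" using dim_Times[OF s(1,2)] s by simp
  moreover have "pos_index (\<lambda>v. B v v) (X \<times> W) = neg_index (\<lambda>v. B v v) (X \<times> W)"
  proof -
    \<comment> \<open>Reversing the sign in \<open>W\<close> exchanges positive and negative
      subspaces.\<close>
    define f :: "'v \<times> 'v \<Rightarrow> 'v \<times> 'v" where "f z = (fst z, - snd z)" for z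
    have f: "linear f" by (rule linearI) (auto simp: f_def)
    have im: "f ` (X \<times> W) = X \<times> W"
    proof
      show "f ` (X \<times> W) \<subseteq> X \<times> W" using s by (auto simp: f_def subspace_neg)
      show "X \<times> W \<subseteq> f ` (X \<times> W)"
      proof
        fix z assume "z \<in> X \<times> W"
        then have "f z \<in> X \<times> W" "z = f (f z)" using s by (auto simp: f_def subspace_neg)
        then show "z \<in> f ` (X \<times> W)" by (metis image_eqI)
      qed
    qed
    have "pos_index (\<lambda>v. B v v) (f ` (X \<times> W)) = pos_index (\<lambda>v. B (f v) (f v)) (X \<times> W)"
      by (rule pos_index_image[OF f sP]) (simp add: bilinear_simps[OF B])
    then show ?thesis unfolding im neg_index_eq by (simp add: f_def B_def \<omega>_simps)
  qed
  ultimately have "pos_index (\<lambda>v. B v v) (X \<times> W) = n" by linarith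
  then show ?thesis by (simp only: Bq)
qed

text \<open>The case in which the third Lagrangian is \<open>W\<close> itself, so that
  \<open>W\<close> is no longer transversal to all three. Writing the middle entry as the graph
  vector of \<open>x + d\<close> and shifting the last one splits the form into the graph form on
  \<open>X\<close> and the pairing of \<open>d\<close> with \<open>w\<close>; this hyperbolic part
  contributes n. Computing the same number over another base is what compares two bases
  later.\<close>

lemma gind_eq_kash:
  assumes X: "transv W X" and Y: "transv W Y"
  shows "kash X Y W = gind W Y X + n"
proof -
  have s: "subspace X" "subspace W" "subspace Y" using assms by (auto simp: transv_def lag_subspace)
  let ?w = "wpart W Y"
  have lw: "linear ?w" by (rule wpart_linear[OF Y])
  define f where "f = (\<lambda>(x, d, w). (x, (x + d) + ?w (x + d), w - ?w x))"
  have linf: "linear f"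
    unfolding f_def by (intro linearI) (auto simp: linear_add[OF lw] linear_cmul[OF lw] algebra_simps)
  have im: "f ` (X \<times> X \<times> W) = X \<times> Y \<times> W"
  proof
    show "f ` (X \<times> X \<times> W) \<subseteq> X \<times> Y \<times> W"
      using wpart_mem[OF Y] s by (auto simp: f_def subspace_diff)
    show "X \<times> Y \<times> W \<subseteq> f ` (X \<times> X \<times> W)"
    proof safe
      fix x y w assume h: "x \<in> X" "y \<in> Y" "w \<in> W"
      define x' where "x' = y + wpart W X y"
      have x': "x' \<in> X" "wpart W X y \<in> W" using wpart_mem[OF X] by (auto simp: x'_def)
      have "?w x' = - wpart W X y" using x' s h
        by (intro wpart_eq[OF Y]) (auto simp: x'_def subspace_neg)
      then have "f (x, x' - x, w + ?w x) = (x, y, w)" by (simp add: f_def x'_def)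
      moreover have "(x, x' - x, w + ?w x) \<in> X \<times> X \<times> W"
        using h x' s wpart_mem[OF Y] by (auto simp: subspace_diff subspace_add)
      ultimately show "(x, y, w) \<in> f ` (X \<times> X \<times> W)" by (metis image_eqI)
    qed
  qed
  define S where "S u v = \<omega> u (?w v)" for u v
  have S: "bilinear S" unfolding S_def bilinear_def
    by (auto intro!: linearI simp: linear_add[OF lw] linear_cmul[OF lw] \<omega>_simps)
  have Ssym: "S u v = S v u" if "u \<in> X" "v \<in> X" for u v
    using wpart_skew[OF Y, of u v] lag_iso[OF transv_lag(2)[OF X] that] by (simp add: S_def)
  define B where "B u v = (\<omega> (fst u) (snd v) + \<omega> (fst v) (snd u)) / 2" for u v
  have B: "bilinear B"
    unfolding B_def bilinear_def by (auto intro!: linearI simp: \<omega>_simps algebra_simps add_divide_distrib)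
  have "kash X Y W = pos_index (\<lambda>(x, y, z). \<omega> x y + \<omega> y z + \<omega> z x) (f ` (X \<times> X \<times> W))"
    by (simp add: kash_def im)
  also have "\<dots> = pos_index (\<lambda>v. (\<lambda>(x, y, z). \<omega> x y + \<omega> y z + \<omega> z x) (f v)) (X \<times> X \<times> W)"
    by (rule pos_index_image[OF linf]) (use s in \<open>auto simp: zero_prod_def subspace_Times\<close>)
  also have "\<dots> = pos_index (\<lambda>v. S (fst v) (fst v) + B (snd v) (snd v)) (X \<times> X \<times> W)"
  proof (rule pos_index_cong)
    fix v assume "v \<in> X \<times> X \<times> W"
    then obtain x d w where v: "v = (x, d, w)" "x \<in> X" "d \<in> X" "w \<in> W" by auto
    have z: "\<omega> x d = 0" "\<omega> w (?w x) = 0" "\<omega> w (?w d) = 0" "\<omega> (?w x) w = 0" "\<omega> (?w d) w = 0"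
      "\<omega> (?w x) (?w x) = 0" "\<omega> (?w d) (?w x) = 0"
      using v X wpart_mem(1)[OF Y] by (auto simp: transv_def intro: lag_iso)
    show "(\<lambda>(x, y, z). \<omega> x y + \<omega> y z + \<omega> z x) (f v) = S (fst v) (fst v) + B (snd v) (snd v)"
      using z wpart_skew[OF Y, of x d] skew[of w x] skew[of "?w x" x]
      by (simp add: v f_def S_def B_def \<omega>_simps linear_add[OF lw])
  qed
  also have "\<dots> = pos_index (\<lambda>v. S v v) X + pos_index (\<lambda>v. B v v) (X \<times> W)"
    by (rule pos_index_prod[OF S s(1) Ssym B subspace_Times[OF s(1,2)]]) (auto simp: B_def)
  also have "pos_index (\<lambda>v. B v v) (X \<times> W) = n"
    using pos_index_pairing[OF transv_sym[OF X]] by (simp add: B_def)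
  also have "pos_index (\<lambda>v. S v v) X = gind W Y X"
  proof -
    define g where "g v = v + wpart W X v" for v
    have ling: "linear g" unfolding g_def by (rule linear_graph[OF X])
    have "range g = X"
      unfolding g_def by (rule range_graph[OF X])
    then have "pos_index (\<lambda>v. S v v) X = pos_index (\<lambda>v. S v v) (g ` UNIV)" by simp
    also have "\<dots> = pos_index (\<lambda>v. S (g v) (g v)) UNIV"
      by (rule pos_index_image[OF ling subspace_UNIV]) (simp add: bilinear_simps[OF S])
    also have "\<dots> = gind W Y X"
      unfolding gind_def
    proof (rule pos_index_cong)
      fix v
      have w: "?w (g v) = ?w v - wpart W X v"
        using wpart_in_W[OF Y wpart_mem(1)[OF X]] by (simp add: g_def linear_add[OF lw])
      have "\<omega> (wpart W X v) (?w v - wpart W X v) = 0"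
        using X wpart_mem(1)[OF X] wpart_mem(1)[OF Y] s by (auto simp: transv_def intro!: lag_iso subspace_diff)
      then show "S (g v) (g v) = gform W Y X v v"
        unfolding S_def w by (simp add: g_def gform_def \<omega>_simps)
    qed
    finally show ?thesis .
  qed
  finally show ?thesis by simp
qed

text \<open>The triple index of Zhou, Wu and Zhu, written through Kashiwara's form.\<close>

definition triple :: "'v set \<Rightarrow> 'v set \<Rightarrow> 'v set \<Rightarrow> int" where
  "triple X Y Z = int (kash Y X Z) + int (dim (X \<inter> Z)) - int n"

text \<open>The left side contains no \<open>W\<close>, so the combination on the right has the same
  value for every common transversal.\<close>

lemma triple_eq:
  assumes "transv W X" "transv W Y" "transv W Z"
  shows "triple X Y Z = int (gind W X Y) + int (gind W Y Z) - int (gind W X Z)"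
proof -
  have "gind W X Z + gind W Z X + dim (X \<inter> Z) = n" by (rule gind_swap) (use assms in auto)
  then show ?thesis
    unfolding triple_def kash_eq[OF assms(2,1,3)] by linarith
qed

end

subsection \<open>Transversals and convergence of Lagrangian subspaces\<close>

lemma closest_point_subspace_unique:
  fixes S :: "'a::euclidean_space set"
  assumes "subspace S" "p \<in> S" "\<And>s. s \<in> S \<Longrightarrow> (v - p) \<bullet> s = 0"
  shows "closest_point S v = p"
proof -
  have "dist v p \<le> dist v z" if "z \<in> S" for z
  proof -
    have "(v - p) \<bullet> (p - z) = 0" using assms that by (simp add: subspace_diff)
    then have "(norm (v - p + (p - z)))\<^sup>2 = (norm (v - p))\<^sup>2 + (norm (p - z))\<^sup>2"
      using norm_add_Pythagorean[of "v - p" "p - z"] by (simp add: orthogonal_def)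
    then have "(norm (v - p))\<^sup>2 \<le> (norm (v - z))\<^sup>2" by simp
    then show ?thesis by (simp add: dist_norm)
  qed
  then show ?thesis
    using closest_point_unique[OF subspace_imp_convex[OF assms(1)] closed_subspace[OF assms(1)] assms(2)]
    by metis
qed

lemma closest_point_subspace:
  fixes S :: "'a::euclidean_space set"
  assumes "subspace S"
  shows "closest_point S v \<in> S" "s \<in> S \<Longrightarrow> (v - closest_point S v) \<bullet> s = 0"
proof -
  obtain y z where yz: "y \<in> span S" "\<And>w. w \<in> span S \<Longrightarrow> orthogonal z w" "v = y + z"
    using orthogonal_subspace_decomp_exists[of S v] by blast
  have sp: "span S = S" using assms by (simp add: span_eq_iff)
  have "closest_point S v = y"
    using yz unfolding sp by (intro closest_point_subspace_unique[OF assms]) (auto simp: orthogonal_def)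
  then show "closest_point S v \<in> S" "s \<in> S \<Longrightarrow> (v - closest_point S v) \<bullet> s = 0"
    using yz unfolding sp orthogonal_def by auto
qed

lemma linear_closest_point:
  fixes S :: "'a::euclidean_space set"
  assumes "subspace S" shows "linear (closest_point S)"
proof (rule linearI)
  note c = closest_point_subspace[OF assms]
  fix u v :: 'a and r :: real
  show "closest_point S (u + v) = closest_point S u + closest_point S v"
  proof (rule closest_point_subspace_unique[OF assms])
    show "closest_point S u + closest_point S v \<in> S" using c(1) assms by (simp add: subspace_add)
    fix s assume "s \<in> S"
    then show "(u + v - (closest_point S u + closest_point S v)) \<bullet> s = 0"
      using c(2)[of s u] c(2)[of s v] by (simp add: inner_diff_left inner_add_left)
  qed
  show "closest_point S (r *\<^sub>R v) = r *\<^sub>R closest_point S v"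
  proof (rule closest_point_subspace_unique[OF assms])
    show "r *\<^sub>R closest_point S v \<in> S" using c(1) assms by (simp add: subspace_scale)
    fix s assume "s \<in> S"
    then show "(r *\<^sub>R v - r *\<^sub>R closest_point S v) \<bullet> s = 0"
      using c(2)[of s v] by (simp add: inner_diff_left)
  qed
qed

text \<open>For linear maps on a finite-dimensional space pointwise convergence is convergence in
  operator norm.\<close>

lemma linear_tendsto_uniform:
  fixes f :: "'i \<Rightarrow> 'a::euclidean_space \<Rightarrow> 'b::real_normed_vector"
  assumes "eventually (\<lambda>i. linear (f i)) F" "linear g" "\<And>v. ((\<lambda>i. f i v) \<longlongrightarrow> g v) F" "e > 0"
  shows "eventually (\<lambda>i. \<forall>v. norm (f i v - g v) \<le> e * norm v) F"
proof -
  define \<epsilon> where "\<epsilon> i = (\<Sum>b\<in>Basis. norm (f i b - g b))" for i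
  have "(\<epsilon> \<longlongrightarrow> (\<Sum>b\<in>Basis. norm (g b - g b))) F"
    unfolding \<epsilon>_def by (intro tendsto_sum tendsto_norm tendsto_diff assms(3) tendsto_const)
  then have "(\<epsilon> \<longlongrightarrow> 0) F" by simp
  then have "eventually (\<lambda>i. \<epsilon> i < e) F" using assms(4) by (rule order_tendstoD(2))
  with assms(1) show ?thesis
  proof eventually_elim
    case (elim i)
    show ?case
    proof
      fix v :: 'a
      have lin: "linear (\<lambda>v. f i v - g v)" using elim(1) assms(2) by (rule linear_compose_sub)
      have "f i v - g v = (\<Sum>b\<in>Basis. (v \<bullet> b) *\<^sub>R (f i b - g b))"
        using linear_sum[OF lin, of "\<lambda>b. (v \<bullet> b) *\<^sub>R b" Basis]
        by (simp add: linear_cmul[OF lin] euclidean_representation)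
      then have "norm (f i v - g v) \<le> (\<Sum>b\<in>Basis. \<bar>v \<bullet> b\<bar> * norm (f i b - g b))"
        by (simp add: sum_norm_le)
      also have "\<dots> \<le> (\<Sum>b\<in>Basis. norm v * norm (f i b - g b))"
        by (intro sum_mono mult_right_mono Basis_le_norm) auto
      also have "\<dots> = norm v * \<epsilon> i" by (simp add: \<epsilon>_def sum_distrib_left)
      also have "\<dots> \<le> e * norm v"
        using mult_right_mono[OF less_imp_le[OF elim(2)], of "norm v"] by (simp add: mult.commute)
      finally show "norm (f i v - g v) \<le> e * norm v" .
    qed
  qed
qed

context symplectic_space
begin

section \<open>Compatible complex structures and common transversals\<close>

text \<open>Besides the usual compatibility, the metric of \<open>J\<close> is required to agree
  with the ambient inner product on \<open>L0\<close>. This lets orthogonality in \<open>L0\<close>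
  be read off from the symplectic form.\<close>

definition compatible :: "'v set \<Rightarrow> ('v \<Rightarrow> 'v) \<Rightarrow> bool" where
  "compatible L0 J \<longleftrightarrow> linear J \<and> (\<forall>v. J (J v) = - v) \<and> (\<forall>u v. \<omega> (J u) (J v) = \<omega> u v)
     \<and> (\<forall>v. v \<noteq> 0 \<longrightarrow> \<omega> v (J v) > 0) \<and> (\<forall>x\<in>L0. \<forall>y\<in>L0. \<omega> x (J y) = x \<bullet> y)"

text \<open>\<open>J\<close> exchanges \<open>L0\<close> with a Lagrangian complement
  \<open>M\<close>: it sends \<open>x + E y\<close> to \<open>- y + E x\<close> for \<open>x\<close>
  and \<open>y\<close> in \<open>L0\<close>. Since \<open>E\<close> is dual to the inner product on
  \<open>L0\<close>, all requirements follow from the explicit expression of the symplectic form in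
  the coordinates \<open>x\<close> and \<open>y\<close>.\<close>

lemma compatible_exists:
  assumes L0: "lag L0"
  shows "\<exists>J. compatible L0 J"
proof -
  have s0: "subspace L0" by (rule lag_subspace[OF L0])
  define A where "A u = (\<Sum>b\<in>Basis. \<omega> u b *\<^sub>R b)" for u
  have A: "A u \<bullet> v = \<omega> u v" for u v
  proof -
    have "\<omega> u v = \<omega> u (\<Sum>b\<in>Basis. (v \<bullet> b) *\<^sub>R b)" by (simp add: euclidean_representation)
    also have "\<dots> = (\<Sum>b\<in>Basis. (v \<bullet> b) * \<omega> u b)"
      using bil by (simp add: bilinear_def linear_sum linear_cmul)
    finally show ?thesis by (simp add: A_def inner_sum_left inner_sum_right inner_commute[of _ v] mult.commute)
  qed
  have linA: "linear A"
    by (rule linearI; rule euclidean_eqI) (simp_all add: A inner_add_left \<omega>_simps)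
  have "inj A"
  proof (rule linear_injective_0[OF linA, THEN iffD2], safe)
    fix u assume "A u = 0"
    then have "\<omega> u v = 0" for v using A[of u v] by simp
    then show "u = 0" by (rule nondeg)
  qed
  then obtain A' where A': "linear A'" "\<And>x. A (A' x) = x"
    using linear_injective_isomorphism[OF linA] by auto
  define P where "P = closest_point L0"
  have linP: "linear P" unfolding P_def by (rule linear_closest_point[OF s0])
  have PL0: "P v \<in> L0" for v unfolding P_def by (rule closest_point_subspace(1)[OF s0])
  have P_inner: "P v \<bullet> x = v \<bullet> x" if "x \<in> L0" for v x
    using closest_point_subspace(2)[OF s0 that, of v] by (simp add: P_def inner_diff_left)
  note P = linP PL0 P_inner
  define D where "D y = - A' y" for y
  have linD: "linear D" unfolding D_def by (rule linear_compose_neg[OF A'(1)])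
  have D: "\<omega> x (D y) = x \<bullet> y" for x y
    using A[of "A' y" x] skew[of x "A' y"] by (simp add: D_def A' \<omega>_simps inner_commute)
  have D2: "\<omega> (D y) (D z) = D y \<bullet> z" for y z by (rule D)
  \<comment> \<open>\<open>D\<close> represents the inner product by the symplectic form, but the
    image of \<open>L0\<close> under it need not be isotropic. In the product of \<open>E y\<close>
    and \<open>E z\<close> each of the two mixed terms removes half of the product of
    \<open>D y\<close> and \<open>D z\<close>, whence the factor. The correction lies in
    \<open>L0\<close>, so pairings with \<open>L0\<close> are unaffected.\<close>
  define E where "E y = D y - (1/2) *\<^sub>R P (D y)" for y
  have linE: "linear E"
    by (rule linearI)
      (simp_all add: E_def linear_add[OF linD] linear_cmul[OF linD] linear_add[OF P(1)] linear_cmul[OF P(1)] algebra_simps)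
  have E: "\<omega> x (E y) = x \<bullet> y" if "x \<in> L0" "y \<in> L0" for x y
    using lag_iso[OF L0 that(1) P(2)] by (simp add: E_def \<omega>_simps D)
  have E2: "\<omega> (E y) (E z) = 0" if "y \<in> L0" "z \<in> L0" for y z
  proof -
    have "\<omega> (P (D y)) (P (D z)) = 0" by (rule lag_iso[OF L0 P(2) P(2)])
    moreover have "\<omega> (P (D y)) (D z) = D y \<bullet> z" using P(3)[OF that(2)] by (simp add: D)
    moreover have "\<omega> (D y) (P (D z)) = - (D z \<bullet> y)"
      using P(3)[OF that(1)] skew[of "D y" "P (D z)"] by (simp add: D)
    moreover have "D z \<bullet> y = - (D y \<bullet> z)" using D2[of y z] D2[of z y] skew[of "D y" "D z"] by simp
    ultimately show ?thesis by (simp add: E_def \<omega>_simps D2)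
  qed
  have injE: "y = 0" if "y \<in> L0" "E y \<in> L0" for y
    using E[OF that(1,1)] lag_iso[OF L0 that] by simp
  define M where "M = E ` L0"
  have "inj_on E L0"
    by (rule linear_injective_on_subspace_0[OF linE s0, THEN iffD2]) (use injE subspace_0[OF s0] in auto)
  then have "dim M = n" using dim_image_subspace[OF linE s0] lag_dim[OF L0] by (simp add: M_def)
  then have lagM: "lag M"
    unfolding lagrangian_def using linear_subspace_image[OF linE s0] E2 by (auto simp: M_def)
  have T: "transv M L0"
  proof -
    have "v = 0" if v: "v \<in> M" "v \<in> L0" for v
    proof -
      obtain y where y: "y \<in> L0" "v = E y" using v by (auto simp: M_def)
      then have "y = 0" using injE[of y] v by simp
      then show ?thesis using y linear_0[OF linE] by simp
    qed
    then have "M \<inter> L0 = {0}" using subspace_0[OF s0] subspace_0[OF lag_subspace[OF lagM]] by blast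
    then show ?thesis using lagM L0 by (simp add: transv_def)
  qed
  define w where "w = wpart M L0"
  have w: "linear w" unfolding w_def by (rule wpart_linear[OF T])
  \<comment> \<open>\<open>v + w v\<close> is the component \<open>x\<close> of \<open>v\<close>,
    and \<open>- w v\<close> is the component \<open>E y\<close>. As
    \<open>P (A (E y)) = - y\<close> for \<open>y\<close> in \<open>L0\<close>, the last term
    recovers \<open>- y\<close>.\<close>
  define J where "J v = E (v + w v) - P (A (w v))" for v
  have linJ: "linear J"
    by (rule linearI)
      (simp_all add: J_def linear_add[OF linE] linear_cmul[OF linE] linear_add[OF P(1)] linear_cmul[OF P(1)]
        linear_add[OF w] linear_cmul[OF w] linear_add[OF linA] linear_cmul[OF linA] algebra_simps)
  have J: "J (x + E y) = - y + E x" if "x \<in> L0" "y \<in> L0" for x y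
  proof -
    have wv: "w (x + E y) = - E y"
      unfolding w_def by (rule wpart_eq[OF T]) (use that lag_subspace[OF lagM] in \<open>auto simp: M_def intro!: subspace_neg\<close>)
    have "P (A (- E y)) = y"
      unfolding P_def
    proof (rule closest_point_subspace_unique[OF s0 that(2)])
      fix s assume s: "s \<in> L0"
      have "A (- E y) \<bullet> s = s \<bullet> y" using E[OF s that(2)] skew[of "E y" s] by (simp add: A \<omega>_simps)
      then show "(A (- E y) - y) \<bullet> s = 0" by (simp add: inner_diff_left inner_commute[of y s])
    qed
    then show ?thesis by (simp add: J_def wv)
  qed
  have dec: "\<exists>x y. x \<in> L0 \<and> y \<in> L0 \<and> v = x + E y" for v
  proof -
    have "v \<in> ssum M L0" using transv_ssum[OF T] by simp
    then obtain y x where "y \<in> L0" "x \<in> L0" "v = E y + x" by (auto simp: ssum_def M_def)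
    then show ?thesis by (metis add.commute)
  qed
  have neg: "- y \<in> L0" if "y \<in> L0" for y using s0 that by (rule subspace_neg)
  have form: "\<omega> (x + E y) (x' + E y') = x \<bullet> y' - x' \<bullet> y"
    if "x \<in> L0" "y \<in> L0" "x' \<in> L0" "y' \<in> L0" for x y x' y'
    using that E[of x y'] E[of x' y] skew[of "E y" x'] E2[of y y'] lag_iso[OF L0, of x x'] by (simp add: \<omega>_simps)
  have J2: "J (J v) = - v" for v
  proof -
    obtain x y where xy: "x \<in> L0" "y \<in> L0" "v = x + E y" using dec by blast
    have "J (- y + E x) = - x + E (- y)" by (rule J) (use xy neg in auto)
    then show ?thesis by (simp add: xy J linear_neg[OF linE])
  qed
  have Jw: "\<omega> (J u) (J v) = \<omega> u v" for u v
  proof -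
    obtain x y where xy: "x \<in> L0" "y \<in> L0" "u = x + E y" using dec by blast
    obtain x' y' where xy': "x' \<in> L0" "y' \<in> L0" "v = x' + E y'" using dec by blast
    show ?thesis
      unfolding xy(3) xy'(3) J[OF xy(1,2)] J[OF xy'(1,2)] form[OF xy(1,2) xy'(1,2)]
        form[OF neg[OF xy(2)] xy(1) neg[OF xy'(2)] xy'(1)]
      by (simp add: inner_commute[of y x'] inner_commute[of y' x])
  qed
  have Jpos: "\<omega> v (J v) > 0" if "v \<noteq> 0" for v
  proof -
    obtain x y where xy: "x \<in> L0" "y \<in> L0" "v = x + E y" using dec by blast
    have e: "\<omega> v (J v) = x \<bullet> x + y \<bullet> y"
      unfolding xy(3) J[OF xy(1,2)] form[OF xy(1,2) neg[OF xy(2)] xy(1)] by simp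
    have "x \<noteq> 0 \<or> y \<noteq> 0" using that xy by (auto simp: linear_0[OF linE])
    then show ?thesis unfolding e by (metis add_nonneg_pos add_pos_nonneg inner_ge_zero inner_gt_zero_iff)
  qed
  have J0: "\<omega> x (J y) = x \<bullet> y" if "x \<in> L0" "y \<in> L0" for x y
  proof -
    have "J (y + E 0) = - 0 + E y" by (rule J) (use that subspace_0[OF s0] in auto)
    then have "J y = E y" by (simp add: linear_0[OF linE])
    then show ?thesis using E[OF that] by simp
  qed
  show ?thesis unfolding compatible_def using linJ J2 Jw Jpos J0 by blast
qed

text \<open>The graphs, over the image of \<open>L0\<close> under \<open>J\<close>, of the maps that
  send \<open>J y\<close> to \<open>c *\<^sub>R y\<close>: a line in a chart of Lagrangians.\<close>

definition tilt :: "('v \<Rightarrow> 'v) \<Rightarrow> 'v set \<Rightarrow> real \<Rightarrow> 'v set" where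
  "tilt J L0 c = (\<lambda>y. c *\<^sub>R y + J y) ` L0"

lemma lag_tilt:
  assumes L0: "lag L0" and J: "compatible L0 J"
  shows "lag (tilt J L0 c)"
proof -
  have lJ: "linear J" using J by (simp add: compatible_def)
  have lin: "linear (\<lambda>y. c *\<^sub>R y + J y)"
    by (rule linearI) (simp_all add: linear_add[OF lJ] linear_cmul[OF lJ] algebra_simps)
  have s0: "subspace L0" by (rule lag_subspace[OF L0])
  have "inj_on (\<lambda>y. c *\<^sub>R y + J y) L0"
  proof (rule linear_injective_on_subspace_0[OF lin s0, THEN iffD2], safe)
    fix y assume y: "y \<in> L0" "c *\<^sub>R y + J y = 0"
    then have "\<omega> y (c *\<^sub>R y + J y) = 0" by (simp add: \<omega>_simps)
    then have "\<omega> y (J y) = 0" by (simp add: \<omega>_simps)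
    then show "y = 0" using J by (metis compatible_def less_irrefl)
  qed
  then have "dim (tilt J L0 c) = n" unfolding tilt_def using dim_image_subspace[OF lin s0] lag_dim[OF L0] by simp
  moreover have "\<omega> (c *\<^sub>R x + J x) (c *\<^sub>R y + J y) = 0" if "x \<in> L0" "y \<in> L0" for x y
  proof -
    have "\<omega> x y = 0" by (rule lag_iso[OF L0 that])
    moreover have "\<omega> x (J y) = x \<bullet> y" "\<omega> y (J x) = y \<bullet> x" "\<omega> (J x) (J y) = \<omega> x y"
      using J that by (auto simp: compatible_def)
    ultimately show ?thesis using skew[of "J x" y] by (simp add: \<omega>_simps inner_commute)
  qed
  ultimately show ?thesis
    unfolding lagrangian_def tilt_def using linear_subspace_image[OF lin s0] by auto
qed

text \<open>The exceptional parameters behave like eigenvalues of a symmetric operator: vectors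
  \<open>y\<close> belonging to different parameters are orthogonal, so there are only finitely many
  of them.\<close>

lemma finite_tilt:
  assumes L0: "lag L0" and J: "compatible L0 J" and L: "lag L"
  shows "finite {c. tilt J L0 c \<inter> L \<noteq> {0}}"
proof -
  let ?S = "{c. tilt J L0 c \<inter> L \<noteq> {0}}"
  have lJ: "linear J" using J by (simp add: compatible_def)
  have "\<forall>c\<in>?S. \<exists>y. y \<in> L0 \<and> y \<noteq> 0 \<and> c *\<^sub>R y + J y \<in> L"
  proof
    fix c assume "c \<in> ?S"
    moreover have "0 \<in> tilt J L0 c \<inter> L"
      using subspace_0[OF lag_subspace[OF L]] subspace_0[OF lag_subspace[OF lag_tilt[OF L0 J]]] by simp
    ultimately obtain x where "x \<in> tilt J L0 c" "x \<in> L" "x \<noteq> 0" by blast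
    then show "\<exists>y. y \<in> L0 \<and> y \<noteq> 0 \<and> c *\<^sub>R y + J y \<in> L"
      unfolding tilt_def by (auto simp: linear_0[OF lJ])
  qed
  then obtain y where y: "\<And>c. c \<in> ?S \<Longrightarrow> y c \<in> L0 \<and> y c \<noteq> 0 \<and> c *\<^sub>R y c + J (y c) \<in> L" by metis
  have orth: "y c \<bullet> y d = 0" if "c \<in> ?S" "d \<in> ?S" "c \<noteq> d" for c d
  proof -
    have "\<omega> (c *\<^sub>R y c + J (y c)) (d *\<^sub>R y d + J (y d)) = 0"
      by (rule lag_iso[OF L]) (use y that in auto)
    moreover have "\<omega> (y c) (y d) = 0" by (rule lag_iso[OF L0]) (use y that in auto)
    moreover have "\<omega> (J (y c)) (J (y d)) = \<omega> (y c) (y d)" "\<omega> (y c) (J (y d)) = y c \<bullet> y d" "\<omega> (y d) (J (y c)) = y d \<bullet> y c"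
      using J y that by (auto simp: compatible_def)
    ultimately have "(c - d) * (y c \<bullet> y d) = 0"
      using skew[of "J (y c)" "y d"] by (simp add: \<omega>_simps inner_commute algebra_simps)
    then show ?thesis using that by simp
  qed
  have "inj_on y ?S"
  proof (rule inj_onI, rule ccontr)
    fix c d assume cd: "c \<in> ?S" "d \<in> ?S" "y c = y d" "c \<noteq> d"
    then have "y c \<bullet> y c = 0" using orth[of c d] by simp
    then show False using y[OF cd(1)] by simp
  qed
  moreover have "finite (y ` ?S)"
    by (rule pairwise_orthogonal_imp_finite) (auto simp: pairwise_def orthogonal_def intro!: orth)
  ultimately show ?thesis by (rule finite_imageD[rotated])
qed

text \<open>Each Lagrangian excludes finitely many tilts, and there are infinitely many real
  parameters.\<close>

lemma common_transversal:
  assumes "finite \<L>" "\<L> \<noteq> {}" "\<And>L. L \<in> \<L> \<Longrightarrow> lag L"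
  obtains W where "\<And>L. L \<in> \<L> \<Longrightarrow> transv W L"
proof -
  obtain L0 where "L0 \<in> \<L>" using assms(2) by blast
  then have L0: "lag L0" using assms(3) by blast
  then obtain J where J: "compatible L0 J" using compatible_exists by blast
  have "finite (\<Union>L\<in>\<L>. {c. tilt J L0 c \<inter> L \<noteq> {0}})"
    using assms(1) finite_tilt[OF L0 J assms(3)] by blast
  then obtain c :: real where "c \<notin> (\<Union>L\<in>\<L>. {c. tilt J L0 c \<inter> L \<noteq> {0}})"
    using ex_new_if_finite[OF infinite_UNIV_char_0] by blast
  then show thesis using that[of "tilt J L0 c"] lag_tilt[OF L0 J] assms(3) unfolding transv_def by blast
qed

lemma common_transversal3:
  assumes "lag X" "lag Y" "lag Z"
  obtains W where "transv W X" "transv W Y" "transv W Z"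
proof -
  obtain W where "\<And>L. L \<in> {X, Y, Z} \<Longrightarrow> transv W L"
    by (rule common_transversal[of "{X, Y, Z}"]) (use assms in auto)
  then show thesis using that[of W] by blast
qed

section \<open>Continuity of graph maps, graph forms and their indices\<close>

text \<open>Stated for filters, so that the same lemmas serve for paths in one variable and for
  homotopies in two.\<close>

definition lag_tendsto :: "('i \<Rightarrow> 'v set) \<Rightarrow> 'v set \<Rightarrow> 'i filter \<Rightarrow> bool" where
  "lag_tendsto l x F \<longleftrightarrow> lag x \<and> eventually (\<lambda>i. lag (l i)) F
     \<and> (\<forall>v. ((\<lambda>i. closest_point (l i) v) \<longlongrightarrow> closest_point x v) F)"

text \<open>Transversality makes the distance to \<open>x\<close> a norm on \<open>W\<close>,
  bounded below by \<open>e * norm w\<close>. Uniform convergence of the projections preserves half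
  of this bound, which yields transversality nearby and also the estimate behind the continuity of
  \<open>wpart\<close>.\<close>

lemma lag_tendsto_transv_bound:
  assumes l: "lag_tendsto l x F" and W: "transv W x"
  obtains e where "e > 0"
    "eventually (\<lambda>i. transv W (l i) \<and> (\<forall>w\<in>W. e * norm w \<le> norm (w - closest_point (l i) w))) F"
proof -
  have sx: "subspace x" and sW: "subspace W" using W by (auto simp: transv_def lag_subspace)
  have "\<exists>e>0. \<forall>w\<in>W. norm (w - closest_point x w) \<ge> e * norm w"
  proof (rule injective_imp_isometric[OF closed_subspace[OF sW] sW])
    show "bounded_linear (\<lambda>w. w - closest_point x w)"
      using linear_closest_point[OF sx]
      by (intro linear_conv_bounded_linear[THEN iffD1] linear_compose_sub linear_ident)
    show "\<forall>w\<in>W. w - closest_point x w = 0 \<longrightarrow> w = 0"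
    proof safe
      fix w assume w: "w \<in> W" "w - closest_point x w = 0"
      then have "w \<in> W \<inter> x" using closest_point_subspace(1)[OF sx, of w] by simp
      moreover have "W \<inter> x = {0}" using W by (simp add: transv_def)
      ultimately show "w = 0" by blast
    qed
  qed
  then obtain e where e: "e > 0" "\<And>w. w \<in> W \<Longrightarrow> norm (w - closest_point x w) \<ge> e * norm w" by blast
  have evl: "eventually (\<lambda>i. lag (l i)) F" using l by (simp add: lag_tendsto_def)
  have "eventually (\<lambda>i. linear (closest_point (l i))) F"
    using evl by eventually_elim (auto intro: linear_closest_point lag_subspace)
  then have "eventually (\<lambda>i. \<forall>v. norm (closest_point (l i) v - closest_point x v) \<le> (e/2) * norm v) F"
    by (rule linear_tendsto_uniform[OF _ linear_closest_point[OF sx]]) (use l e in \<open>auto simp: lag_tendsto_def\<close>)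
  with evl have "eventually (\<lambda>i. transv W (l i) \<and> (\<forall>w\<in>W. (e/2) * norm w \<le> norm (w - closest_point (l i) w))) F"
  proof eventually_elim
    case (elim i)
    have b: "(e/2) * norm w \<le> norm (w - closest_point (l i) w)" if "w \<in> W" for w
    proof -
      have "norm (w - closest_point x w) \<le> norm (w - closest_point (l i) w) + norm (closest_point (l i) w - closest_point x w)"
        using norm_triangle_ineq[of "w - closest_point (l i) w" "closest_point (l i) w - closest_point x w"] by simp
      then show ?thesis using e(2)[OF that] elim(2)[rule_format, of w] by linarith
    qed
    have "w = 0" if "w \<in> W" "w \<in> l i" for w
    proof -
      have "closest_point (l i) w = w" by (rule closest_point_self[OF that(2)])
      then have "(e/2) * norm w \<le> 0" using b[OF that(1)] by simp
      then show ?thesis using e(1) by (simp add: mult_le_0_iff)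
    qed
    moreover have "0 \<in> W" "0 \<in> l i" using sW elim(1) by (auto simp: subspace_0 lag_subspace)
    ultimately have "W \<inter> l i = {0}" by blast
    then show ?case using b W elim(1) by (simp add: transv_def)
  qed
  then show thesis using that[of "e/2"] e(1) by simp
qed

lemma lag_tendsto_transv:
  assumes "lag_tendsto l x F" "transv W x"
  shows "eventually (\<lambda>i. transv W (l i)) F"
proof -
  obtain e where "e > 0"
    "eventually (\<lambda>i. transv W (l i) \<and> (\<forall>w\<in>W. e * norm w \<le> norm (w - closest_point (l i) w))) F"
    by (rule lag_tendsto_transv_bound[OF assms])
  from this(2) show ?thesis by eventually_elim blast
qed

text \<open>The difference \<open>y\<close> of the two \<open>W\<close>-parts carries
  \<open>m\<close> into \<open>l i\<close>, so \<open>y\<close> and \<open>- m\<close> have the same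
  distance vector to \<open>l i\<close>. The lower bound on \<open>W\<close> then controls
  \<open>y\<close> by the distance of \<open>m\<close> from \<open>l i\<close>, which tends to
  0.\<close>

lemma lag_tendsto_wpart:
  assumes l: "lag_tendsto l x F" and W: "transv W x"
  shows "((\<lambda>i. wpart W (l i) v) \<longlongrightarrow> wpart W x v) F"
proof -
  obtain e where e: "e > 0"
    "eventually (\<lambda>i. transv W (l i) \<and> (\<forall>w\<in>W. e * norm w \<le> norm (w - closest_point (l i) w))) F"
    by (rule lag_tendsto_transv_bound[OF l W])
  define m where "m = v + wpart W x v"
  have m: "m \<in> x" using wpart_mem[OF W] by (simp add: m_def)
  have sW: "subspace W" using W by (auto simp: transv_def lag_subspace)
  have "((\<lambda>i. m - closest_point (l i) m) \<longlongrightarrow> m - closest_point x m) F"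
    using l by (intro tendsto_intros) (auto simp: lag_tendsto_def)
  moreover have "closest_point x m = m" by (rule closest_point_self[OF m])
  ultimately have lim: "((\<lambda>i. norm (m - closest_point (l i) m) / e) \<longlongrightarrow> 0) F"
    using tendsto_divide[OF tendsto_norm tendsto_const] e(1) by (fastforce simp: tendsto_norm_zero_iff tendsto_norm_zero)
  have "eventually (\<lambda>i. norm (wpart W (l i) v - wpart W x v) \<le> norm (m - closest_point (l i) m) / e) F"
    using e(2)
  proof eventually_elim
    case (elim i)
    then have t: "transv W (l i)" by blast
    have sl: "subspace (l i)" using t by (auto simp: transv_def lag_subspace)
    define y where "y = wpart W (l i) v - wpart W x v"
    have y: "y \<in> W" using wpart_mem(1)[OF t] wpart_mem(1)[OF W] sW by (simp add: y_def subspace_diff)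
    have my: "m + y \<in> l i" using wpart_mem(2)[OF t, of v] by (simp add: m_def y_def)
    have "closest_point (l i) (m + y) = m + y" by (rule closest_point_self[OF my])
    then have "y - closest_point (l i) y = - (m - closest_point (l i) m)"
      by (simp add: linear_add[OF linear_closest_point[OF sl]] algebra_simps)
    then have "norm (y - closest_point (l i) y) = norm (m - closest_point (l i) m)" by (metis norm_minus_cancel)
    moreover have "e * norm y \<le> norm (y - closest_point (l i) y)" using elim y by blast
    ultimately show ?case using e(1) by (simp add: y_def field_simps)
  qed
  then have "((\<lambda>i. wpart W (l i) v - wpart W x v) \<longlongrightarrow> 0) F"
    by (rule Lim_null_comparison[OF _ lim])
  then show ?thesis by (rule LIM_zero_cancel)
qed

lemma tendsto_\<omega>:
  "(f \<longlongrightarrow> a) F \<Longrightarrow> (g \<longlongrightarrow> b) F \<Longrightarrow> ((\<lambda>i. \<omega> (f i) (g i)) \<longlongrightarrow> \<omega> a b) F"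
  using bounded_bilinear.tendsto[OF bilinear_conv_bounded_bilinear[THEN iffD1, OF bil]] .

lemma lag_tendsto_gform:
  assumes "lag_tendsto l x F" "transv W x"
  shows "((\<lambda>i. gform W (l i) M u v) \<longlongrightarrow> gform W x M u v) F"
    and "((\<lambda>i. gform W M (l i) u v) \<longlongrightarrow> gform W M x u v) F"
  unfolding gform_def
  by (intro tendsto_\<omega> tendsto_diff tendsto_const lag_tendsto_wpart[OF assms])+

text \<open>Both orders of the arguments give lower semicontinuous indices. By
  \<open>gind_swap\<close> their sum is n at the limit and at most n nearby, so neither of them can
  grow.\<close>

lemma gind_locally_constant:
  assumes l: "lag_tendsto l x F" and x: "transv U x" and M: "transv U M" and xM: "x \<inter> M = {0}"
  shows "eventually (\<lambda>i. gind U M (l i) = gind U M x) F"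
proof -
  note ev = lag_tendsto_transv[OF l x]
  have "eventually (\<lambda>i. gind U x M \<le> gind U (l i) M) F"
    unfolding gind_def
  proof (rule pos_index_lsc[OF gform_bilinear[OF x M] _ lag_tendsto_gform(1)[OF l x]])
    show "eventually (\<lambda>i. bilinear (gform U (l i) M)) F"
      using ev by eventually_elim (rule gform_bilinear[OF _ M])
  qed
  moreover have "eventually (\<lambda>i. gind U M x \<le> gind U M (l i)) F"
    unfolding gind_def
  proof (rule pos_index_lsc[OF gform_bilinear[OF M x] _ lag_tendsto_gform(2)[OF l x]])
    show "eventually (\<lambda>i. bilinear (gform U M (l i))) F"
      using ev by eventually_elim (rule gform_bilinear[OF M])
  qed
  ultimately show ?thesis using ev
  proof eventually_elim
    case (elim i)
    have "dim (x \<inter> M) = 0" using xM by simp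
    then show ?case using gind_swap[OF x M] gind_swap[OF elim(3) M] elim(1,2) by linarith
  qed
qed

text \<open>Kashiwara's index of \<open>x\<close>, \<open>l i\<close> and \<open>W\<close> is
  computed twice: over \<open>W\<close> itself, and over \<open>U\<close>, which is transversal to
  \<open>W\<close> too. The two results differ by indices of \<open>W\<close> against
  \<open>l i\<close> and \<open>x\<close>, and these are locally constant because \<open>x\<close>
  and \<open>W\<close> are transversal.\<close>

lemma gind_change_base_aux:
  assumes l: "lag_tendsto l x F" and W: "transv W x" and U: "transv U x" "transv U W"
  shows "eventually (\<lambda>i. gind W (l i) x = gind U (l i) x) F"
proof -
  have Wx: "x \<inter> W = {0}" using W by (auto simp: transv_def)
  show ?thesis
    using gind_locally_constant[OF l U Wx] lag_tendsto_transv[OF l W] lag_tendsto_transv[OF l U(1)]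
  proof eventually_elim
    case (elim i)
    have "kash x (l i) W = gind W (l i) x + n" by (rule gind_eq_kash[OF W elim(2)])
    moreover have "kash x (l i) W = gind U (l i) x + gind U W (l i) + gind U x W"
      by (rule kash_eq[OF U(1) elim(3) U(2)])
    moreover have "gind U W x + gind U x W + dim (W \<inter> x) = n" by (rule gind_swap[OF U(2,1)])
    moreover have "dim (W \<inter> x) = 0" using W by (simp add: transv_def)
    ultimately show ?case using elim(1) by linarith
  qed
qed

text \<open>The triple index of \<open>l i\<close>, \<open>x\<close> and \<open>L0\<close> is the
  same over both bases, which replaces \<open>L0\<close> by the limit \<open>x\<close>. The
  auxiliary \<open>U\<close> links \<open>W\<close> with \<open>W'\<close>, as these two may
  intersect.\<close>

lemma gind_change_base:
  assumes l: "lag_tendsto l x F" and W: "transv W x" "transv W L0" and W': "transv W' x" "transv W' L0"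
  shows "eventually (\<lambda>i. int (gind W (l i) L0) - int (gind W x L0) = int (gind W' (l i) L0) - int (gind W' x L0)) F"
proof -
  obtain U where U: "transv U x" "transv U W" "transv U W'"
    by (rule common_transversal3[of x W W']) (use W W' in \<open>auto simp: transv_def\<close>)
  show ?thesis
    using gind_change_base_aux[OF l W(1) U(1,2)] gind_change_base_aux[OF l W'(1) U(1,3)]
      lag_tendsto_transv[OF l W(1)] lag_tendsto_transv[OF l W'(1)]
  proof eventually_elim
    case (elim i)
    show ?case
      using triple_eq[OF elim(3) W] triple_eq[OF elim(4) W'] elim(1,2) by linarith
  qed
qed

end

subsection \<open>Index functions of Lagrangian paths\<close>

lemma eventually_at_within_mem: "eventually (\<lambda>t. t \<in> S) (at x within S)"
  by (simp add: eventually_at_filter)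

text \<open>Connectedness of the interval, obtained by bisection so that \<open>h\<close> may take
  values in any type.\<close>

lemma locally_constant_interval:
  fixes h :: "real \<Rightarrow> 'a"
  assumes "a \<le> b" and loc: "\<And>t. t \<in> {a..b} \<Longrightarrow> eventually (\<lambda>t'. h t' = h t) (at t within {a..b})"
  shows "h a = h b"
proof -
  define P where "P c d \<longleftrightarrow> (a \<le> c \<and> d \<le> b \<longrightarrow> h c = h d)" for c d
  have "P a b"
  proof (rule Bolzano[where P = P, OF \<open>a \<le> b\<close>])
    show "P c d" if "P c e" "P e d" "c \<le> e" "e \<le> d" for c e d using that by (auto simp: P_def)
    fix x assume "a \<le> x" "x \<le> b"
    then have "x \<in> {a..b}" by simp
    from loc[OF this] obtain e where e: "e > 0" "\<And>t. t \<in> {a..b} \<Longrightarrow> t \<noteq> x \<Longrightarrow> dist t x < e \<Longrightarrow> h t = h x"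
      unfolding eventually_at by blast
    have "P c d" if cd: "c \<le> x" "x \<le> d" "d - c < e" for c d
      unfolding P_def
    proof
      assume ab: "a \<le> c \<and> d \<le> b"
      have "h c = h x" by (cases "c = x") (use e(2)[of c] cd ab in \<open>auto simp: dist_real_def\<close>)
      moreover have "h d = h x" by (cases "d = x") (use e(2)[of d] cd ab in \<open>auto simp: dist_real_def\<close>)
      ultimately show "h c = h d" by simp
    qed
    then show "\<exists>e>0. \<forall>c d. c \<le> x \<and> x \<le> d \<and> d - c < e \<longrightarrow> P c d"
      using e(1) by (intro exI[of _ e]) simp
  qed
  then show ?thesis by (simp add: P_def)
qed

context symplectic_space
begin

lemma lag_tendsto_withinI:
  assumes "\<And>t. t \<in> S \<Longrightarrow> lag (l t)" "x \<in> S"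
    "\<And>v. ((\<lambda>t. closest_point (l t) v) \<longlongrightarrow> closest_point (l x) v) (at x within S)"
  shows "lag_tendsto l (l x) (at x within S)"
proof -
  have "eventually (\<lambda>t. lag (l t)) (at x within S)"
    using eventually_at_within_mem by eventually_elim (rule assms(1))
  then show ?thesis using assms by (simp add: lag_tendsto_def)
qed

definition lag_continuous :: "(real \<Rightarrow> 'v set) \<Rightarrow> real set \<Rightarrow> bool" where
  "lag_continuous l S \<longleftrightarrow> (\<forall>t\<in>S. lag_tendsto l (l t) (at t within S))"

lemma lag_continuousD: "lag_continuous l S \<Longrightarrow> t \<in> S \<Longrightarrow> lag_tendsto l (l t) (at t within S)"
  by (simp add: lag_continuous_def)

lemma lag_continuous_lag: "lag_continuous l S \<Longrightarrow> t \<in> S \<Longrightarrow> lag (l t)"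
  by (auto simp: lag_continuous_def lag_tendsto_def)

lemma lag_path_continuous: "lag_path \<omega> n l a b \<Longrightarrow> lag_continuous l {a..b}"
  unfolding lag_path_def lag_continuous_def continuous_on_def
  by (intro ballI lag_tendsto_withinI) simp_all

lemma lag_continuous_subset: "lag_continuous l S \<Longrightarrow> T \<subseteq> S \<Longrightarrow> lag_continuous l T"
  unfolding lag_continuous_def lag_tendsto_def
  by (meson filter_leD at_le subsetD tendsto_mono)

section \<open>Index functions as primitives of the local increments\<close>

text \<open>A primitive of the local increments of \<open>gind\<close>. The condition is imposed for
  every admissible \<open>W\<close>, so that gluing and comparing index functions involve no choice
  of bases; \<open>gind_change_base\<close> makes the conditions consistent.\<close>

definition index_fun :: "'v set \<Rightarrow> (real \<Rightarrow> 'v set) \<Rightarrow> real set \<Rightarrow> (real \<Rightarrow> int) \<Rightarrow> bool" where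
  "index_fun L0 l S f \<longleftrightarrow> (\<forall>t\<in>S. \<forall>W. transv W L0 \<longrightarrow> transv W (l t) \<longrightarrow>
     eventually (\<lambda>t'. f t' - f t = int (gind W (l t') L0) - int (gind W (l t) L0)) (at t within S))"

lemma index_funD:
  assumes "index_fun L0 l S f" "t \<in> S" "transv W L0" "transv W (l t)"
  shows "eventually (\<lambda>t'. f t' - f t = int (gind W (l t') L0) - int (gind W (l t) L0)) (at t within S)"
  using assms unfolding index_fun_def by blast

lemma index_fun_subset: "index_fun L0 l S f \<Longrightarrow> T \<subseteq> S \<Longrightarrow> index_fun L0 l T f"
  unfolding index_fun_def by (meson filter_leD at_le subsetD)

text \<open>Local existence, where one \<open>W\<close> suits the whole set; the condition for any
  other base is a change of base.\<close>

lemma index_fun_gind: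
  assumes l: "lag_continuous l S" and W: "transv W L0" "\<And>t. t \<in> S \<Longrightarrow> transv W (l t)"
  shows "index_fun L0 l S (\<lambda>t. int (gind W (l t) L0))"
  unfolding index_fun_def
proof (intro ballI allI impI)
  fix t W' assume t: "t \<in> S" and W': "transv W' L0" "transv W' (l t)"
  show "eventually (\<lambda>t'. int (gind W (l t') L0) - int (gind W (l t) L0)
      = int (gind W' (l t') L0) - int (gind W' (l t) L0)) (at t within S)"
    by (rule gind_change_base[OF lag_continuousD[OF l t] W(2)[OF t] W(1) W'(2,1)])
qed

lemma index_fun_glue:
  assumes f: "index_fun L0 l {c..e} f" and g: "index_fun L0 l {e..d} g" and "c \<le> e" "e \<le> d"
  shows "\<exists>h. index_fun L0 l {c..d} h"
proof -
  define h where "h t = (if t \<le> e then f t else g t - g e + f e)" for t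
  have "index_fun L0 l {c..d} h"
    unfolding index_fun_def
  proof (intro ballI allI impI)
    fix t W assume t: "t \<in> {c..d}" and W: "transv W L0" "transv W (l t)"
    let ?P = "\<lambda>t'. h t' - h t = int (gind W (l t') L0) - int (gind W (l t) L0)"
    have 1: "eventually ?P (at t within {c..e})"
    proof (cases "t \<le> e")
      case True
      then have "eventually (\<lambda>t'. f t' - f t = int (gind W (l t') L0) - int (gind W (l t) L0)) (at t within {c..e})"
        using t by (intro index_funD[OF f _ W]) auto
      with eventually_at_within_mem show ?thesis
        by eventually_elim (use True in \<open>auto simp: h_def\<close>)
    next
      case False
      then have "eventually (\<lambda>t'. e < t') (at t within {c..e})"
        by (intro order_tendstoD(1)[OF tendsto_ident_at]) auto
      with eventually_at_within_mem show ?thesis by eventually_elim auto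
    qed
    have 2: "eventually ?P (at t within {e..d})"
    proof (cases "e \<le> t")
      case True
      then have "eventually (\<lambda>t'. g t' - g t = int (gind W (l t') L0) - int (gind W (l t) L0)) (at t within {e..d})"
        using t by (intro index_funD[OF g _ W]) auto
      with eventually_at_within_mem show ?thesis
      proof eventually_elim
        case (elim t')
        have "h t' = g t' - g e + f e" if "t' \<ge> e" for t' using that by (auto simp: h_def)
        then show ?case using elim True by auto
      qed
    next
      case False
      then have "eventually (\<lambda>t'. t' < e) (at t within {e..d})"
        by (intro order_tendstoD(2)[OF tendsto_ident_at]) auto
      with eventually_at_within_mem show ?thesis by eventually_elim auto
    qed
    have "{c..d} = {c..e} \<union> {e..d}" using assms by auto
    then show "eventually ?P (at t within {c..d})"
      using 1 2 by (simp add: at_within_union eventually_sup)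
  qed
  then show ?thesis by blast
qed

lemma index_fun_exists:
  assumes L0: "lag L0" and l: "lag_continuous l {a..b}" and "a \<le> b"
  shows "\<exists>f. index_fun L0 l {a..b} f"
proof -
  define P where "P c d \<longleftrightarrow> (a \<le> c \<and> d \<le> b \<and> c \<le> d \<longrightarrow> (\<exists>f. index_fun L0 l {c..d} f))" for c d
  have "P a b"
  proof (rule Bolzano[where P = P, OF \<open>a \<le> b\<close>])
    show "P c d" if P: "P c e" "P e d" and ced: "c \<le> e" "e \<le> d" for c e d
      unfolding P_def
    proof
      assume "a \<le> c \<and> d \<le> b \<and> c \<le> d"
      then obtain f g where "index_fun L0 l {c..e} f" "index_fun L0 l {e..d} g"
        using P ced unfolding P_def by auto
      then show "\<exists>f. index_fun L0 l {c..d} f" using ced by (rule index_fun_glue)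
    qed
    fix x assume "a \<le> x" "x \<le> b"
    then have x: "x \<in> {a..b}" by simp
    obtain W where W: "transv W L0" "transv W (l x)"
      using common_transversal3[OF L0 lag_continuous_lag[OF l x] L0] by blast
    from lag_tendsto_transv[OF lag_continuousD[OF l x] W(2)]
    obtain e where e: "e > 0" "\<And>t. t \<in> {a..b} \<Longrightarrow> t \<noteq> x \<Longrightarrow> dist t x < e \<Longrightarrow> transv W (l t)"
      unfolding eventually_at by blast
    have "P c d" if cd: "c \<le> x" "x \<le> d" "d - c < e" for c d
      unfolding P_def
    proof
      assume ab: "a \<le> c \<and> d \<le> b \<and> c \<le> d"
      have "transv W (l t)" if "t \<in> {c..d}" for t
        by (cases "t = x") (use e(2)[of t] cd ab that W in \<open>auto simp: dist_real_def\<close>)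
      moreover have "lag_continuous l {c..d}" using lag_continuous_subset[OF l, of "{c..d}"] ab by auto
      ultimately show "\<exists>f. index_fun L0 l {c..d} f" using index_fun_gind[OF _ W(1)] by blast
    qed
    then show "\<exists>e>0. \<forall>c d. c \<le> x \<and> x \<le> d \<and> d - c < e \<longrightarrow> P c d"
      using e(1) by (intro exI[of _ e]) simp
  qed
  then show ?thesis using assms(3) by (simp add: P_def)
qed

lemma index_fun_increment:
  assumes f: "index_fun L0 l {c..d} f" and W: "transv W L0" "\<And>t. t \<in> {c..d} \<Longrightarrow> transv W (l t)" and "c \<le> d"
  shows "f d - f c = int (gind W (l d) L0) - int (gind W (l c) L0)"
proof -
  have "f c - int (gind W (l c) L0) = f d - int (gind W (l d) L0)"
  proof (rule locally_constant_interval[where h = "\<lambda>t. f t - int (gind W (l t) L0)", OF \<open>c \<le> d\<close>])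
    fix t assume t: "t \<in> {c..d}"
    show "eventually (\<lambda>t'. f t' - int (gind W (l t') L0) = f t - int (gind W (l t) L0)) (at t within {c..d})"
      using index_funD[OF f t W(1) W(2)[OF t]] by eventually_elim linarith
  qed
  then show ?thesis by linarith
qed

lemma index_fun_unique:
  assumes L0: "lag L0" and l: "lag_continuous l {a..b}" and "a \<le> b"
    and f: "index_fun L0 l {a..b} f" and g: "index_fun L0 l {a..b} g"
  shows "f b - f a = g b - g a"
proof -
  have "f a - g a = f b - g b"
  proof (rule locally_constant_interval[where h = "\<lambda>t. f t - g t", OF \<open>a \<le> b\<close>])
    fix t assume t: "t \<in> {a..b}"
    obtain W where W: "transv W L0" "transv W (l t)"
      using common_transversal3[OF L0 lag_continuous_lag[OF l t] L0] by blast
    show "eventually (\<lambda>t'. f t' - g t' = f t - g t) (at t within {a..b})"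
      using index_funD[OF f t W] index_funD[OF g t W] by eventually_elim linarith
  qed
  then show ?thesis by linarith
qed

text \<open>By \<open>triple_eq\<close>, the difference of the two indices plus the triple index of
  \<open>l t\<close>, \<open>\<mu>1\<close>, \<open>\<mu>2\<close> equals
  \<open>gind W \<mu>1 \<mu>2\<close>, in which \<open>l t\<close> does not occur. Hence the
  corresponding sum of index functions is locally constant.\<close>

lemma index_fun_difference:
  assumes l: "lag_continuous l {a..b}" and "a \<le> b" and m: "lag \<mu>1" "lag \<mu>2"
    and f1: "index_fun \<mu>1 l {a..b} f1" and f2: "index_fun \<mu>2 l {a..b} f2"
  shows "(f2 b - f2 a) - (f1 b - f1 a) = triple (l a) \<mu>1 \<mu>2 - triple (l b) \<mu>1 \<mu>2"
proof -
  have "f2 a - f1 a + triple (l a) \<mu>1 \<mu>2 = f2 b - f1 b + triple (l b) \<mu>1 \<mu>2"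
  proof (rule locally_constant_interval[where h = "\<lambda>t. f2 t - f1 t + triple (l t) \<mu>1 \<mu>2", OF \<open>a \<le> b\<close>])
    fix t assume t: "t \<in> {a..b}"
    obtain W where W: "transv W (l t)" "transv W \<mu>1" "transv W \<mu>2"
      using common_transversal3[OF lag_continuous_lag[OF l t] m] by blast
    show "eventually (\<lambda>t'. f2 t' - f1 t' + triple (l t') \<mu>1 \<mu>2 = f2 t - f1 t + triple (l t) \<mu>1 \<mu>2) (at t within {a..b})"
      using index_funD[OF f1 t W(2,1)] index_funD[OF f2 t W(3,1)] lag_tendsto_transv[OF lag_continuousD[OF l t] W(1)]
    proof eventually_elim
      case (elim t')
      show ?case using triple_eq[OF W] triple_eq[OF elim(3) W(2,3)] elim(1,2) by linarith
    qed
  qed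
  then show ?thesis by linarith
qed

section \<open>Bounds and cocycle identity of the triple index\<close>

lemma triple_bounds:
  assumes "lag X" "lag Y" "lag Z"
  shows "0 \<le> triple X Y Z" "triple X Y Z \<le> int n - int (dim (ssum (X \<inter> Y) (Y \<inter> Z)))"
proof -
  obtain W where W: "transv W X" "transv W Y" "transv W Z" using common_transversal3[OF assms] by blast
  show "0 \<le> triple X Y Z" "triple X Y Z \<le> int n - int (dim (ssum (X \<inter> Y) (Y \<inter> Z)))"
    using gind_triangle[OF W] unfolding triple_eq[OF W] by linarith+
qed

text \<open>Over a common base the triple index is a coboundary. The identity moves the comparison
  from the pair of reference Lagrangians to the pair of endpoints of the path, from which the second
  family of subspaces in the theorem arises.\<close>

lemma triple_cocycle:
  assumes "lag A" "lag B" "lag X" "lag Y"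
  shows "triple A X Y - triple B X Y = triple A B Y - triple A B X"
proof -
  obtain W where "\<And>L. L \<in> {A, B, X, Y} \<Longrightarrow> transv W L"
    by (rule common_transversal[of "{A, B, X, Y}"]) (use assms in auto)
  then have W: "transv W A" "transv W B" "transv W X" "transv W Y" by blast+
  show ?thesis
    unfolding triple_eq[OF W(1,3,4)] triple_eq[OF W(2,3,4)] triple_eq[OF W(1,2,4)] triple_eq[OF W(1,2,3)]
    by linarith
qed

section \<open>Homotopy invariance\<close>

text \<open>On a small rectangle one base serves all Lagrangians of the homotopy, so an increment in
  \<open>t\<close> depends on the two ends only. Adding such pieces cancels the contributions of the
  inner division points.\<close>

lemma index_homotopy_invariant:
  assumes L0: "lag L0" and "a \<le> b"
    and lagH: "\<And>s t. s \<in> {0..1} \<Longrightarrow> t \<in> {a..b} \<Longrightarrow> lag (H s t)"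
    and contH: "\<And>v. continuous_on ({0..1} \<times> {a..b}) (\<lambda>(s,t). closest_point (H s t) v)"
    and ends: "\<And>s. s \<in> {0..1} \<Longrightarrow> H s a = la" "\<And>s. s \<in> {0..1} \<Longrightarrow> H s b = lb"
    and f: "\<And>s. s \<in> {0..1::real} \<Longrightarrow> index_fun L0 (H s) {a..b} (f s)"
  shows "f 0 b - f 0 a = f 1 b - f 1 a"
proof (rule locally_constant_interval[where h = "\<lambda>s. f s b - f s a"])
  show "(0::real) \<le> 1" by simp
  fix s0 :: real assume s0: "s0 \<in> {0..1}"
  let ?F = "at s0 within {0..1}"
  let ?g = "\<lambda>W L. int (gind W L L0)"
  have tend: "lag_tendsto (\<lambda>s. H s t) (H s0 t) ?F" if t: "t \<in> {a..b}" for t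
  proof -
    have "continuous_on {0..1} (\<lambda>s. (\<lambda>(s,t). closest_point (H s t) v) (s, t))" for v
      by (rule continuous_on_compose2[OF contH]) (use t in \<open>auto intro!: continuous_intros\<close>)
    then show ?thesis
      using s0 t lagH unfolding continuous_on_def
      by (intro lag_tendsto_withinI[where l = "\<lambda>s. H s t"]) simp_all
  qed
  \<comment> \<open>\<open>P c d\<close> says that near \<open>s0\<close> the increment over
    \<open>{c..d}\<close> changes by the motion of the right end minus that of the left end. The
    bases at both ends are quantified, so that adjacent intervals can be joined with any common base
    at the shared point.\<close>
  define P where "P c d \<longleftrightarrow> a \<le> c \<and> d \<le> b \<and> c \<le> d \<longrightarrow>
    (\<forall>W W'. transv W L0 \<and> transv W (H s0 c) \<and> transv W' L0 \<and> transv W' (H s0 d) \<longrightarrow>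
      eventually (\<lambda>s. (f s d - f s c) - (f s0 d - f s0 c)
        = (?g W' (H s d) - ?g W' (H s0 d)) - (?g W (H s c) - ?g W (H s0 c))) ?F)" for c d
  have Pab: "P a b"
  proof (rule Bolzano[where P = P, OF \<open>a \<le> b\<close>])
    fix c e d assume trans: "P c e" "P e d" "c \<le> e" "e \<le> d"
    show "P c d"
      unfolding P_def
    proof (intro impI allI)
      fix W W' assume h: "a \<le> c \<and> d \<le> b \<and> c \<le> d"
        and W: "transv W L0 \<and> transv W (H s0 c) \<and> transv W' L0 \<and> transv W' (H s0 d)"
      have e: "e \<in> {a..b}" using h trans by auto
      obtain V where V: "transv V L0" "transv V (H s0 e)"
        using common_transversal3[OF L0 lagH[OF s0 e] L0] by blast
      have 1: "eventually (\<lambda>s. (f s e - f s c) - (f s0 e - f s0 c)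
        = (?g V (H s e) - ?g V (H s0 e)) - (?g W (H s c) - ?g W (H s0 c))) ?F"
        using trans(1) h trans(3,4) e W V unfolding P_def by simp
      have 2: "eventually (\<lambda>s. (f s d - f s e) - (f s0 d - f s0 e)
        = (?g W' (H s d) - ?g W' (H s0 d)) - (?g V (H s e) - ?g V (H s0 e))) ?F"
        using trans(2) h trans(3,4) e W V unfolding P_def by simp
      show "eventually (\<lambda>s. (f s d - f s c) - (f s0 d - f s0 c)
        = (?g W' (H s d) - ?g W' (H s0 d)) - (?g W (H s c) - ?g W (H s0 c))) ?F"
        using 1 2 by eventually_elim linarith
    qed
  next
    fix x assume "a \<le> x" "x \<le> b"
    then have x: "x \<in> {a..b}" by auto
    obtain V where V: "transv V L0" "transv V (H s0 x)"
      using common_transversal3[OF L0 lagH[OF s0 x] L0] by blast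
    have "lag_tendsto (\<lambda>(s,t). H s t) (H s0 x) (at (s0, x) within {0..1} \<times> {a..b})"
      unfolding lag_tendsto_def
    proof (intro conjI allI)
      show "lag (H s0 x)" by (rule lagH[OF s0 x])
      show "eventually (\<lambda>i. lag (case i of (s, t) \<Rightarrow> H s t)) (at (s0, x) within {0..1} \<times> {a..b})"
        using eventually_at_within_mem by eventually_elim (use lagH in auto)
      fix v
      have "((\<lambda>(s,t). closest_point (H s t) v) \<longlongrightarrow> (\<lambda>(s,t). closest_point (H s t) v) (s0, x))
          (at (s0, x) within {0..1} \<times> {a..b})"
        using contH[of v] s0 x unfolding continuous_on_def by blast
      then show "((\<lambda>i. closest_point (case i of (s, t) \<Rightarrow> H s t) v) \<longlongrightarrow> closest_point (H s0 x) v)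
          (at (s0, x) within {0..1} \<times> {a..b})"
        by (simp add: case_prod_beta')
    qed
    from lag_tendsto_transv[OF this V(2)]
    obtain e where e: "e > 0" "\<And>s t. s \<in> {0..1} \<Longrightarrow> t \<in> {a..b} \<Longrightarrow> (s, t) \<noteq> (s0, x) \<Longrightarrow> dist (s, t) (s0, x) < e \<Longrightarrow> transv V (H s t)"
      unfolding eventually_at by fastforce
    have e': "transv V (H s t)" if "s \<in> {0..1}" "t \<in> {a..b}" "\<bar>s - s0\<bar> < e/2" "\<bar>t - x\<bar> < e/2" for s t
    proof (cases "(s, t) = (s0, x)")
      case True then show ?thesis using V by simp
    next
      case False
      have "dist (s, t) (s0, x) \<le> \<bar>s - s0\<bar> + \<bar>t - x\<bar>"
        using sqrt_sum_squares_le_sum_abs[of "s - s0" "t - x"] by (simp add: dist_Pair_Pair dist_real_def)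
      then show ?thesis using e(2)[OF that(1,2) False] that by linarith
    qed
    have "P c d" if cd': "c \<le> x" "x \<le> d" "d - c < e/2" for c d
      unfolding P_def
    proof (intro impI allI)
      fix W W' assume h: "a \<le> c \<and> d \<le> b \<and> c \<le> d"
        and W: "transv W L0 \<and> transv W (H s0 c) \<and> transv W' L0 \<and> transv W' (H s0 d)"
      have m: "c \<in> {a..b}" "d \<in> {a..b}" using h by auto
      have near: "transv V (H s t)" if "s \<in> {0..1}" "\<bar>s - s0\<bar> < e/2" "t \<in> {c..d}" for s t
      proof (rule e')
        show "\<bar>t - x\<bar> < e/2" using that(3) cd' unfolding atLeastAtMost_iff by linarith
      qed (use that h in auto)
      have V0: "transv V (H s0 c)" "transv V (H s0 d)" using near[of s0] s0 e(1) h by auto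
      have incr: "f s d - f s c = ?g V (H s d) - ?g V (H s c)" if s: "s \<in> {0..1}" "\<bar>s - s0\<bar> < e/2" for s
      proof (rule index_fun_increment[OF _ V(1)])
        show "index_fun L0 (H s) {c..d} (f s)" using index_fun_subset[OF f[OF s(1)], of "{c..d}"] h by auto
        show "transv V (H s t)" if "t \<in> {c..d}" for t by (rule near[OF s that])
        show "c \<le> d" using h by blast
      qed
      have ev: "eventually (\<lambda>s. s \<in> {0..1} \<and> \<bar>s - s0\<bar> < e/2) ?F"
        unfolding eventually_at using e(1) by (intro exI[of _ "e/2"]) (auto simp: dist_real_def)
      have "transv W L0" "transv W (H s0 c)" "transv W' L0" "transv W' (H s0 d)" using W by auto
      note gind_change_base[OF tend[OF m(1)] this(2,1) V0(1) V(1)] gind_change_base[OF tend[OF m(2)] this(4,3) V0(2) V(1)]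
      with ev show "eventually (\<lambda>s. (f s d - f s c) - (f s0 d - f s0 c)
        = (?g W' (H s d) - ?g W' (H s0 d)) - (?g W (H s c) - ?g W (H s0 c))) ?F"
      proof eventually_elim
        case (elim s)
        have "f s0 d - f s0 c = ?g V (H s0 d) - ?g V (H s0 c)" by (rule incr) (use s0 e(1) in auto)
        moreover have "f s d - f s c = ?g V (H s d) - ?g V (H s c)" by (rule incr) (use elim in auto)
        ultimately show ?case using elim(2,3) by linarith
      qed
    qed
    then show "\<exists>e>0. \<forall>c d. c \<le> x \<and> x \<le> d \<and> d - c < e \<longrightarrow> P c d"
      using e(1) by (intro exI[of _ "e/2"]) simp
  qed
  \<comment> \<open>Both ends stay fixed during the homotopy, so their motions vanish and the
    increment over the whole interval is locally constant in \<open>s\<close>.\<close>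
  have la: "lag la" "lag lb" using lagH[of 0 a] lagH[of 0 b] ends[of 0] \<open>a \<le> b\<close> by auto
  obtain W where W: "transv W L0" "transv W la" "transv W lb"
    using common_transversal3[OF L0 la] by blast
  then have "eventually (\<lambda>s. (f s b - f s a) - (f s0 b - f s0 a)
        = (?g W (H s b) - ?g W (H s0 b)) - (?g W (H s a) - ?g W (H s0 a))) ?F"
    using Pab \<open>a \<le> b\<close> ends[OF s0] unfolding P_def by simp
  with eventually_at_within_mem show "eventually (\<lambda>s. f s b - f s a = f s0 b - f s0 a) ?F"
    by eventually_elim (use ends s0 in simp)
qed

lemma index_fun_cong:
  assumes "index_fun L0 l S f" "\<And>t. t \<in> S \<Longrightarrow> l t = l' t"
  shows "index_fun L0 l' S f"
  unfolding index_fun_def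
proof (intro ballI allI impI)
  fix t W assume t: "t \<in> S" and W: "transv W L0" "transv W (l' t)"
  have "transv W (l t)" using W assms(2)[OF t] by simp
  from index_funD[OF assms(1) t W(1) this] eventually_at_within_mem
  show "eventually (\<lambda>t'. f t' - f t = int (gind W (l' t') L0) - int (gind W (l' t) L0)) (at t within S)"
    by eventually_elim (use assms(2) t in simp)
qed

lemma lag_homotopic_index:
  assumes L0: "lag L0" and "a \<le> b" and h: "lag_homotopic \<omega> n l l' a b"
    and f: "index_fun L0 l {a..b} f" and f': "index_fun L0 l' {a..b} f'"
  shows "f b - f a = f' b - f' a"
proof -
  obtain H :: "real \<Rightarrow> real \<Rightarrow> 'v set" where H': "(\<forall>s\<in>{0..1}. \<forall>t\<in>{a..b}. lag (H s t))
    \<and> (\<forall>v. continuous_on ({0..1} \<times> {a..b}) (\<lambda>(s,t). closest_point (H s t) v))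
    \<and> (\<forall>t\<in>{a..b}. H 0 t = l t \<and> H 1 t = l' t)
    \<and> (\<forall>s\<in>{0..1}. H s a = l a \<and> H s b = l b)"
    using h[unfolded lag_homotopic_def] by (elim exE) (rule that)
  have H: "\<And>s t. s \<in> {0..1} \<Longrightarrow> t \<in> {a..b} \<Longrightarrow> lag (H s t)"
    "\<And>v. continuous_on ({0..1} \<times> {a..b}) (\<lambda>(s,t). closest_point (H s t) v)"
    "\<And>t. t \<in> {a..b} \<Longrightarrow> H 0 t = l t \<and> H 1 t = l' t"
    "\<And>s. s \<in> {0..1} \<Longrightarrow> H s a = l a \<and> H s b = l b"
    using H' by simp_all
  have cont: "lag_continuous (H s) {a..b}" if s: "s \<in> {0..1}" for s
  proof -
    have "continuous_on {a..b} (\<lambda>t. (\<lambda>(s,t). closest_point (H s t) v) (s, t))" for v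
      by (rule continuous_on_compose2[OF H(2)]) (use s in \<open>auto intro!: continuous_intros\<close>)
    then show ?thesis
      using s H(1) by (intro lag_path_continuous) (auto simp: lag_path_def)
  qed
  have "\<exists>F. index_fun L0 (H s) {a..b} F" if s: "s \<in> {0..1}" for s
    by (rule index_fun_exists[OF L0 cont[OF s] \<open>a \<le> b\<close>])
  then obtain F where F: "\<And>s. s \<in> {0..1} \<Longrightarrow> index_fun L0 (H s) {a..b} (F s)" by metis
  have "F 0 b - F 0 a = F 1 b - F 1 a"
    by (rule index_homotopy_invariant[OF L0 \<open>a \<le> b\<close> H(1,2) _ _ F]) (use H(4) in auto)
  moreover have "F 0 b - F 0 a = f b - f a"
    by (rule index_fun_unique[OF L0 cont \<open>a \<le> b\<close> F index_fun_cong[OF f]]) (use H(3) in auto)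
  moreover have "F 1 b - F 1 a = f' b - f' a"
    by (rule index_fun_unique[OF L0 cont \<open>a \<le> b\<close> F index_fun_cong[OF f']]) (use H(3) in auto)
  ultimately show ?thesis by simp
qed

end

subsection \<open>The crossing formula\<close>

lemma has_vector_derivative_tendsto_iff:
  "(f has_vector_derivative D) (at x within S) \<longleftrightarrow> ((\<lambda>y. (f y - f x) /\<^sub>R (y - x)) \<longlongrightarrow> D) (at x within S)"
proof -
  have e: "norm (f y - f x - (y - x) *\<^sub>R D) / norm (y - x) = norm ((f y - f x) /\<^sub>R (y - x) - D)" if "y \<noteq> x" for y
  proof -
    have "(f y - f x) /\<^sub>R (y - x) - D = (f y - f x - (y - x) *\<^sub>R D) /\<^sub>R (y - x)"
      using that by (simp add: scaleR_diff_right)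
    then show ?thesis by (simp add: divide_inverse mult.commute)
  qed
  have "((\<lambda>y. norm (f y - f x - (y - x) *\<^sub>R D) / norm (y - x)) \<longlongrightarrow> 0) (at x within S)
      \<longleftrightarrow> ((\<lambda>y. norm ((f y - f x) /\<^sub>R (y - x) - D)) \<longlongrightarrow> 0) (at x within S)"
  proof (rule filterlim_cong[OF refl refl])
    show "eventually (\<lambda>y. norm (f y - f x - (y - x) *\<^sub>R D) / norm (y - x) = norm ((f y - f x) /\<^sub>R (y - x) - D)) (at x within S)"
      unfolding eventually_at_filter using e by (intro always_eventually) blast
  qed
  then show ?thesis
    unfolding has_vector_derivative_def has_derivative_iff_norm
    by (simp add: bounded_linear_scaleR_left tendsto_norm_zero_iff LIM_zero_iff)
qed

lemma at_within_Icc_nontrivial: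
  fixes a b :: real
  assumes "a < b" "t \<in> {a..b}" shows "at t within {a..b} \<noteq> bot"
  using assms by (simp add: trivial_limit_within)

lemma eventually_at_split:
  fixes t :: real
  assumes "eventually P (at t within (S \<inter> {t<..}))" "eventually P (at t within (S \<inter> {..<t}))"
  shows "eventually P (at t within S)"
  using assms unfolding eventually_at_filter
  by eventually_elim (auto simp: neq_iff)

lemma pos_index_trivial [simp]: "pos_index Q {0} = 0"
proof -
  obtain U where U: "subspace U" "U \<subseteq> {0}" "\<And>u. u \<in> U \<Longrightarrow> u \<noteq> 0 \<Longrightarrow> Q u > 0" "dim U = pos_index Q {0}"
    using pos_index_witness[of "{0}" Q] by blast
  then show ?thesis using dim_eq_0[of U] by simp
qed

lemma neg_index_trivial [simp]: "neg_index Q {0} = 0"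
  by (simp add: neg_index_eq)

lemma qsgn_trivial [simp]: "qsgn Q {0} = 0"
  by (simp add: qsgn_def)

text \<open>Linearity passes to the derivative because derivatives within a nontrivial interval are
  unique.\<close>

lemma linear_closest_point_derivative:
  fixes l :: "real \<Rightarrow> 'a::euclidean_space set"
  assumes "a < b" "t \<in> {a..b}" and sl: "\<And>t. t \<in> {a..b} \<Longrightarrow> subspace (l t)"
    and D: "\<And>v. ((\<lambda>s. closest_point (l s) v) has_vector_derivative D v) (at t within {a..b})"
  shows "linear D"
proof (rule linearI)
  fix u v :: 'a and c :: real
  note lin = linear_closest_point[OF sl]
  have "((\<lambda>s. closest_point (l s) (u + v)) has_vector_derivative D u + D v) (at t within {a..b})"
    by (rule has_vector_derivative_transform[OF assms(2) _ has_vector_derivative_add[OF D D]])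
      (simp add: linear_add[OF lin])
  then show "D (u + v) = D u + D v"
    by (rule vector_derivative_unique_within[OF at_within_Icc_nontrivial[OF assms(1,2)] D])
  have "((\<lambda>s. closest_point (l s) (c *\<^sub>R v)) has_vector_derivative c *\<^sub>R D v) (at t within {a..b})"
    by (rule has_vector_derivative_transform[OF assms(2) _ bounded_linear.has_vector_derivative[OF bounded_linear_scaleR_right D]])
      (simp add: linear_cmul[OF lin])
  then show "D (c *\<^sub>R v) = c *\<^sub>R D v"
    by (rule vector_derivative_unique_within[OF at_within_Icc_nontrivial[OF assms(1,2)] D])
qed

context symplectic_space
begin

text \<open>The quotient shared by the crossing form and the graph form. Since \<open>x t\<close>
  and the graph vector lie in the same Lagrangian \<open>l t\<close>, subtracting \<open>x t\<close>
  leaves the pairing of \<open>x t0\<close> with the graph vector unchanged. Thus the derivative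
  falls on \<open>x\<close>, and \<open>wpart\<close> has only to be continuous.\<close>

lemma crossing_derivative:
  assumes l: "lag_continuous l {a..b}" and t0: "t0 \<in> {a..b}" and W: "transv W (l t0)"
    and x: "\<And>t. t \<in> {a..b} \<Longrightarrow> x t \<in> l t" "(x has_vector_derivative x') (at t0 within {a..b})"
  shows "((\<lambda>t. - \<omega> (x t - x t0) (u + wpart W (l t) u) / (t - t0)) \<longlongrightarrow> \<omega> (u + wpart W (l t0) u) x') (at t0 within {a..b})"
proof -
  have "((\<lambda>t. - \<omega> ((x t - x t0) /\<^sub>R (t - t0)) (u + wpart W (l t) u)) \<longlongrightarrow> - \<omega> x' (u + wpart W (l t0) u)) (at t0 within {a..b})"
    using x(2) unfolding has_vector_derivative_tendsto_iff
    by (intro tendsto_minus tendsto_\<omega> tendsto_add tendsto_const lag_tendsto_wpart[OF lag_continuousD[OF l t0] W])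
  moreover have "\<omega> (d /\<^sub>R h) y = \<omega> d y / h" for d y and h :: real
    by (simp add: \<omega>_simps divide_inverse mult.commute)
  ultimately show ?thesis using skew[of "u + wpart W (l t0) u" x'] by simp
qed

text \<open>The velocity of any curve in \<open>l\<close> through the given vector replaces the
  auxiliary Lagrangian. The same value results for every transversal \<open>W\<close>, so the
  definite description is meaningful.\<close>

lemma crossing_form_eq:
  assumes l: "lag_continuous l {a..b}" and "a < b" and t0: "t0 \<in> {a..b}"
    and x: "\<And>t. t \<in> {a..b} \<Longrightarrow> x t \<in> l t" "(x has_vector_derivative x') (at t0 within {a..b})"
  shows "crossing_form \<omega> n l a b t0 (x t0) = \<omega> (x t0) x'"
proof -
  let ?v = "x t0"
  have v: "?v \<in> l t0" by (rule x(1)[OF t0])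
  have lagt: "lag (l t0)" by (rule lag_continuous_lag[OF l t0])
  have der: "((\<lambda>t. \<omega> ?v (wpart W (l t) ?v)) has_real_derivative \<omega> ?v x') (at t0 within {a..b})"
    if W: "transv W (l t0)" for W
    unfolding has_field_derivative_iff
  proof (rule Lim_transform_eventually)
    have w0: "wpart W (l t0) ?v = 0" by (rule wpart_in_L[OF W v])
    show "((\<lambda>t. - \<omega> (x t - ?v) (?v + wpart W (l t) ?v) / (t - t0)) \<longlongrightarrow> \<omega> ?v x') (at t0 within {a..b})"
      using crossing_derivative[OF l t0 W x, of ?v] by (simp add: w0)
    show "eventually (\<lambda>t. - \<omega> (x t - ?v) (?v + wpart W (l t) ?v) / (t - t0)
        = (\<omega> ?v (wpart W (l t) ?v) - \<omega> ?v (wpart W (l t0) ?v)) / (t - t0)) (at t0 within {a..b})"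
      using lag_tendsto_transv[OF lag_continuousD[OF l t0] W] eventually_at_within_mem
    proof eventually_elim
      case (elim t)
      have "\<omega> (x t) (?v + wpart W (l t) ?v) = 0"
        by (rule lag_iso[OF lag_continuous_lag[OF l elim(2)] x(1)[OF elim(2)] wpart_mem(2)[OF elim(1)]])
      then have "- \<omega> (x t - ?v) (?v + wpart W (l t) ?v) = \<omega> ?v (wpart W (l t) ?v)"
        by (simp add: \<omega>_simps)
      then show ?case by (simp add: w0 \<omega>_simps)
    qed
  qed
  show ?thesis
    unfolding crossing_form_def
  proof (rule the_equality)
    obtain W where W: "transv W (l t0)" using common_transversal3[OF lagt lagt lagt] by blast
    show "\<exists>W. lag W \<and> W \<inter> l t0 = {0} \<and>
      ((\<lambda>t. \<omega> ?v (THE w. w \<in> W \<and> ?v + w \<in> l t)) has_real_derivative \<omega> ?v x') (at t0 within {a..b})"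
      using der[OF W] W unfolding wpart_def transv_def by blast
    fix q assume "\<exists>W. lag W \<and> W \<inter> l t0 = {0} \<and>
      ((\<lambda>t. \<omega> ?v (THE w. w \<in> W \<and> ?v + w \<in> l t)) has_real_derivative q) (at t0 within {a..b})"
    then obtain W where W: "lag W" "W \<inter> l t0 = {0}"
      "((\<lambda>t. \<omega> ?v (THE w. w \<in> W \<and> ?v + w \<in> l t)) has_real_derivative q) (at t0 within {a..b})" by blast
    have W': "transv W (l t0)" using W lagt by (simp add: transv_def)
    show "q = \<omega> ?v x'"
      using tendsto_unique[OF at_within_Icc_nontrivial[OF \<open>a < b\<close> t0] W(3)[unfolded has_field_derivative_iff]
          der[OF W', unfolded has_field_derivative_iff wpart_def]] .
  qed
qed

lemma lag_path_C1_continuous: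
  assumes "lag_path_C1 \<omega> n l a b" shows "lag_continuous l {a..b}"
proof (rule lag_path_continuous)
  have "continuous_on {a..b} (\<lambda>t. closest_point (l t) v)" for v
  proof -
    obtain D where "\<forall>t\<in>{a..b}. ((\<lambda>s. closest_point (l s) v) has_vector_derivative D t) (at t within {a..b})"
      using assms unfolding lag_path_C1_def by blast
    then show ?thesis by (meson continuous_on_eq_continuous_within has_vector_derivative_continuous)
  qed
  then show "lag_path \<omega> n l a b" using assms by (simp add: lag_path_C1_def lag_path_def)
qed

text \<open>On \<open>l t0 \<inter> L0\<close> the graph form against \<open>L0\<close> vanishes at
  \<open>t0\<close>, and its first-order part is the crossing form. So \<open>index_jump\<close>
  applies with \<open>h = t - t0\<close> on the right, and on the left with
  \<open>h = t0 - t\<close> and the negated derivative; \<open>W\<close> is the part of the radical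
  that persists.\<close>

lemma crossing_jump:
  assumes C1: "lag_path_C1 \<omega> n l a b" and "a < b" and t0: "t0 \<in> {a..b}"
    and W: "transv W (l t0)" "transv W L0"
    and nd: "nondegenerate (crossing_form \<omega> n l a b t0) (l t0 \<inter> L0)"
  shows "eventually (\<lambda>t. gind W (l t) L0 = gind W (l t0) L0 + pos_index (crossing_form \<omega> n l a b t0) (l t0 \<inter> L0)
      \<and> l t \<inter> L0 = {0}) (at t0 within ({a..b} \<inter> {t0<..}))" (is ?right)
    and "eventually (\<lambda>t. gind W (l t) L0 = gind W (l t0) L0 + neg_index (crossing_form \<omega> n l a b t0) (l t0 \<inter> L0)
      \<and> l t \<inter> L0 = {0}) (at t0 within ({a..b} \<inter> {..<t0}))" (is ?left)
proof -
  let ?F = "at t0 within {a..b}"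
  let ?K = "l t0 \<inter> L0"
  let ?Q = "crossing_form \<omega> n l a b t0"
  have l: "lag_continuous l {a..b}" by (rule lag_path_C1_continuous[OF C1])
  have sl: "subspace (l t)" if "t \<in> {a..b}" for t by (rule lag_subspace[OF lag_continuous_lag[OF l that]])
  have "\<forall>v. \<exists>d. ((\<lambda>s. closest_point (l s) v) has_vector_derivative d) ?F"
    using C1 t0 unfolding lag_path_C1_def by blast
  then obtain D where D: "\<And>v. ((\<lambda>s. closest_point (l s) v) has_vector_derivative D v) ?F" by metis
  have linD: "linear D" by (rule linear_closest_point_derivative[OF \<open>a < b\<close> t0 sl D])
  have lagL0: "lag L0" and sL0: "subspace L0" and sW: "subspace W"
    using W by (auto simp: transv_def lag_subspace)
  have K: "subspace ?K" using sl[OF t0] sL0 by (rule subspace_inter)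
  have Qeq: "?Q v = \<omega> v (D v)" if "v \<in> l t0" for v
  proof -
    have e: "closest_point (l t0) v = v" by (rule closest_point_self[OF that])
    have "crossing_form \<omega> n l a b t0 (closest_point (l t0) v) = \<omega> (closest_point (l t0) v) (D v)"
      by (rule crossing_form_eq[OF l \<open>a < b\<close> t0 _ D]) (rule closest_point_subspace(1)[OF sl])
    then show ?thesis by (simp only: e)
  qed
  \<comment> \<open>The derivative of the graph form in the direction of \<open>k\<close> from the
    crossing space and arbitrary \<open>u\<close>. The mixed entries are included because
    \<open>index_jump\<close> asks for them; for \<open>u = k\<close> it is the crossing
    form.\<close>
  define C where "C k u = \<omega> (u + wpart W (l t0) u) (D k)" for k u
  have lw: "linear (wpart W (l t0))" by (rule wpart_linear[OF W(1)])
  have C: "bilinear C"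
    unfolding bilinear_def C_def
    by (auto intro!: linearI simp: linear_add[OF lw] linear_cmul[OF lw] linear_add[OF linD] linear_cmul[OF linD] \<omega>_simps algebra_simps)
  have CQ: "C k k = ?Q k" if "k \<in> ?K" for k
    using that Qeq[of k] wpart_in_L[OF W(1), of k] by (simp add: C_def)
  define S where "S t = gform W (l t) L0" for t
  note evT = lag_tendsto_transv[OF lag_continuousD[OF l t0] W(1)]
  have Clim: "((\<lambda>t. S t k u / (t - t0)) \<longlongrightarrow> C k u) ?F" if k: "k \<in> ?K" for k u
  proof -
    have kl: "k \<in> l t0" "k \<in> L0" using k by auto
    have e: "closest_point (l t0) k = k" by (rule closest_point_self[OF kl(1)])
    show ?thesis
    proof (rule Lim_transform_eventually)
      show "((\<lambda>t. - \<omega> (closest_point (l t) k - closest_point (l t0) k) (u + wpart W (l t) u) / (t - t0)) \<longlongrightarrow> C k u) ?F"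
        unfolding C_def
        by (rule crossing_derivative[OF l t0 W(1) _ D]) (rule closest_point_subspace(1)[OF sl])
      show "eventually (\<lambda>t. - \<omega> (closest_point (l t) k - closest_point (l t0) k) (u + wpart W (l t) u) / (t - t0)
          = S t k u / (t - t0)) ?F"
        using evT eventually_at_within_mem
      proof eventually_elim
        case (elim t)
        have "\<omega> (closest_point (l t) k) (u + wpart W (l t) u) = 0"
          by (rule lag_iso[OF lag_continuous_lag[OF l elim(2)] closest_point_subspace(1)[OF sl[OF elim(2)]] wpart_mem(2)[OF elim(1)]])
        moreover have "\<omega> k (u + wpart W L0 u) = 0" by (rule lag_iso[OF lagL0 kl(2) wpart_mem(2)[OF W(2)]])
        ultimately have "- \<omega> (closest_point (l t) k - k) (u + wpart W (l t) u) = S t k u"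
          by (simp add: S_def gform_def \<omega>_simps)
        then show ?case by (simp add: e)
      qed
    qed
  qed
  \<comment> \<open>On the crossing space \<open>C\<close> is symmetric as a limit of symmetric
    forms.\<close>
  have Csym: "C u v = C v u" if "u \<in> ?K" "v \<in> ?K" for u v
  proof (rule tendsto_unique[OF at_within_Icc_nontrivial[OF \<open>a < b\<close> t0] Clim[OF that(1)]])
    show "((\<lambda>t. S t u v / (t - t0)) \<longlongrightarrow> C v u) ?F"
      by (rule Lim_transform_eventually[OF Clim[OF that(2)]])
        (use evT in \<open>eventually_elim, simp add: S_def gform_sym[OF _ W(2)]\<close>)
  qed
  have Crad: "form_radical C ?K \<subseteq> {0}"
  proof
    fix u assume "u \<in> form_radical C ?K"
    then have u: "u \<in> ?K" "\<And>v. v \<in> ?K \<Longrightarrow> C u v = 0" unfolding form_radical_def by blast+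
    have "?Q (u + v) - ?Q u - ?Q v = 0" if v: "v \<in> ?K" for v
    proof -
      have uv: "u + v \<in> ?K" by (rule subspace_add[OF K u(1) v])
      have "C (u + v) (u + v) = C u u + C v v"
        using u(2)[OF v] Csym[OF u(1) v] by (simp add: bilinear_simps[OF C])
      then show ?thesis using CQ[OF uv] CQ[OF u(1)] CQ[OF v] by linarith
    qed
    then show "u \<in> {0}" using nd u(1) unfolding nondegenerate_def by blast
  qed
  have S0: "bilinear (S t0)" "S t0 u v = S t0 v u" for u v
    using gform_bilinear[OF W] gform_sym[OF W] by (simp_all add: S_def)
  have evS: "eventually (\<lambda>t. bilinear (S t) \<and> (\<forall>u v. S t u v = S t v u)) ?F"
    using evT by eventually_elim (use gform_bilinear[OF _ W(2)] gform_sym[OF _ W(2)] in \<open>unfold S_def, blast\<close>)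
  have conv: "((\<lambda>t. S t x y) \<longlongrightarrow> S t0 x y) ?F" for x y
    unfolding S_def by (rule lag_tendsto_gform(1)[OF lag_continuousD[OF l t0] W(1)])
  have KR: "?K \<subseteq> form_radical (S t0) UNIV"
    unfolding S_def gform_radical[OF W] using ssum_mem_right[OF sW] by blast
  have evR: "eventually (\<lambda>t. W \<subseteq> form_radical (S t) UNIV) ?F"
    using evT
  proof eventually_elim
    case (elim t)
    have "subspace (l t \<inter> L0)" using elim sL0 by (simp add: transv_def lag_subspace subspace_inter)
    then show ?case unfolding S_def gform_radical[OF elim W(2)] using ssum_mem_left by blast
  qed
  have dR: "dim (form_radical (S t0) UNIV) = dim W + dim ?K"
    unfolding S_def dim_gform_radical[OF W] using W by (simp add: transv_def lag_dim)
  have mono: "eventually P (at t0 within ({a..b} \<inter> T))" if "eventually P ?F" for P T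
    using that at_le[of "{a..b} \<inter> T" "{a..b}" t0] by (auto intro: filter_leD)
  have tmono: "(f \<longlongrightarrow> y) (at t0 within ({a..b} \<inter> T))" if "(f \<longlongrightarrow> y) ?F" for f :: "real \<Rightarrow> real" and y T
    using that by (rule tendsto_within_subset) simp
  have fin: "l t \<inter> L0 = {0}" if "transv W (l t)" "dim (form_radical (S t) UNIV) = dim W" for t
  proof -
    have "dim (l t \<inter> L0) = 0"
      using that W dim_gform_radical[OF that(1) W(2)] by (simp add: S_def transv_def lag_dim)
    then have "l t \<inter> L0 \<subseteq> {0}" by (simp only: dim_eq_0)
    moreover have "0 \<in> l t \<inter> L0" using that(1) sL0 by (simp add: transv_def lag_subspace subspace_0)
    ultimately show ?thesis by blast
  qed
  have idt: "((\<lambda>t. t - t0) \<longlongrightarrow> 0) ?F" using tendsto_diff[OF tendsto_ident_at tendsto_const, of t0 t0 "{a..b}"] by simp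
  have "eventually (\<lambda>t. pos_index (\<lambda>v. S t v v) UNIV = pos_index (\<lambda>v. S t0 v v) UNIV + pos_index (\<lambda>v. C v v) ?K
     \<and> dim (form_radical (S t) UNIV) = dim W) (at t0 within ({a..b} \<inter> {t0<..}))"
    by (rule index_jump[where h = "\<lambda>t. t - t0", OF S0 mono[OF evS] tmono[OF conv] K KR _ tmono[OF idt] C Csym Crad tmono[OF Clim]
          mono[OF evR] dR])
      (auto simp: eventually_at_filter)
  then show ?right
    using mono[OF evT]
  proof eventually_elim
    case (elim t)
    have "pos_index (\<lambda>v. C v v) ?K = pos_index ?Q ?K" by (rule pos_index_cong[OF CQ])
    then show ?case using elim fin[OF elim(2)] by (simp add: gind_def S_def)
  qed
  have C': "bilinear (\<lambda>u v. - C u v)" by (rule bilinear_uminus[OF C])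
  have "eventually (\<lambda>t. pos_index (\<lambda>v. S t v v) UNIV = pos_index (\<lambda>v. S t0 v v) UNIV + pos_index (\<lambda>v. - C v v) ?K
     \<and> dim (form_radical (S t) UNIV) = dim W) (at t0 within ({a..b} \<inter> {..<t0}))"
  proof (rule index_jump[where h = "\<lambda>t. t0 - t" and C = "\<lambda>u v. - C u v", OF S0 mono[OF evS] tmono[OF conv] K KR _ _ C' _ _ _ mono[OF evR] dR])
    show "eventually (\<lambda>t. 0 < t0 - t) (at t0 within ({a..b} \<inter> {..<t0}))" by (auto simp: eventually_at_filter)
    show "((\<lambda>t. t0 - t) \<longlongrightarrow> 0) (at t0 within ({a..b} \<inter> {..<t0}))"
      using tendsto_minus[OF tmono[OF idt]] by simp
    show "- C u v = - C v u" if "u \<in> ?K" "v \<in> ?K" for u v using Csym[OF that] by simp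
    show "form_radical (\<lambda>u v. - C u v) ?K \<subseteq> {0}" using Crad by (simp add: form_radical_def)
    show "((\<lambda>t. S t k u / (t0 - t)) \<longlongrightarrow> - C k u) (at t0 within ({a..b} \<inter> {..<t0}))" if "k \<in> ?K" for k u
    proof -
      have "S t k u / (t0 - t) = - (S t k u / (t - t0))" for t
        by (metis minus_diff_eq divide_minus_right)
      then show ?thesis using tendsto_minus[OF tmono[OF Clim[OF that]]] by simp
    qed
  qed
  then show ?left
    using mono[OF evT]
  proof eventually_elim
    case (elim t)
    have "pos_index (\<lambda>v. - C v v) ?K = neg_index ?Q ?K"
      unfolding neg_index_eq by (rule pos_index_cong) (simp only: CQ)
    then show ?case using elim fin[OF elim(2)] by (simp add: gind_def S_def)
  qed
qed

lemma regular_nondegenerate: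
  assumes reg: "regular_path \<omega> n L0 l a b" and t: "t \<in> {a..b}"
  shows "nondegenerate (crossing_form \<omega> n l a b t) (l t \<inter> L0)"
proof (cases "l t \<inter> L0 = {0}")
  case True
  then show ?thesis by (simp add: nondegenerate_def)
next
  case False
  then show ?thesis using assms by (auto simp: regular_path_def crossings_def)
qed

lemma crossings_isolated:
  assumes reg: "regular_path \<omega> n L0 l a b" and "a < b" and L0: "lag L0" and t: "t \<in> {a..b}"
  shows "eventually (\<lambda>s. l s \<inter> L0 = {0}) (at t within {a..b})"
proof -
  have C1: "lag_path_C1 \<omega> n l a b" using reg by (simp add: regular_path_def)
  note l = lag_path_C1_continuous[OF C1]
  obtain W where W: "transv W (l t)" "transv W L0"
    using common_transversal3[OF lag_continuous_lag[OF l t] L0 L0] by blast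
  note j = crossing_jump[OF C1 \<open>a < b\<close> t W regular_nondegenerate[OF reg t]]
  show ?thesis
    by (rule eventually_at_split; rule eventually_mono[OF j(1)] eventually_mono[OF j(2)]; blast)
qed

text \<open>An infinite index set would turn the sum in \<open>clm_formula\<close> into 0; isolated
  crossings in a compact interval exclude this.\<close>

lemma regular_finite_crossings:
  assumes reg: "regular_path \<omega> n L0 l a b" and "a < b" and L0: "lag L0"
  shows "finite (crossings l L0 a b)"
proof -
  have "finite ({a..b} \<inter> crossings l L0 a b)"
  proof (rule finite_not_islimpt_in_compact)
    show "compact {a..b}" by simp
    fix t assume t: "t \<in> {a..b}"
    have "eventually (\<lambda>s. s \<notin> crossings l L0 a b) (at t within {a..b})"
      using crossings_isolated[OF assms t] by eventually_elim (simp add: crossings_def)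
    then have "eventually (\<lambda>s. s \<notin> crossings l L0 a b) (at t within crossings l L0 a b)"
      by (rule filter_leD[OF at_le, rotated]) (auto simp: crossings_def)
    with eventually_at_within_mem have "eventually (\<lambda>s. False) (at t within crossings l L0 a b)"
      by eventually_elim blast
    then show "\<not> t islimpt crossings l L0 a b"
      by (simp add: trivial_limit_within[symmetric] trivial_limit_def)
  qed
  moreover have "{a..b} \<inter> crossings l L0 a b = crossings l L0 a b" by (auto simp: crossings_def)
  ultimately show ?thesis by simp
qed

text \<open>The candidate is the crossing formula of the path cut off at \<open>t\<close>. On
  leaving an instant it gains the positive index there, and on arriving it loses the negative one,
  in accordance with \<open>crossing_jump\<close>.\<close>

lemma regular_index_fun:
  assumes reg: "regular_path \<omega> n L0 l a b" and "a < b" and L0: "lag L0"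
  obtains f where "index_fun L0 l {a..b} f" "f b - f a = clm_formula \<omega> n L0 l a b"
proof -
  let ?G = "crossing_form \<omega> n l a b"
  let ?p = "\<lambda>t. int (pos_index (?G t) (l t \<inter> L0))" and ?m = "\<lambda>t. int (neg_index (?G t) (l t \<inter> L0))"
  let ?s = "\<lambda>t. qsgn (?G t) (l t \<inter> L0)"
  let ?X = "crossings l L0 a b"
  \<comment> \<open>For the one-point interval at \<open>a\<close> the formula would give the
    signature. The value 0 makes the positive index at \<open>a\<close> the jump just after
    \<open>a\<close>.\<close>
  define f where "f t = (if t = a then 0 else ?p a + (\<Sum>s\<in>?X \<inter> {a<..<t}. ?s s) - ?m t)" for t
  have C1: "lag_path_C1 \<omega> n l a b" using reg by (simp add: regular_path_def)
  note l = lag_path_C1_continuous[OF C1]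
  have fin: "finite ?X" by (rule regular_finite_crossings[OF assms])
  have "index_fun L0 l {a..b} f"
    unfolding index_fun_def
  proof (intro ballI allI impI)
    fix t W assume t: "t \<in> {a..b}" and W: "transv W L0" "transv W (l t)"
    note j = crossing_jump[OF C1 \<open>a < b\<close> t W(2,1) regular_nondegenerate[OF reg t]]
    obtain e where e: "e > 0" "\<And>s. s \<in> {a..b} \<Longrightarrow> s \<noteq> t \<Longrightarrow> dist s t < e \<Longrightarrow> l s \<inter> L0 = {0}"
      using crossings_isolated[OF assms t] unfolding eventually_at by blast
    have noX: "s \<notin> ?X" if "s \<noteq> t" "\<bar>s - t\<bar> < e" for s
      using e(2)[of s] that by (auto simp: crossings_def dist_real_def)
    show "eventually (\<lambda>t'. f t' - f t = int (gind W (l t') L0) - int (gind W (l t) L0)) (at t within {a..b})"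
    proof (rule eventually_at_split)
      have "eventually (\<lambda>t'. t' \<in> {a..b} \<and> t < t' \<and> t' - t < e) (at t within ({a..b} \<inter> {t<..}))"
        unfolding eventually_at using e(1) by (intro exI[of _ e]) (auto simp: dist_real_def)
      with j(1) show "eventually (\<lambda>t'. f t' - f t = int (gind W (l t') L0) - int (gind W (l t) L0)) (at t within ({a..b} \<inter> {t<..}))"
      proof eventually_elim
        case (elim t')
        have t': "t' \<in> {a..b}" "t < t'" "t' - t < e" using elim by auto
        have m0: "?m t' = 0" using elim by simp
        have "f t' - f t = ?p t"
        proof (cases "t = a")
          case True
          have "s \<notin> ?X" if "s \<in> {a<..<t'}" for s using noX[of s] True t' that by auto
          then have "?X \<inter> {a<..<t'} = {}" by blast
          then show ?thesis using True t' m0 by (simp add: f_def)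
        next
          case False
          then have ta: "a < t" using t by auto
          have "(\<Sum>s\<in>?X \<inter> {a<..<t'}. ?s s) = (\<Sum>s\<in>?X \<inter> {a<..<t}. ?s s) + ?s t"
          proof (cases "t \<in> ?X")
            case True
            have "?X \<inter> {a<..<t'} = insert t (?X \<inter> {a<..<t})"
            proof (intro set_eqI iffI)
              fix s assume s: "s \<in> ?X \<inter> {a<..<t'}"
              then show "s \<in> insert t (?X \<inter> {a<..<t})" using noX[of s] t' by (cases "s < t") auto
            qed (use True ta t' in auto)
            then show ?thesis using fin by simp
          next
            case nX: False
            have "?X \<inter> {a<..<t'} = ?X \<inter> {a<..<t}"
            proof (intro set_eqI iffI)
              fix s assume s: "s \<in> ?X \<inter> {a<..<t'}"
              then show "s \<in> ?X \<inter> {a<..<t}" using noX[of s] nX t' by (cases "s < t"; cases "s = t") auto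
            qed (use ta t' in auto)
            moreover have "l t \<inter> L0 = {0}" using nX t by (simp add: crossings_def)
            ultimately show ?thesis by simp
          qed
          then show ?thesis using False ta t' m0 by (simp add: f_def qsgn_def)
        qed
        then show ?case using elim by simp
      qed
      show "eventually (\<lambda>t'. f t' - f t = int (gind W (l t') L0) - int (gind W (l t) L0)) (at t within ({a..b} \<inter> {..<t}))"
      proof (cases "t = a")
        case True
        then have "{a..b} \<inter> {..<t} = {}" by auto
        then show ?thesis by simp
      next
        case False
        then have ta: "a < t" using t by auto
        have "eventually (\<lambda>t'. t' \<in> {a..b} \<and> t' < t \<and> t - t' < e \<and> a < t') (at t within ({a..b} \<inter> {..<t}))"
          unfolding eventually_at using e(1) ta by (intro exI[of _ "min e (t - a)"]) (auto simp: dist_real_def)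
        with j(2) show ?thesis
        proof eventually_elim
          case (elim t')
          have t': "t' \<in> {a..b}" "t' < t" "t - t' < e" "a < t'" using elim by auto
          have m0: "?m t' = 0" using elim by simp
          have "?X \<inter> {a<..<t'} = ?X \<inter> {a<..<t}"
          proof (intro set_eqI iffI)
            fix s assume s: "s \<in> ?X \<inter> {a<..<t}"
            then show "s \<in> ?X \<inter> {a<..<t'}" using noX[of s] noX[of t'] t' by (cases "s < t'"; cases "s = t'") auto
          qed (use t' in auto)
          then have "f t' - f t = ?m t" using False t' m0 by (simp add: f_def)
          then show ?case using elim by simp
        qed
      qed
    qed
  qed
  moreover have "f b - f a = clm_formula \<omega> n L0 l a b"
    using \<open>a < b\<close> by (simp add: f_def clm_formula_def)
  ultimately show thesis by (rule that)
qed

text \<open>Homotopy invariance gives uniqueness in the definite description and \<open>ex\<close>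
  gives existence; the rotated path will supply \<open>ex\<close>.\<close>

lemma clm_index_eq:
  assumes L0: "lag L0" and "a < b" and l: "lag_continuous l {a..b}" and f: "index_fun L0 l {a..b} f"
    and ex: "\<exists>l'. lag_homotopic \<omega> n l l' a b \<and> regular_path \<omega> n L0 l' a b"
  shows "clm_index \<omega> n L0 l a b = f b - f a"
proof -
  have *: "clm_formula \<omega> n L0 l' a b = f b - f a" if l': "lag_homotopic \<omega> n l l' a b" "regular_path \<omega> n L0 l' a b" for l'
  proof -
    obtain g where g: "index_fun L0 l' {a..b} g" "g b - g a = clm_formula \<omega> n L0 l' a b"
      by (rule regular_index_fun[OF l'(2) \<open>a < b\<close> L0])
    have "f b - f a = g b - g a"
      by (rule lag_homotopic_index[OF L0 _ l'(1) f g(1)]) (use \<open>a < b\<close> in simp)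
    then show ?thesis using g(2) by simp
  qed
  obtain l' where l': "lag_homotopic \<omega> n l l' a b" "regular_path \<omega> n L0 l' a b" using ex by blast
  show ?thesis
    unfolding clm_index_def
  proof (rule the_equality)
    show "\<exists>l'. lag_homotopic \<omega> n l l' a b \<and> regular_path \<omega> n L0 l' a b \<and> finite (crossings l' L0 a b)
       \<and> f b - f a = clm_formula \<omega> n L0 l' a b"
      using l' *[OF l'] regular_finite_crossings[OF l'(2) \<open>a < b\<close> L0] by metis
    fix m assume "\<exists>l'. lag_homotopic \<omega> n l l' a b \<and> regular_path \<omega> n L0 l' a b \<and> finite (crossings l' L0 a b)
       \<and> m = clm_formula \<omega> n L0 l' a b"
    then show "m = f b - f a" using * by blast
  qed
qed

end

subsection \<open>Differentiability of orthogonal projections\<close>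

text \<open>The projection written as a rational expression in the vectors of a frame, so that it
  inherits limits and derivatives from the frame. Dividing by \<open>e \<bullet> e\<close> instead
  of normalising avoids square roots.\<close>

fun gram_schmidt :: "'a::euclidean_space list \<Rightarrow> 'a \<Rightarrow> 'a" where
  "gram_schmidt [] v = 0"
| "gram_schmidt (u # us) v =
    (let e = u - gram_schmidt us u in gram_schmidt us v + ((v \<bullet> e) / (e \<bullet> e)) *\<^sub>R e)"

lemma gram_schmidt_eq: "gram_schmidt us v = closest_point (span (set us)) v"
proof (induction us arbitrary: v)
  case Nil
  have "closest_point {0} v = 0" by (rule closest_point_subspace_unique) auto
  then show ?case by simp
next
  case (Cons u us)
  let ?S = "span (set us)" and ?T = "span (set (u # us))"
  define e where "e = u - gram_schmidt us u"
  have c: "gram_schmidt us v \<in> ?S" "s \<in> ?S \<Longrightarrow> (v - gram_schmidt us v) \<bullet> s = 0" for s v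
    unfolding Cons.IH using closest_point_subspace[OF subspace_span] by blast+
  have ST: "?S \<subseteq> ?T" by (rule span_mono) auto
  have eT: "e \<in> ?T" unfolding e_def using c(1) ST by (intro span_diff) (auto intro: span_base)
  have eS: "e \<bullet> s = 0" if "s \<in> ?S" for s using c(2)[OF that] by (simp add: e_def)
  have "closest_point ?T v = gram_schmidt us v + ((v \<bullet> e) / (e \<bullet> e)) *\<^sub>R e"
  proof (rule closest_point_subspace_unique[OF subspace_span])
    show "gram_schmidt us v + ((v \<bullet> e) / (e \<bullet> e)) *\<^sub>R e \<in> ?T"
      using c(1)[of v] ST eT by (intro span_add span_scale) auto
    fix s assume "s \<in> ?T"
    then obtain k where k: "s - k *\<^sub>R u \<in> ?S" by (auto simp: span_breakdown_eq)
    define s' where "s' = s - k *\<^sub>R u + k *\<^sub>R gram_schmidt us u"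
    have s': "s' \<in> ?S" unfolding s'_def using k c(1)[of u] by (intro span_add span_scale)
    have s: "s = k *\<^sub>R e + s'" by (simp add: s'_def e_def algebra_simps)
    have 1: "(v - gram_schmidt us v) \<bullet> s' = 0" by (rule c(2)[OF s'])
    have 2: "gram_schmidt us v \<bullet> e = 0" using eS[OF c(1)[of v]] by (simp add: inner_commute)
    \<comment> \<open>For \<open>e = 0\<close> both sides vanish, so dependent vectors in the list
      cause no exception.\<close>
    have 3: "(v \<bullet> e) / (e \<bullet> e) * (e \<bullet> e) = v \<bullet> e" by (cases "e = 0") auto
    show "(v - (gram_schmidt us v + ((v \<bullet> e) / (e \<bullet> e)) *\<^sub>R e)) \<bullet> s = 0"
    proof -
      have "(v - (gram_schmidt us v + ((v \<bullet> e) / (e \<bullet> e)) *\<^sub>R e)) \<bullet> s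
        = (v - gram_schmidt us v) \<bullet> s' + k * (v \<bullet> e - gram_schmidt us v \<bullet> e)
          - (v \<bullet> e) / (e \<bullet> e) * (k * (e \<bullet> e) + e \<bullet> s')"
        unfolding s by (simp add: algebra_simps inner_add_left inner_diff_left inner_add_right)
      also have "\<dots> = k * (v \<bullet> e) - k * ((v \<bullet> e) / (e \<bullet> e) * (e \<bullet> e))"
        unfolding 1 2 eS[OF s'] by (simp add: algebra_simps)
      also have "\<dots> = 0" by (simp only: 3 diff_self)
      finally show ?thesis .
    qed
  qed
  then show ?case by (simp add: e_def Let_def)
qed

lemma gram_schmidt_residual_nonzero:
  assumes "independent (set (u # us))" "distinct (u # us)"
  shows "u - gram_schmidt us u \<noteq> 0"
proof
  assume "u - gram_schmidt us u = 0"
  then have "u \<in> span (set us)"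
    using closest_point_subspace(1)[OF subspace_span[of "set us"], of u] by (simp add: gram_schmidt_eq)
  then show False using assms by (simp add: independent_insert)
qed

text \<open>The denominators converge to squared residuals of the limit frame, which are nonzero by
  its independence.\<close>

lemma tendsto_gram_schmidt:
  assumes "\<And>f. f \<in> set fs \<Longrightarrow> ((\<lambda>i. \<phi> i f) \<longlongrightarrow> \<psi> f) F"
    "independent (set (map \<psi> fs))" "distinct (map \<psi> fs)" "(g \<longlongrightarrow> y) F"
  shows "((\<lambda>i. gram_schmidt (map (\<phi> i) fs) (g i)) \<longlongrightarrow> gram_schmidt (map \<psi> fs) y) F"
  using assms
proof (induction fs arbitrary: g y)
  case Nil
  then show ?case by simp
next
  case (Cons f fs)
  have ind: "independent (set (map \<psi> fs))" using Cons.prems(2) by (simp add: independent_insert split: if_splits)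
  have IH: "((\<lambda>i. gram_schmidt (map (\<phi> i) fs) (g i)) \<longlongrightarrow> gram_schmidt (map \<psi> fs) y) F"
    if "(g \<longlongrightarrow> y) F" for g y
    by (rule Cons.IH) (use Cons.prems ind that in auto)
  have f: "((\<lambda>i. \<phi> i f) \<longlongrightarrow> \<psi> f) F" using Cons.prems(1) by simp
  have e: "\<psi> f - gram_schmidt (map \<psi> fs) (\<psi> f) \<noteq> 0"
    using gram_schmidt_residual_nonzero[of "\<psi> f" "map \<psi> fs"] Cons.prems by simp
  then have "(\<psi> f - gram_schmidt (map \<psi> fs) (\<psi> f)) \<bullet> (\<psi> f - gram_schmidt (map \<psi> fs) (\<psi> f)) \<noteq> 0" by simp
  then show ?case unfolding list.map gram_schmidt.simps Let_def
    by (intro tendsto_add tendsto_scaleR tendsto_divide tendsto_inner tendsto_diff IH f Cons.prems(4))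
qed

section \<open>Calculus of continuously differentiable curves\<close>

definition C1_on :: "real set \<Rightarrow> (real \<Rightarrow> 'a::real_normed_vector) \<Rightarrow> bool" where
  "C1_on S f \<longleftrightarrow> (\<exists>D. (\<forall>t\<in>S. (f has_vector_derivative D t) (at t within S)) \<and> continuous_on S D)"

lemma C1_onI:
  assumes "\<And>t. t \<in> S \<Longrightarrow> (f has_vector_derivative D t) (at t within S)" "continuous_on S D"
  shows "C1_on S f"
  using assms unfolding C1_on_def by blast

lemma C1_on_continuous: "C1_on S f \<Longrightarrow> continuous_on S f"
  unfolding C1_on_def continuous_on_eq_continuous_within
  by (meson has_vector_derivative_continuous)

lemma C1_on_subset: "C1_on S f \<Longrightarrow> T \<subseteq> S \<Longrightarrow> C1_on T f"
  unfolding C1_on_def by (meson continuous_on_subset has_vector_derivative_within_subset subsetD)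

lemma C1_on_const [intro]: "C1_on S (\<lambda>t. c)"
  by (rule C1_onI[where D = "\<lambda>t. 0"]) auto

lemma C1_on_add:
  assumes "C1_on S f" "C1_on S g" shows "C1_on S (\<lambda>t. f t + g t)"
proof -
  obtain D E where *: "\<forall>t\<in>S. (f has_vector_derivative D t) (at t within S)" "continuous_on S D"
    "\<forall>t\<in>S. (g has_vector_derivative E t) (at t within S)" "continuous_on S E"
    using assms unfolding C1_on_def by blast
  show ?thesis
    by (rule C1_onI[where D = "\<lambda>t. D t + E t"])
      (use * in \<open>auto intro!: has_vector_derivative_add continuous_on_add\<close>)
qed

lemma C1_on_bounded_linear:
  assumes h: "bounded_linear h" and "C1_on S f" shows "C1_on S (\<lambda>t. h (f t))"
proof -
  obtain D where *: "\<forall>t\<in>S. (f has_vector_derivative D t) (at t within S)" "continuous_on S D"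
    using assms unfolding C1_on_def by blast
  show ?thesis
    by (rule C1_onI[where D = "\<lambda>t. h (D t)"])
      (use * in \<open>auto intro!: bounded_linear.has_vector_derivative[OF h] bounded_linear.continuous_on[OF h]\<close>)
qed

lemma C1_on_diff:
  assumes "C1_on S f" "C1_on S g" shows "C1_on S (\<lambda>t. f t - g t)"
  using C1_on_add[OF assms(1) C1_on_bounded_linear[OF bounded_linear_minus[OF bounded_linear_ident] assms(2)]] by simp

lemma C1_on_bounded_bilinear:
  assumes h: "bounded_bilinear h" and "C1_on S f" "C1_on S g" shows "C1_on S (\<lambda>t. h (f t) (g t))"
proof -
  obtain D E where *: "\<forall>t\<in>S. (f has_vector_derivative D t) (at t within S)" "continuous_on S D"
    "\<forall>t\<in>S. (g has_vector_derivative E t) (at t within S)" "continuous_on S E"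
    using assms unfolding C1_on_def by blast
  note c = C1_on_continuous[OF assms(2)] C1_on_continuous[OF assms(3)]
  show ?thesis
  proof (rule C1_onI[where D = "\<lambda>t. h (f t) (E t) + h (D t) (g t)"])
    show "((\<lambda>t. h (f t) (g t)) has_vector_derivative h (f t) (E t) + h (D t) (g t)) (at t within S)" if "t \<in> S" for t
      using * that by (intro bounded_bilinear.has_vector_derivative[OF h]) auto
    show "continuous_on S (\<lambda>t. h (f t) (E t) + h (D t) (g t))"
      using * c by (intro continuous_on_add bounded_bilinear.continuous_on[OF h])
  qed
qed

lemma C1_on_inverse:
  fixes f :: "real \<Rightarrow> real"
  assumes "C1_on S f" "\<And>t. t \<in> S \<Longrightarrow> f t \<noteq> 0" shows "C1_on S (\<lambda>t. inverse (f t))"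
proof -
  obtain D where *: "\<forall>t\<in>S. (f has_vector_derivative D t) (at t within S)" "continuous_on S D"
    using assms unfolding C1_on_def by blast
  show ?thesis
  proof (rule C1_onI[where D = "\<lambda>t. - (inverse (f t) * D t * inverse (f t))"])
    show "((\<lambda>t. inverse (f t)) has_vector_derivative - (inverse (f t) * D t * inverse (f t))) (at t within S)" if "t \<in> S" for t
      using * that assms(2)
      by (auto simp: has_real_derivative_iff_has_vector_derivative[symmetric] intro!: DERIV_inverse')
    show "continuous_on S (\<lambda>t. - (inverse (f t) * D t * inverse (f t)))"
      using *(2) C1_on_continuous[OF assms(1)] assms(2) by (intro continuous_intros) auto
  qed
qed

lemmas C1_on_scaleR = C1_on_bounded_bilinear[OF bounded_bilinear_scaleR]
  and C1_on_inner = C1_on_bounded_bilinear[OF bounded_bilinear_inner]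
  and C1_on_mult = C1_on_bounded_bilinear[OF bounded_bilinear_mult]

lemma C1_on_gram_schmidt:
  assumes "\<And>f. f \<in> set fs \<Longrightarrow> C1_on S (\<lambda>t. \<phi> t f)"
    "\<And>t. t \<in> S \<Longrightarrow> independent (set (map (\<phi> t) fs)) \<and> distinct (map (\<phi> t) fs)" "C1_on S g"
  shows "C1_on S (\<lambda>t. gram_schmidt (map (\<phi> t) fs) (g t))"
  using assms
proof (induction fs arbitrary: g)
  case Nil
  then show ?case by (simp add: C1_on_const)
next
  case (Cons f fs)
  have ind: "independent (set (map (\<phi> t) fs)) \<and> distinct (map (\<phi> t) fs)" if "t \<in> S" for t
    using Cons.prems(2)[OF that] by (simp add: independent_insert split: if_splits)
  have IH: "C1_on S (\<lambda>t. gram_schmidt (map (\<phi> t) fs) (g t))" if "C1_on S g" for g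
    by (rule Cons.IH) (use Cons.prems ind that in auto)
  have f: "C1_on S (\<lambda>t. \<phi> t f)" using Cons.prems(1) by simp
  have e: "\<phi> t f - gram_schmidt (map (\<phi> t) fs) (\<phi> t f) \<noteq> 0" if "t \<in> S" for t
    using gram_schmidt_residual_nonzero[of "\<phi> t f" "map (\<phi> t) fs"] Cons.prems(2)[OF that] by simp
  show ?case unfolding list.map gram_schmidt.simps Let_def divide_inverse
    by (intro C1_on_add C1_on_scaleR C1_on_mult C1_on_inverse C1_on_inner C1_on_diff IH f Cons.prems(3))
      (use e in simp)
qed

text \<open>Since the derivative within the interval is unique, \<open>vector_derivative\<close>
  agrees with every local derivative and is continuous where they are.\<close>

lemma C1_on_local:
  assumes "a < b" and loc: "\<And>t0. t0 \<in> {a..b} \<Longrightarrow> \<exists>d>0. C1_on ({a..b} \<inter> ball t0 d) f"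
  shows "C1_on {a..b} f"
proof -
  let ?D = "\<lambda>t. vector_derivative f (at t within {a..b})"
  have *: "(f has_vector_derivative ?D t0) (at t0 within {a..b}) \<and> (?D \<longlongrightarrow> ?D t0) (at t0 within {a..b})"
    if t0: "t0 \<in> {a..b}" for t0
  proof -
    obtain d where d: "d > 0" "C1_on ({a..b} \<inter> ball t0 d) f" using loc[OF t0] by blast
    then obtain E where E: "\<And>t. t \<in> {a..b} \<inter> ball t0 d \<Longrightarrow> (f has_vector_derivative E t) (at t within ({a..b} \<inter> ball t0 d))"
      "continuous_on ({a..b} \<inter> ball t0 d) E" unfolding C1_on_def by blast
    have at: "at t within ({a..b} \<inter> ball t0 d) = at t within {a..b}" if "t \<in> ball t0 d" for t
      by (rule at_within_nhd[OF that open_ball]) auto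
    have der: "(f has_vector_derivative E t) (at t within {a..b})" "?D t = E t" if t: "t \<in> {a..b} \<inter> ball t0 d" for t
    proof -
      show 1: "(f has_vector_derivative E t) (at t within {a..b})"
        using E(1)[OF t] at[of t] t by simp
      show "?D t = E t"
        by (rule vector_derivative_within[OF at_within_Icc_nontrivial[OF \<open>a < b\<close>] 1]) (use t in auto)
    qed
    have t0': "t0 \<in> {a..b} \<inter> ball t0 d" using t0 d by simp
    have "(E \<longlongrightarrow> E t0) (at t0 within {a..b})"
      using E(2) t0' at[of t0] d(1) unfolding continuous_on_def by force
    moreover have "eventually (\<lambda>t. E t = ?D t) (at t0 within {a..b})"
    proof -
      have "eventually (\<lambda>t. t \<in> {a..b} \<inter> ball t0 d) (at t0 within {a..b})"
        unfolding eventually_at using d(1) by (intro exI[of _ d]) (auto simp: dist_commute)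
      then show ?thesis by eventually_elim (simp only: der(2))
    qed
    ultimately have "(?D \<longlongrightarrow> E t0) (at t0 within {a..b})" by (rule Lim_transform_eventually)
    then show ?thesis using der[OF t0'] by simp
  qed
  show ?thesis
    by (rule C1_onI[where D = ?D]) (use * in \<open>auto simp: continuous_on_def\<close>)
qed

section \<open>Subspaces moving as images of a fixed subspace\<close>

text \<open>On a subspace an injective linear map is bounded below, and operator-norm convergence
  preserves half of the bound.\<close>

lemma injective_eventually:
  fixes T :: "'i \<Rightarrow> 'a::euclidean_space \<Rightarrow> 'b::euclidean_space"
  assumes "eventually (\<lambda>i. linear (T i)) F" "linear T0" "\<And>v. ((\<lambda>i. T i v) \<longlongrightarrow> T0 v) F"
    "subspace X" "inj_on T0 X"
  shows "eventually (\<lambda>i. inj_on (T i) X) F"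
proof -
  have "\<forall>x\<in>X. T0 x = 0 \<longrightarrow> x = 0"
    using linear_injective_on_subspace_0[OF assms(2,4)] assms(5) by blast
  then have "\<exists>e>0. \<forall>x\<in>X. norm (T0 x) \<ge> e * norm x"
    by (rule injective_imp_isometric[OF closed_subspace[OF assms(4)] assms(4) linear_conv_bounded_linear[THEN iffD1, OF assms(2)]])
  then obtain e where e: "e > 0" "\<And>x. x \<in> X \<Longrightarrow> norm (T0 x) \<ge> e * norm x" by blast
  have "eventually (\<lambda>i. \<forall>v. norm (T i v - T0 v) \<le> (e/2) * norm v) F"
    by (rule linear_tendsto_uniform[OF assms(1-3)]) (use e in simp)
  with assms(1) show ?thesis
  proof eventually_elim
    case (elim i)
    show ?case
    proof (rule linear_injective_on_subspace_0[OF elim(1) assms(4), THEN iffD2], safe)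
      fix x assume x: "x \<in> X" "T i x = 0"
      then have "norm (T0 x) \<le> (e/2) * norm x" using elim(2)[rule_format, of x] by simp
      then have "(e/2) * norm x \<le> 0" using e(2)[OF x(1)] by simp
      then show "x = 0" using e(1) by (simp add: mult_le_0_iff)
    qed
  qed
qed

lemma basis_list_exists:
  fixes X :: "'a::euclidean_space set"
  assumes "subspace X"
  obtains xs where "distinct xs" "set xs \<subseteq> X" "independent (set xs)" "span (set xs) = X"
proof -
  obtain B where B: "B \<subseteq> X" "independent B" "X \<subseteq> span B" "card B = dim X" using basis_exists by blast
  have fB: "finite B" using B(2) independent_bound by blast
  obtain xs where xs: "set xs = B" "distinct xs" using finite_distinct_list[OF fB] by blast
  have "span B = X" using B(1,3) assms by (metis span_minimal subset_antisym)
  then show thesis using that[OF xs(2)] xs(1) B by blast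
qed

lemma frame_image:
  fixes T :: "'a::euclidean_space \<Rightarrow> 'b::euclidean_space"
  assumes T: "linear T" "inj_on T X" and X: "subspace X" and L: "subspace L" "T ` X \<subseteq> L" "dim L \<le> dim X"
    and xs: "distinct xs" "set xs \<subseteq> X" "independent (set xs)" "span (set xs) = X"
  shows "span (set (map T xs)) = L" "independent (set (map T xs))" "distinct (map T xs)"
proof -
  have "span (set (map T xs)) = T ` X" using linear_span_image[OF T(1), of "set xs"] xs by simp
  also have "\<dots> = L"
    by (rule subspace_dim_equal[OF linear_subspace_image[OF T(1) X] L(1,2)])
      (use L(3) dim_image_subspace[OF T(1) X T(2)] in simp)
  finally show "span (set (map T xs)) = L" .
  show "independent (set (map T xs))"
    using linear_independent_injective_image[OF T(1) xs(3)] T(2) xs(4) by simp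
  show "distinct (map T xs)"
    using xs T(2) by (auto simp: distinct_map intro: inj_on_subset)
qed

text \<open>The images of a fixed basis of \<open>X\<close> form a converging frame, and the
  projection is computed from that frame by \<open>gram_schmidt\<close>. Containment and the bound
  on the dimension say that the image is all of \<open>L i\<close>.\<close>

lemma tendsto_closest_point_image:
  fixes T :: "'i \<Rightarrow> 'a::euclidean_space \<Rightarrow> 'b::euclidean_space"
  assumes T: "eventually (\<lambda>i. linear (T i)) F" "linear T0" "\<And>x. ((\<lambda>i. T i x) \<longlongrightarrow> T0 x) F"
    and X: "subspace X" "inj_on T0 X"
    and L: "eventually (\<lambda>i. subspace (L i) \<and> T i ` X \<subseteq> L i \<and> dim (L i) \<le> dim X) F"
      "subspace L0" "T0 ` X \<subseteq> L0" "dim L0 \<le> dim X"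
  shows "((\<lambda>i. closest_point (L i) v) \<longlongrightarrow> closest_point L0 v) F"
proof -
  obtain xs where xs: "distinct xs" "set xs \<subseteq> X" "independent (set xs)" "span (set xs) = X"
    by (rule basis_list_exists[OF X(1)])
  note fr = frame_image[OF _ _ X(1) _ _ _ xs]
  have 0: "gram_schmidt (map T0 xs) v = closest_point L0 v"
    unfolding gram_schmidt_eq using fr(1)[OF T(2) X(2) L(2-4)] by simp
  have "((\<lambda>i. gram_schmidt (map (T i) xs) v) \<longlongrightarrow> gram_schmidt (map T0 xs) v) F"
    by (rule tendsto_gram_schmidt[OF T(3) fr(2)[OF T(2) X(2) L(2-4)] fr(3)[OF T(2) X(2) L(2-4)] tendsto_const])
  moreover have "eventually (\<lambda>i. gram_schmidt (map (T i) xs) v = closest_point (L i) v) F"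
    using T(1) L(1) injective_eventually[OF T X]
  proof eventually_elim
    case (elim i)
    then show ?case unfolding gram_schmidt_eq using fr(1)[of "T i" "L i"] by simp
  qed
  ultimately show ?thesis unfolding 0 by (rule Lim_transform_eventually)
qed

text \<open>\<open>X\<close> and \<open>T\<close> may depend on \<open>t0\<close>: a natural choice
  is the subspace at \<open>t0\<close> projected to its neighbours, which is injective only near
  \<open>t0\<close>.\<close>

lemma C1_on_closest_point_image:
  fixes l :: "real \<Rightarrow> 'a::euclidean_space set"
  assumes "a < b" and l: "\<And>t. t \<in> {a..b} \<Longrightarrow> subspace (l t)"
    and loc: "\<And>t0. t0 \<in> {a..b} \<Longrightarrow> \<exists>X T. subspace X \<and> (\<forall>t\<in>{a..b}. linear (T t) \<and> T t ` X \<subseteq> l t \<and> dim (l t) \<le> dim X)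
        \<and> (\<forall>x::'a. C1_on {a..b} (\<lambda>t. T t x)) \<and> inj_on (T t0) X"
  shows "C1_on {a..b} (\<lambda>t. closest_point (l t) v)"
proof (rule C1_on_local[OF \<open>a < b\<close>])
  fix t0 assume t0: "t0 \<in> {a..b}"
  obtain X :: "'a set" and T where X: "subspace X" and T: "\<And>t. t \<in> {a..b} \<Longrightarrow> linear (T t) \<and> T t ` X \<subseteq> l t \<and> dim (l t) \<le> dim X"
    and C: "\<And>x. C1_on {a..b} (\<lambda>t. T t x)" and inj: "inj_on (T t0) X" using loc[OF t0] by blast
  have "eventually (\<lambda>t. inj_on (T t) X) (at t0 within {a..b})"
  proof (rule injective_eventually[OF _ _ _ X inj])
    show "eventually (\<lambda>t. linear (T t)) (at t0 within {a..b})"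
      using eventually_at_within_mem by eventually_elim (use T in blast)
    show "linear (T t0)" using T[OF t0] by blast
    show "((\<lambda>t. T t v) \<longlongrightarrow> T t0 v) (at t0 within {a..b})" for v
      using C1_on_continuous[OF C, of v] t0 by (simp add: continuous_on_def)
  qed
  then obtain d where d: "d > 0" "\<And>t. t \<in> {a..b} \<Longrightarrow> t \<noteq> t0 \<Longrightarrow> dist t t0 < d \<Longrightarrow> inj_on (T t) X"
    unfolding eventually_at by blast
  let ?S = "{a..b} \<inter> ball t0 d"
  have injS: "inj_on (T t) X" if "t \<in> ?S" for t
    using d(2)[of t] inj that by (cases "t = t0") (auto simp: dist_commute)
  obtain xs where xs: "distinct xs" "set xs \<subseteq> X" "independent (set xs)" "span (set xs) = X"
    by (rule basis_list_exists[OF X])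
  have fr: "span (set (map (T t) xs)) = l t" "independent (set (map (T t) xs))" "distinct (map (T t) xs)"
    if "t \<in> ?S" for t
    using frame_image[OF _ injS[OF that] X _ _ _ xs, of "l t"] T[of t] l[of t] that by blast+
  have "C1_on ?S (\<lambda>t. gram_schmidt (map (T t) xs) v)"
    by (rule C1_on_gram_schmidt) (use fr C1_on_subset[OF C, of ?S] in \<open>auto simp: C1_on_const\<close>)
  then obtain D where D: "\<And>t. t \<in> ?S \<Longrightarrow> ((\<lambda>t. gram_schmidt (map (T t) xs) v) has_vector_derivative D t) (at t within ?S)"
    "continuous_on ?S D" unfolding C1_on_def by blast
  have "C1_on ?S (\<lambda>t. closest_point (l t) v)"
  proof (rule C1_onI[OF _ D(2)])
    fix t assume t: "t \<in> ?S"
    show "((\<lambda>t. closest_point (l t) v) has_vector_derivative D t) (at t within ?S)"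
      by (rule has_vector_derivative_transform[OF t _ D(1)[OF t]]) (simp only: gram_schmidt_eq fr(1))
  qed
  then show "\<exists>d>0. C1_on ({a..b} \<inter> ball t0 d) (\<lambda>t. closest_point (l t) v)" using d(1) by blast
qed

subsection \<open>Existence of regular representatives\<close>

text \<open>The cubic that runs from 0 to 1 with vanishing derivative at both ends. For
  \<open>c = d\<close> division by zero makes it constantly 0.\<close>

definition smoothstep :: "real \<Rightarrow> real \<Rightarrow> real \<Rightarrow> real" where
  "smoothstep c d t = ((t - c) / (d - c))\<^sup>2 * (3 - 2 * ((t - c) / (d - c)))"

lemma smoothstep_range:
  assumes "t \<in> {c..d}" shows "smoothstep c d t \<in> {0..1}"
proof -
  define \<tau> where "\<tau> = (t - c) / (d - c)"
  have "0 \<le> \<tau>" "\<tau> \<le> 1" using assms by (auto simp: \<tau>_def divide_le_eq_1 intro!: divide_nonneg_nonneg)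
  then have "0 \<le> \<tau>\<^sup>2 * (3 - 2 * \<tau>)" "0 \<le> (1 - \<tau>)\<^sup>2 * (1 + 2 * \<tau>)" by auto
  moreover have "1 - \<tau>\<^sup>2 * (3 - 2 * \<tau>) = (1 - \<tau>)\<^sup>2 * (1 + 2 * \<tau>)"
    by (simp add: power2_eq_square algebra_simps)
  ultimately show ?thesis by (simp add: smoothstep_def \<tau>_def)
qed

lemma smoothstep_derivative:
  "(smoothstep c d has_vector_derivative (6 * ((t - c) / (d - c)) * (1 - (t - c) / (d - c)) / (d - c))) (at t within S)"
proof -
  have \<tau>: "((\<lambda>t. (t - c) / (d - c)) has_real_derivative (1 - 0) / (d - c)) (at t within S)"
    by (intro DERIV_cdivide DERIV_diff DERIV_ident DERIV_const)
  have "((\<lambda>t. ((t - c) / (d - c))\<^sup>2 * (3 - 2 * ((t - c) / (d - c)))) has_real_derivative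
    (6 * ((t - c) / (d - c)) * (1 - (t - c) / (d - c)) / (d - c))) (at t within S)"
  proof (rule DERIV_cong[OF DERIV_mult[OF DERIV_power[OF \<tau>, of 2] DERIV_diff[OF DERIV_const DERIV_cmult[OF \<tau>]]]])
    have "of_nat 2 * (r * x ^ (2 - Suc 0)) * (3 - 2 * x) + (0 - 2 * r) * x\<^sup>2 = 6 * x * (1 - x) * r" for r x :: real
      by (simp add: power2_eq_square algebra_simps)
    from this[of "(1 - 0) / (d - c)" "(t - c) / (d - c)"]
    show "of_nat 2 * ((1 - 0) / (d - c) * ((t - c) / (d - c)) ^ (2 - Suc 0)) * (3 - 2 * ((t - c) / (d - c)))
        + (0 - 2 * ((1 - 0) / (d - c))) * ((t - c) / (d - c))\<^sup>2
      = 6 * ((t - c) / (d - c)) * (1 - (t - c) / (d - c)) / (d - c)"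
      by (simp only: divide_inverse[of "1 - 0"] divide_inverse[of _ "d - c"] diff_0_right mult_1_left mult.assoc)
  qed
  then show ?thesis unfolding smoothstep_def[abs_def] has_real_derivative_iff_has_vector_derivative .
qed

context symplectic_space
begin

section \<open>Operations on homotopies\<close>

lemma lag_homotopicE:
  assumes "lag_homotopic \<omega> n l l' a b"
  obtains H :: "real \<Rightarrow> real \<Rightarrow> 'v set" where "\<And>s t. s \<in> {0..1} \<Longrightarrow> t \<in> {a..b} \<Longrightarrow> lag (H s t)"
    "\<And>v. continuous_on ({0..1} \<times> {a..b}) (\<lambda>z. closest_point (H (fst z) (snd z)) v)"
    "\<And>t. t \<in> {a..b} \<Longrightarrow> H 0 t = l t" "\<And>t. t \<in> {a..b} \<Longrightarrow> H 1 t = l' t"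
    "\<And>s. s \<in> {0..1} \<Longrightarrow> H s a = l a" "\<And>s. s \<in> {0..1} \<Longrightarrow> H s b = l b"
proof -
  obtain H :: "real \<Rightarrow> real \<Rightarrow> 'v set" where "(\<forall>s\<in>{0..1}. \<forall>t\<in>{a..b}. lag (H s t))
    \<and> (\<forall>v. continuous_on ({0..1} \<times> {a..b}) (\<lambda>z. closest_point (H (fst z) (snd z)) v))
    \<and> (\<forall>t\<in>{a..b}. H 0 t = l t \<and> H 1 t = l' t)
    \<and> (\<forall>s\<in>{0..1}. H s a = l a \<and> H s b = l b)"
    using assms[unfolded lag_homotopic_def case_prod_beta'] by (elim exE) (rule that)
  then show thesis by (intro that[of H]) simp_all
qed

lemma lag_homotopicI:
  fixes H :: "real \<Rightarrow> real \<Rightarrow> 'v set"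
  assumes "\<And>s t. s \<in> {0..1} \<Longrightarrow> t \<in> {a..b} \<Longrightarrow> lag (H s t)"
    "\<And>v. continuous_on ({0..1} \<times> {a..b}) (\<lambda>z. closest_point (H (fst z) (snd z)) v)"
    "\<And>t. t \<in> {a..b} \<Longrightarrow> H 0 t = l t" "\<And>t. t \<in> {a..b} \<Longrightarrow> H 1 t = l' t"
    "\<And>s. s \<in> {0..1} \<Longrightarrow> H s a = l a" "\<And>s. s \<in> {0..1} \<Longrightarrow> H s b = l b"
  shows "lag_homotopic \<omega> n l l' a b"
  unfolding lag_homotopic_def case_prod_beta' by (rule exI[of _ H]) (simp add: assms)

lemma lag_homotopic_ends:
  assumes "lag_homotopic \<omega> n l p a b" "a \<le> b" shows "p a = l a" "p b = l b"
proof -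
  obtain H :: "real \<Rightarrow> real \<Rightarrow> 'v set" where H: "\<And>s t. s \<in> {0..1} \<Longrightarrow> t \<in> {a..b} \<Longrightarrow> lag (H s t)"
    "\<And>v. continuous_on ({0..1} \<times> {a..b}) (\<lambda>z. closest_point (H (fst z) (snd z)) v)"
    "\<And>t. t \<in> {a..b} \<Longrightarrow> H 0 t = l t" "\<And>t. t \<in> {a..b} \<Longrightarrow> H 1 t = p t"
    "\<And>s. s \<in> {0..1} \<Longrightarrow> H s a = l a" "\<And>s. s \<in> {0..1} \<Longrightarrow> H s b = l b"
    using lag_homotopicE[OF assms(1)] by blast
  from H(4)[of a] H(4)[of b] H(5)[of 1] H(6)[of 1] show "p a = l a" "p b = l b"
    using assms(2) by auto
qed

lemma lag_homotopic_trans: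
  assumes 1: "lag_homotopic \<omega> n l l' a b" and 2: "lag_homotopic \<omega> n l' l'' a b" and "a \<le> b"
  shows "lag_homotopic \<omega> n l l'' a b"
proof -
  obtain H :: "real \<Rightarrow> real \<Rightarrow> 'v set" where H: "\<And>s t. s \<in> {0..1} \<Longrightarrow> t \<in> {a..b} \<Longrightarrow> lag (H s t)"
    "\<And>v. continuous_on ({0..1} \<times> {a..b}) (\<lambda>z. closest_point (H (fst z) (snd z)) v)"
    "\<And>t. t \<in> {a..b} \<Longrightarrow> H 0 t = l t" "\<And>t. t \<in> {a..b} \<Longrightarrow> H 1 t = l' t"
    "\<And>s. s \<in> {0..1} \<Longrightarrow> H s a = l a" "\<And>s. s \<in> {0..1} \<Longrightarrow> H s b = l b"
    using lag_homotopicE[OF 1] by blast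
  obtain K :: "real \<Rightarrow> real \<Rightarrow> 'v set" where K: "\<And>s t. s \<in> {0..1} \<Longrightarrow> t \<in> {a..b} \<Longrightarrow> lag (K s t)"
    "\<And>v. continuous_on ({0..1} \<times> {a..b}) (\<lambda>z. closest_point (K (fst z) (snd z)) v)"
    "\<And>t. t \<in> {a..b} \<Longrightarrow> K 0 t = l' t" "\<And>t. t \<in> {a..b} \<Longrightarrow> K 1 t = l'' t"
    "\<And>s. s \<in> {0..1} \<Longrightarrow> K s a = l' a" "\<And>s. s \<in> {0..1} \<Longrightarrow> K s b = l' b"
    using lag_homotopicE[OF 2] by blast
  have ends: "l' a = l a" "l' b = l b" using H(4)[of a] H(5)[of 1] H(4)[of b] H(6)[of 1] \<open>a \<le> b\<close> by auto
  define G where "G s t = (if s \<le> 1/2 then H (2 * s) t else K (2 * s - 1) t)" for s t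
  show ?thesis
  proof (rule lag_homotopicI[where H = G])
    fix v
    have "continuous_on ({0..1/2} \<times> {a..b} \<union> {1/2..1} \<times> {a..b})
      (\<lambda>z. if fst z \<le> 1/2 then closest_point (H (2 * fst z) (snd z)) v else closest_point (K (2 * fst z - 1) (snd z)) v)"
    proof (rule continuous_on_cases)
      have "continuous_on ({0..1/2} \<times> {a..b}) (\<lambda>z. (\<lambda>z. closest_point (H (fst z) (snd z)) v) (2 * fst z, snd z))"
        by (rule continuous_on_compose2[OF H(2)]) (auto intro!: continuous_intros)
      then show "continuous_on ({0..1/2} \<times> {a..b}) (\<lambda>z. closest_point (H (2 * fst z) (snd z)) v)" by simp
      have "continuous_on ({1/2..1} \<times> {a..b}) (\<lambda>z. (\<lambda>z. closest_point (K (fst z) (snd z)) v) (2 * fst z - 1, snd z))"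
        by (rule continuous_on_compose2[OF K(2)]) (auto intro!: continuous_intros)
      then show "continuous_on ({1/2..1} \<times> {a..b}) (\<lambda>z. closest_point (K (2 * fst z - 1) (snd z)) v)" by simp
      show "\<forall>z. z \<in> {0..1/2} \<times> {a..b} \<and> \<not> fst z \<le> 1/2 \<or> z \<in> {1/2..1} \<times> {a..b} \<and> fst z \<le> 1/2 \<longrightarrow>
        closest_point (H (2 * fst z) (snd z)) v = closest_point (K (2 * fst z - 1) (snd z)) v"
      proof (intro allI impI)
        fix z :: "real \<times> real"
        assume "z \<in> {0..1/2} \<times> {a..b} \<and> \<not> fst z \<le> 1/2 \<or> z \<in> {1/2..1} \<times> {a..b} \<and> fst z \<le> 1/2"
        then have e: "2 * fst z = 1" "2 * fst z - 1 = 0" and t: "snd z \<in> {a..b}" by auto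
        show "closest_point (H (2 * fst z) (snd z)) v = closest_point (K (2 * fst z - 1) (snd z)) v"
          unfolding e(2) unfolding e(1) H(4)[OF t] K(3)[OF t] ..
      qed
    qed (auto intro: closed_Times)
    moreover have "{0..1/2} \<times> {a..b} \<union> {1/2..1} \<times> {a..b} = {0..1::real} \<times> {a..b}" by auto
    ultimately have "continuous_on ({0..1} \<times> {a..b})
      (\<lambda>z. if fst z \<le> 1/2 then closest_point (H (2 * fst z) (snd z)) v else closest_point (K (2 * fst z - 1) (snd z)) v)"
      by (simp only:)
    then show "continuous_on ({0..1} \<times> {a..b}) (\<lambda>z. closest_point (G (fst z) (snd z)) v)"
      by (rule continuous_on_eq) (simp add: G_def)
  qed (use H K ends in \<open>auto simp: G_def\<close>)
qed

lemma lag_homotopic_glue: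
  assumes 1: "lag_homotopic \<omega> n l p c e" and 2: "lag_homotopic \<omega> n l q e d" and "c \<le> e" "e \<le> d"
  shows "lag_homotopic \<omega> n l (\<lambda>t. if t \<le> e then p t else q t) c d"
proof -
  obtain H :: "real \<Rightarrow> real \<Rightarrow> 'v set" where H: "\<And>s t. s \<in> {0..1} \<Longrightarrow> t \<in> {c..e} \<Longrightarrow> lag (H s t)"
    "\<And>v. continuous_on ({0..1} \<times> {c..e}) (\<lambda>z. closest_point (H (fst z) (snd z)) v)"
    "\<And>t. t \<in> {c..e} \<Longrightarrow> H 0 t = l t" "\<And>t. t \<in> {c..e} \<Longrightarrow> H 1 t = p t"
    "\<And>s. s \<in> {0..1} \<Longrightarrow> H s c = l c" "\<And>s. s \<in> {0..1} \<Longrightarrow> H s e = l e"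
    using lag_homotopicE[OF 1] by blast
  obtain K :: "real \<Rightarrow> real \<Rightarrow> 'v set" where K: "\<And>s t. s \<in> {0..1} \<Longrightarrow> t \<in> {e..d} \<Longrightarrow> lag (K s t)"
    "\<And>v. continuous_on ({0..1} \<times> {e..d}) (\<lambda>z. closest_point (K (fst z) (snd z)) v)"
    "\<And>t. t \<in> {e..d} \<Longrightarrow> K 0 t = l t" "\<And>t. t \<in> {e..d} \<Longrightarrow> K 1 t = q t"
    "\<And>s. s \<in> {0..1} \<Longrightarrow> K s e = l e" "\<And>s. s \<in> {0..1} \<Longrightarrow> K s d = l d"
    using lag_homotopicE[OF 2] by blast
  define G where "G s t = (if t \<le> e then H s t else K s t)" for s t
  show ?thesis
  proof (rule lag_homotopicI[where H = G])
    fix v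
    have "continuous_on ({0..1} \<times> {c..e} \<union> {0..1} \<times> {e..d})
      (\<lambda>z. if snd z \<le> e then closest_point (H (fst z) (snd z)) v else closest_point (K (fst z) (snd z)) v)"
    proof (rule continuous_on_cases[OF _ _ H(2) K(2)])
      show "\<forall>z. z \<in> {0..1} \<times> {c..e} \<and> \<not> snd z \<le> e \<or> z \<in> {0..1} \<times> {e..d} \<and> snd z \<le> e \<longrightarrow>
        closest_point (H (fst z) (snd z)) v = closest_point (K (fst z) (snd z)) v"
      proof (intro allI impI)
        fix z :: "real \<times> real"
        assume "z \<in> {0..1} \<times> {c..e} \<and> \<not> snd z \<le> e \<or> z \<in> {0..1} \<times> {e..d} \<and> snd z \<le> e"
        then have "snd z = e" "fst z \<in> {0..1}" by auto
        then show "closest_point (H (fst z) (snd z)) v = closest_point (K (fst z) (snd z)) v"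
          using H(6)[of "fst z"] K(5)[of "fst z"] by simp
      qed
    qed (auto intro: closed_Times)
    moreover have "{0..1} \<times> {c..e} \<union> {0..1} \<times> {e..d} = {0..1::real} \<times> {c..d}"
      using \<open>c \<le> e\<close> \<open>e \<le> d\<close> by auto
    ultimately have "continuous_on ({0..1} \<times> {c..d})
      (\<lambda>z. if snd z \<le> e then closest_point (H (fst z) (snd z)) v else closest_point (K (fst z) (snd z)) v)"
      by (simp only:)
    then show "continuous_on ({0..1} \<times> {c..d}) (\<lambda>z. closest_point (G (fst z) (snd z)) v)"
      by (rule continuous_on_eq) (simp add: G_def)
  next
    fix s :: real assume s: "s \<in> {0..1}"
    show "G s c = l c" using H(5)[OF s] \<open>c \<le> e\<close> by (simp add: G_def)
    show "G s d = l d" using H(6)[OF s] K(6)[OF s] \<open>e \<le> d\<close> by (cases "d = e") (auto simp: G_def)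
    show "lag (G s t)" if "t \<in> {c..d}" for t using H(1)[OF s, of t] K(1)[OF s, of t] that by (auto simp: G_def)
  next
    fix t assume t: "t \<in> {c..d}"
    show "G 0 t = l t" using H(3)[of t] K(3)[of t] t by (auto simp: G_def)
    show "G 1 t = (if t \<le> e then p t else q t)" using H(4)[of t] K(4)[of t] t by (auto simp: G_def)
  qed
qed

lemma lag_homotopic_const: "lag X \<Longrightarrow> lag_homotopic \<omega> n (\<lambda>t. X) (\<lambda>t. X) a b"
  by (rule lag_homotopicI[where H = "\<lambda>s t. X"]) auto

lemma lag_homotopic_cong:
  assumes "lag_homotopic \<omega> n l p a b" "\<And>t. t \<in> {a..b} \<Longrightarrow> l t = l' t" "a \<le> b"
  shows "lag_homotopic \<omega> n l' p a b"
proof -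
  obtain H :: "real \<Rightarrow> real \<Rightarrow> 'v set" where H: "\<And>s t. s \<in> {0..1} \<Longrightarrow> t \<in> {a..b} \<Longrightarrow> lag (H s t)"
    "\<And>v. continuous_on ({0..1} \<times> {a..b}) (\<lambda>z. closest_point (H (fst z) (snd z)) v)"
    "\<And>t. t \<in> {a..b} \<Longrightarrow> H 0 t = l t" "\<And>t. t \<in> {a..b} \<Longrightarrow> H 1 t = p t"
    "\<And>s. s \<in> {0..1} \<Longrightarrow> H s a = l a" "\<And>s. s \<in> {0..1} \<Longrightarrow> H s b = l b"
    using lag_homotopicE[OF assms(1)] by blast
  show ?thesis
    by (rule lag_homotopicI[where H = H]) (use H assms(2)[of a] assms(2)[of b] assms(2,3) in simp_all)
qed

section \<open>Replacing a continuous path by a differentiable one\<close>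

text \<open>\<open>Z\<close> plays two roles: vanishing derivatives at both ends permit
  concatenation, and vanishing derivatives on an interval record that the path rests there.\<close>

definition flat_C1 :: "real set \<Rightarrow> (real \<Rightarrow> 'v set) \<Rightarrow> real \<Rightarrow> real \<Rightarrow> bool" where
  "flat_C1 Z p c d \<longleftrightarrow> (\<forall>v. \<exists>D. (\<forall>t\<in>{c..d}. ((\<lambda>s. closest_point (p s) v) has_vector_derivative D t) (at t within {c..d}))
     \<and> continuous_on {c..d} D \<and> (\<forall>t\<in>Z. D t = 0))"

lemma flat_C1_mono: "flat_C1 Z p c d \<Longrightarrow> Z' \<subseteq> Z \<Longrightarrow> flat_C1 Z' p c d"
  unfolding flat_C1_def
proof
  fix v
  assume "\<forall>v. \<exists>D. (\<forall>t\<in>{c..d}. ((\<lambda>s. closest_point (p s) v) has_vector_derivative D t) (at t within {c..d}))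
     \<and> continuous_on {c..d} D \<and> (\<forall>t\<in>Z. D t = 0)" and Z: "Z' \<subseteq> Z"
  then obtain D where "(\<forall>t\<in>{c..d}. ((\<lambda>s. closest_point (p s) v) has_vector_derivative D t) (at t within {c..d}))
     \<and> continuous_on {c..d} D \<and> (\<forall>t\<in>Z. D t = 0)" by blast
  then show "\<exists>D. (\<forall>t\<in>{c..d}. ((\<lambda>s. closest_point (p s) v) has_vector_derivative D t) (at t within {c..d}))
     \<and> continuous_on {c..d} D \<and> (\<forall>t\<in>Z'. D t = 0)" using Z by (intro exI[of _ D]) auto
qed

lemma flat_C1_const: "flat_C1 Z (\<lambda>t. X) c d"
  unfolding flat_C1_def by (intro allI exI[of _ "\<lambda>t. 0"]) auto

text \<open>Both one-sided derivatives vanish at \<open>e\<close>, so the concatenation has no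
  corner.\<close>

lemma flat_C1_glue:
  assumes p: "flat_C1 {c, e} p c e" and q: "flat_C1 Z q e d" and Z: "e \<in> Z" "Z \<subseteq> {e..d}" and pq: "p e = q e"
    and "c \<le> e" "e \<le> d"
  shows "flat_C1 (insert c Z) (\<lambda>t. if t \<le> e then p t else q t) c d"
  unfolding flat_C1_def
proof
  fix v
  obtain D where D: "\<And>t. t \<in> {c..e} \<Longrightarrow> ((\<lambda>s. closest_point (p s) v) has_vector_derivative D t) (at t within {c..e})"
    "continuous_on {c..e} D" "D c = 0" "D e = 0" using p unfolding flat_C1_def by blast
  obtain E where E: "\<And>t. t \<in> {e..d} \<Longrightarrow> ((\<lambda>s. closest_point (q s) v) has_vector_derivative E t) (at t within {e..d})"
    "continuous_on {e..d} E" "\<And>t. t \<in> Z \<Longrightarrow> E t = 0" using q unfolding flat_C1_def by blast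
  have un: "{c..d} = {c..e} \<union> {e..d}" using \<open>c \<le> e\<close> \<open>e \<le> d\<close> by auto
  have in1: "{c..e} \<union> (closure {c..e} \<inter> closure {e..d}) = {c..e}" and in2: "{e..d} \<union> (closure {c..e} \<inter> closure {e..d}) = {e..d}"
    using \<open>c \<le> e\<close> \<open>e \<le> d\<close> by auto
  have iff: "t \<in> {c..e} \<longleftrightarrow> t \<le> e" if "t \<in> {c..d}" for t using that by auto
  show "\<exists>D. (\<forall>t\<in>{c..d}. ((\<lambda>s. closest_point (if s \<le> e then p s else q s) v) has_vector_derivative D t) (at t within {c..d}))
     \<and> continuous_on {c..d} D \<and> (\<forall>t\<in>insert c Z. D t = 0)"
  proof (intro exI[of _ "\<lambda>t. if t \<le> e then D t else E t"] conjI ballI)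
    fix t assume t: "t \<in> {c..d}"
    have "((\<lambda>s. if s \<in> {c..e} then closest_point (p s) v else closest_point (q s) v) has_vector_derivative
      (if t \<in> {c..e} then D t else E t)) (at t within {c..d})"
    proof (rule has_vector_derivative_If_within_closures[OF _ un])
      show "t \<in> {c..e} \<union> {e..d}" using t un by blast
      show "((\<lambda>s. closest_point (p s) v) has_vector_derivative D t) (at t within ({c..e} \<union> (closure {c..e} \<inter> closure {e..d})))"
        if "t \<in> {c..e} \<union> (closure {c..e} \<inter> closure {e..d})" using D(1) that unfolding in1 by blast
      show "((\<lambda>s. closest_point (q s) v) has_vector_derivative E t) (at t within ({e..d} \<union> (closure {c..e} \<inter> closure {e..d})))"
        if "t \<in> {e..d} \<union> (closure {c..e} \<inter> closure {e..d})" using E(1) that unfolding in2 by blast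
      assume "t \<in> closure {c..e}" "t \<in> closure {e..d}"
      then have "t = e" by auto
      then show "closest_point (p t) v = closest_point (q t) v" "D t = E t"
        using pq D(4) E(3)[OF Z(1)] by auto
    qed
    then show "((\<lambda>s. closest_point (if s \<le> e then p s else q s) v) has_vector_derivative (if t \<le> e then D t else E t)) (at t within {c..d})"
      unfolding iff[OF t] by (rule has_vector_derivative_transform[OF t, rotated]) (auto simp: iff)
  next
    show "continuous_on {c..d} (\<lambda>t. if t \<le> e then D t else E t)"
      unfolding un using D(4) E(3)[OF Z(1)] by (intro continuous_on_cases D(2) E(2)) (auto dest: antisym)
  next
    fix t assume t: "t \<in> insert c Z"
    show "(if t \<le> e then D t else E t) = 0"
      using t Z D(3,4) E(3) \<open>c \<le> e\<close> by (auto dest: antisym)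
  qed
qed

text \<open>Symmetry of the map amounts to isotropy of its graph. Symmetric maps form a vector
  space, so a chart of Lagrangians transversal to \<open>W\<close> is convex.\<close>

lemma lag_graph:
  assumes W: "transv W X" and \<phi>: "linear \<phi>" "\<And>v. v \<in> X \<Longrightarrow> \<phi> v \<in> W" "\<And>u v. u \<in> X \<Longrightarrow> v \<in> X \<Longrightarrow> \<omega> u (\<phi> v) = \<omega> v (\<phi> u)"
  shows "lag ((\<lambda>v. v + \<phi> v) ` X)" "inj_on (\<lambda>v. v + \<phi> v) X"
proof -
  have X: "lag X" "subspace X" and sW: "lag W" "subspace W" and WX: "W \<inter> X = {0}"
    using W by (auto simp: transv_def lag_subspace)
  have lin: "linear (\<lambda>v. v + \<phi> v)"
    by (rule linearI) (simp_all add: linear_add[OF \<phi>(1)] linear_cmul[OF \<phi>(1)] algebra_simps)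
  show inj: "inj_on (\<lambda>v. v + \<phi> v) X"
  proof (rule linear_injective_on_subspace_0[OF lin X(2), THEN iffD2], safe)
    fix v assume v: "v \<in> X" "v + \<phi> v = 0"
    then have "v = - \<phi> v" by (simp add: eq_neg_iff_add_eq_0)
    then have "v \<in> W" using \<phi>(2)[OF v(1)] subspace_neg[OF sW(2)] by metis
    then show "v = 0" using v(1) WX by blast
  qed
  have "\<omega> (u + \<phi> u) (v + \<phi> v) = 0" if "u \<in> X" "v \<in> X" for u v
  proof -
    have "\<omega> u v = 0" by (rule lag_iso[OF X(1) that])
    moreover have "\<omega> (\<phi> u) (\<phi> v) = 0" by (rule lag_iso[OF sW(1) \<phi>(2)[OF that(1)] \<phi>(2)[OF that(2)]])
    ultimately show ?thesis using \<phi>(3)[OF that] skew[of "\<phi> u" v] by (simp add: \<omega>_simps)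
  qed
  then show "lag ((\<lambda>v. v + \<phi> v) ` X)"
    using linear_subspace_image[OF lin X(2)] dim_image_subspace[OF lin X(2) inj] lag_dim[OF X(1)]
    unfolding lagrangian_def by blast
qed

text \<open>In the chart over \<open>X = l c\<close> the path is a curve of symmetric maps starting
  at 0. A straight-line homotopy deforms it into the segment to its endpoint, traversed with the
  speed of \<open>smoothstep\<close>.\<close>

lemma chart_path:
  assumes "c \<le> d" and l: "lag_continuous l {c..d}" and W: "\<And>t. t \<in> {c..d} \<Longrightarrow> transv W (l t)"
  shows "\<exists>p. lag_homotopic \<omega> n l p c d \<and> flat_C1 {c, d} p c d"
proof -
  have cd: "c \<in> {c..d}" "d \<in> {c..d}" using \<open>c \<le> d\<close> by auto
  define X where "X = l c"
  let ?w = "\<lambda>t. wpart W (l t)"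
  let ?\<sigma> = "smoothstep c d"
  have WX: "transv W X" using W[OF cd(1)] by (simp add: X_def)
  have X: "lag X" "subspace X" using WX by (auto simp: transv_def lag_subspace)
  have sW: "subspace W" using WX by (auto simp: transv_def lag_subspace)
  have wX: "?w c v = 0" if "v \<in> X" for v using wpart_in_L[OF WX] that by (simp add: X_def)
  have wsym: "\<omega> u (?w t v) = \<omega> v (?w t u)" if "t \<in> {c..d}" "u \<in> X" "v \<in> X" for t u v
    using wpart_skew[OF W[OF that(1)], of u v] lag_iso[OF X(1) that(2,3)] by simp
  note lw = wpart_linear[OF W]
  \<comment> \<open>On \<open>X\<close> both terms vanish at \<open>t = c\<close>; at
    \<open>t = d\<close> with \<open>c < d\<close> the coefficients add up to 1. So the ends stay
    fixed for all \<open>s\<close>.\<close>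
  define \<phi> where "\<phi> s t v = (1 - s) *\<^sub>R ?w t v + (s * ?\<sigma> t) *\<^sub>R ?w d v" for s t v
  have \<phi>: "linear (\<phi> s t)" "\<phi> s t v \<in> W" "u \<in> X \<Longrightarrow> v \<in> X \<Longrightarrow> \<omega> u (\<phi> s t v) = \<omega> v (\<phi> s t u)"
    if t: "t \<in> {c..d}" for s t u v
  proof -
    show "linear (\<phi> s t)"
      by (rule linearI) (simp_all add: \<phi>_def linear_add[OF lw[OF t]] linear_cmul[OF lw[OF t]]
          linear_add[OF lw[OF cd(2)]] linear_cmul[OF lw[OF cd(2)]] algebra_simps)
    show "\<phi> s t v \<in> W" unfolding \<phi>_def
      using wpart_mem(1)[OF W[OF t]] wpart_mem(1)[OF W[OF cd(2)]] sW by (intro subspace_add subspace_scale)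
    show "u \<in> X \<Longrightarrow> v \<in> X \<Longrightarrow> \<omega> u (\<phi> s t v) = \<omega> v (\<phi> s t u)"
      using wsym[OF t] wsym[OF cd(2)] by (simp add: \<phi>_def \<omega>_simps)
  qed
  define H where "H s t = (\<lambda>v. v + \<phi> s t v) ` X" for s t
  have lagH: "lag (H s t)" "inj_on (\<lambda>v. v + \<phi> s t v) X" if "t \<in> {c..d}" for s t
    unfolding H_def using lag_graph[OF WX \<phi>(1)[OF that] \<phi>(2)[OF that] \<phi>(3)[OF that]] by blast+
  have full: "(\<lambda>v. v + ?w t v) ` X = l t" if t: "t \<in> {c..d}" for t
  proof (rule subspace_dim_equal)
    have g: "lag ((\<lambda>v. v + ?w t v) ` X)"
      by (rule lag_graph(1)[OF WX lw[OF t] wpart_mem(1)[OF W[OF t]] wsym[OF t]])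
    show "subspace ((\<lambda>v. v + ?w t v) ` X)" by (rule lag_subspace[OF g])
    show "subspace (l t)" by (rule lag_subspace[OF transv_lag(2)[OF W[OF t]]])
    show "(\<lambda>v. v + ?w t v) ` X \<subseteq> l t" using wpart_mem(2)[OF W[OF t]] by blast
    show "dim (l t) \<le> dim ((\<lambda>v. v + ?w t v) ` X)"
      using lag_dim[OF g] lag_dim[OF transv_lag(2)[OF W[OF t]]] by simp
  qed
  define p where "p t = (\<lambda>v. v + ?\<sigma> t *\<^sub>R ?w d v) ` X" for t
  have hom: "lag_homotopic \<omega> n l p c d"
  proof (rule lag_homotopicI[where H = H])
    show "lag (H s t)" if "s \<in> {0..1}" "t \<in> {c..d}" for s t by (rule lagH(1)[OF that(2)])
    show "H 0 t = l t" if "t \<in> {c..d}" for t using full[OF that] by (simp add: H_def \<phi>_def)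
    show "H 1 t = p t" if "t \<in> {c..d}" for t by (simp add: H_def \<phi>_def p_def)
    show "H s c = l c" for s
    proof -
      have "v + \<phi> s c v = v" if "v \<in> X" for v using wX[OF that] by (simp add: \<phi>_def smoothstep_def)
      then show ?thesis unfolding H_def by (simp add: X_def)
    qed
    show "H s d = l d" for s
    proof -
      have "v + \<phi> s d v = v + ?w d v" if "v \<in> X" for v
      \<comment> \<open>For \<open>c = d\<close> the smoothstep vanishes, but then
        \<open>l d\<close> is \<open>X\<close> and the graph map is zero on it.\<close>
      proof (cases "c = d")
        case True
        then show ?thesis using wX[OF that] by (simp add: \<phi>_def)
      next
        case False
        then show ?thesis by (simp add: \<phi>_def smoothstep_def flip: scaleR_add_left)
      qed
      then have "H s d = (\<lambda>v. v + ?w d v) ` X" unfolding H_def by (rule image_cong[OF refl])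
      then show ?thesis using full[OF cd(2)] by simp
    qed
    fix v
    show "continuous_on ({0..1} \<times> {c..d}) (\<lambda>z. closest_point (H (fst z) (snd z)) v)"
      unfolding continuous_on_def
    proof
      fix z0 :: "real \<times> real" assume z0: "z0 \<in> {0..1} \<times> {c..d}"
      then have t0: "snd z0 \<in> {c..d}" by auto
      show "((\<lambda>z. closest_point (H (fst z) (snd z)) v) \<longlongrightarrow> closest_point (H (fst z0) (snd z0)) v) (at z0 within {0..1} \<times> {c..d})"
      proof (rule tendsto_closest_point_image[where X = X and T = "\<lambda>z v. v + \<phi> (fst z) (snd z) v" and ?T0.0 = "\<lambda>v. v + \<phi> (fst z0) (snd z0) v"])
        have lin: "linear (\<lambda>v. v + \<phi> s t v)" if "t \<in> {c..d}" for s t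
          by (rule linearI) (simp_all add: linear_add[OF \<phi>(1)[OF that]] linear_cmul[OF \<phi>(1)[OF that]] algebra_simps)
        show "eventually (\<lambda>z. linear (\<lambda>v. v + \<phi> (fst z) (snd z) v)) (at z0 within {0..1} \<times> {c..d})"
          using eventually_at_within_mem by eventually_elim (auto intro: lin)
        show "linear (\<lambda>v. v + \<phi> (fst z0) (snd z0) v)" by (rule lin[OF t0])
        show "((\<lambda>z. x + \<phi> (fst z) (snd z) x) \<longlongrightarrow> x + \<phi> (fst z0) (snd z0) x) (at z0 within {0..1} \<times> {c..d})" for x
        proof -
          have cw: "continuous_on {c..d} (\<lambda>t. ?w t x)"
            unfolding continuous_on_def using lag_tendsto_wpart[OF lag_continuousD[OF l] W] by blast
          have c1: "continuous_on ({0..1} \<times> {c..d}) (\<lambda>z. ?w (snd z) x)"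
            by (rule continuous_on_compose2[OF cw]) (auto intro!: continuous_intros)
          have "continuous_on S ?\<sigma>" for S unfolding smoothstep_def[abs_def]
            by (cases "c = d") (auto intro!: continuous_intros)
          then have c2: "continuous_on ({0..1} \<times> {c..d}) (\<lambda>z. ?\<sigma> (snd z))"
            by (rule continuous_on_compose2) (auto intro!: continuous_intros)
          have "continuous_on ({0..1} \<times> {c..d}) (\<lambda>z. x + \<phi> (fst z) (snd z) x)"
            unfolding \<phi>_def by (intro continuous_intros c1 c2)
          then show ?thesis using z0 unfolding continuous_on_def by blast
        qed
        show "subspace X" by (rule X(2))
        show "inj_on (\<lambda>v. v + \<phi> (fst z0) (snd z0) v) X" by (rule lagH(2)[OF t0])
        show "eventually (\<lambda>z. subspace (H (fst z) (snd z)) \<and> (\<lambda>v. v + \<phi> (fst z) (snd z) v) ` X \<subseteq> H (fst z) (snd z) \<and> dim (H (fst z) (snd z)) \<le> dim X)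
          (at z0 within {0..1} \<times> {c..d})"
          using eventually_at_within_mem
        proof eventually_elim
          case (elim z)
          then have "lag (H (fst z) (snd z))" using lagH(1)[of "snd z"] by auto
          then show ?case using X(1) by (simp add: lag_subspace lag_dim) (simp add: H_def)
        qed
        show "subspace (H (fst z0) (snd z0))" "dim (H (fst z0) (snd z0)) \<le> dim X"
          using lagH(1)[OF t0, of "fst z0"] X(1) by (simp_all add: lag_subspace lag_dim)
        show "(\<lambda>v. v + \<phi> (fst z0) (snd z0) v) ` X \<subseteq> H (fst z0) (snd z0)" by (simp add: H_def)
      qed
    qed
  qed
  \<comment> \<open>The segment with its linear parameter; \<open>p\<close> is its composition with
    \<open>smoothstep\<close>, and the chain rule transfers the vanishing derivative at the
    ends.\<close>
  define q where "q r = (\<lambda>v. v + r *\<^sub>R ?w d v) ` X" for r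
  have q: "lag (q r)" "inj_on (\<lambda>v. v + r *\<^sub>R ?w d v) X" "linear (\<lambda>v. v + r *\<^sub>R ?w d v)" for r
  proof -
    have lin: "linear (\<lambda>v. r *\<^sub>R ?w d v)" using lw[OF cd(2)] by (rule linear_compose_scale_right)
    show "lag (q r)" "inj_on (\<lambda>v. v + r *\<^sub>R ?w d v) X"
      unfolding q_def using wsym[OF cd(2)] wpart_mem(1)[OF W[OF cd(2)]] subspace_scale[OF sW]
      by (intro lag_graph[OF WX lin]; simp add: \<omega>_simps)+
    show "linear (\<lambda>v. v + r *\<^sub>R ?w d v)"
      by (rule linearI) (simp_all add: linear_add[OF lin] linear_cmul[OF lin] linear_add[OF lw[OF cd(2)]] linear_cmul[OF lw[OF cd(2)]] algebra_simps)
  qed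
  have qC1: "C1_on {0..1} (\<lambda>r. closest_point (q r) v)" for v
  proof (rule C1_on_closest_point_image)
    show "(0::real) < 1" by simp
    show "subspace (q r)" for r by (rule lag_subspace[OF q(1)])
    fix r0 :: real
    have "C1_on {0..1} (\<lambda>r. x + r *\<^sub>R ?w d x)" for x
      by (rule C1_onI[where D = "\<lambda>r. ?w d x"]) (auto intro!: derivative_eq_intros)
    then show "\<exists>X T. subspace X \<and> (\<forall>t\<in>{0..1}. linear (T t) \<and> T t ` X \<subseteq> q t \<and> dim (q t) \<le> dim X)
        \<and> (\<forall>x::'v. C1_on {0..1} (\<lambda>t. T t x)) \<and> inj_on (T r0) X"
      using X q lag_dim[OF q(1)] lag_dim[OF X(1)]
      by (intro exI[of _ X] exI[of _ "\<lambda>r v. v + r *\<^sub>R ?w d v"]) (auto simp: q_def)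
  qed
  have "flat_C1 {c, d} p c d"
    unfolding flat_C1_def
  proof
    fix v
    obtain D where D: "\<And>r. r \<in> {0..1} \<Longrightarrow> ((\<lambda>r. closest_point (q r) v) has_vector_derivative D r) (at r within {0..1})"
      "continuous_on {0..1} D" using qC1 unfolding C1_on_def by blast
    let ?s = "\<lambda>t. 6 * ((t - c) / (d - c)) * (1 - (t - c) / (d - c)) / (d - c)"
    have img: "?\<sigma> ` {c..d} \<subseteq> {0..1}" using smoothstep_range by blast
    show "\<exists>D. (\<forall>t\<in>{c..d}. ((\<lambda>s. closest_point (p s) v) has_vector_derivative D t) (at t within {c..d}))
     \<and> continuous_on {c..d} D \<and> (\<forall>t\<in>{c, d}. D t = 0)"
    proof (intro exI[of _ "\<lambda>t. ?s t *\<^sub>R D (?\<sigma> t)"] conjI ballI)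
      fix t assume t: "t \<in> {c..d}"
      have "(((\<lambda>r. closest_point (q r) v) \<circ> ?\<sigma>) has_vector_derivative ?s t *\<^sub>R D (?\<sigma> t)) (at t within {c..d})"
        by (rule vector_diff_chain_within[OF smoothstep_derivative])
          (rule has_vector_derivative_within_subset[OF D(1)[OF smoothstep_range[OF t]] img])
      then show "((\<lambda>s. closest_point (p s) v) has_vector_derivative ?s t *\<^sub>R D (?\<sigma> t)) (at t within {c..d})"
        by (simp add: o_def p_def q_def)
    next
      have cs: "continuous_on {c..d} ?\<sigma>" unfolding smoothstep_def[abs_def]
        by (cases "c = d") (auto intro!: continuous_intros)
      have "continuous_on {c..d} (\<lambda>t. D (?\<sigma> t))" by (rule continuous_on_compose2[OF D(2) cs img])
      moreover have "continuous_on {c..d} ?s" by (cases "c = d") (auto intro!: continuous_intros)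
      ultimately show "continuous_on {c..d} (\<lambda>t. ?s t *\<^sub>R D (?\<sigma> t))" by (intro continuous_on_scaleR)
    next
      fix t assume "t \<in> {c, d}"
      then have "?s t = 0" by auto
      then show "?s t *\<^sub>R D (?\<sigma> t) = 0" by (simp only: scaleR_zero_left)
    qed
  qed
  with hom show ?thesis by blast
qed

text \<open>A single chart covers only a short piece; flatness at the division points lets the
  pieces be glued by bisection.\<close>

lemma flat_path_exists:
  assumes "a \<le> b" and l: "lag_continuous l {a..b}"
  shows "\<exists>p. lag_homotopic \<omega> n l p a b \<and> flat_C1 {a, b} p a b"
proof -
  define P where "P c d \<longleftrightarrow> (a \<le> c \<and> d \<le> b \<and> c \<le> d \<longrightarrow> (\<exists>p. lag_homotopic \<omega> n l p c d \<and> flat_C1 {c, d} p c d))" for c d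
  have "P a b"
  proof (rule Bolzano[where P = P, OF \<open>a \<le> b\<close>])
    show "P c d" if P: "P c e" "P e d" and ced: "c \<le> e" "e \<le> d" for c e d
      unfolding P_def
    proof
      assume h: "a \<le> c \<and> d \<le> b \<and> c \<le> d"
      obtain p where p: "lag_homotopic \<omega> n l p c e" "flat_C1 {c, e} p c e" using P(1) ced h unfolding P_def by auto
      obtain q where q: "lag_homotopic \<omega> n l q e d" "flat_C1 {e, d} q e d" using P(2) ced h unfolding P_def by auto
      have "p e = l e" by (rule lag_homotopic_ends(2)[OF p(1) ced(1)])
      moreover have "q e = l e" by (rule lag_homotopic_ends(1)[OF q(1) ced(2)])
      ultimately have "flat_C1 (insert c {e, d}) (\<lambda>t. if t \<le> e then p t else q t) c d"
        using ced by (intro flat_C1_glue[OF p(2) q(2)]) auto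
      then have "flat_C1 {c, d} (\<lambda>t. if t \<le> e then p t else q t) c d" by (rule flat_C1_mono) auto
      then show "\<exists>p. lag_homotopic \<omega> n l p c d \<and> flat_C1 {c, d} p c d"
        using lag_homotopic_glue[OF p(1) q(1) ced] by blast
    qed
    fix x assume "a \<le> x" "x \<le> b"
    then have x: "x \<in> {a..b}" by simp
    have lx: "lag (l x)" by (rule lag_continuous_lag[OF l x])
    obtain W where W: "transv W (l x)" using common_transversal3[OF lx lx lx] by blast
    from lag_tendsto_transv[OF lag_continuousD[OF l x] W]
    obtain e where e: "e > 0" "\<And>t. t \<in> {a..b} \<Longrightarrow> t \<noteq> x \<Longrightarrow> dist t x < e \<Longrightarrow> transv W (l t)"
      unfolding eventually_at by blast
    have "P c d" if cd: "c \<le> x" "x \<le> d" "d - c < e" for c d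
      unfolding P_def
    proof
      assume ab: "a \<le> c \<and> d \<le> b \<and> c \<le> d"
      have "transv W (l t)" if "t \<in> {c..d}" for t
        by (cases "t = x") (use e(2)[of t] cd ab that W in \<open>auto simp: dist_real_def\<close>)
      moreover have "lag_continuous l {c..d}" using lag_continuous_subset[OF l, of "{c..d}"] ab by auto
      ultimately show "\<exists>p. lag_homotopic \<omega> n l p c d \<and> flat_C1 {c, d} p c d"
        using ab by (intro chart_path) auto
    qed
    then show "\<exists>e>0. \<forall>c d. c \<le> x \<and> x \<le> d \<and> d - c < e \<longrightarrow> P c d"
      using e(1) by (intro exI[of _ e]) simp
  qed
  then show ?thesis using assms(1) by (simp add: P_def)
qed

text \<open>The parameter change \<open>\<tau>\<close> traverses the whole path during
  \<open>{a..m}\<close> and then stays at \<open>b\<close>; it is joined to the identity by convex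
  combination. Smoothing takes place on \<open>{a..m}\<close> alone, so the tail remains
  constant.\<close>

lemma flat_path_constant_tail:
  assumes "a < m" "m < b" and l: "lag_path \<omega> n l a b"
  shows "\<exists>p. lag_homotopic \<omega> n l p a b \<and> flat_C1 {m..b} p a b \<and> (\<forall>t\<in>{m..b}. p t = l b)"
proof -
  define \<tau> where "\<tau> t = min b (a + (b - a) / (m - a) * (t - a))" for t
  have \<tau>a: "\<tau> a = a" using assms by (simp add: \<tau>_def)
  have \<tau>m: "\<tau> t = b" if "m \<le> t" for t
  proof -
    have "(b - a) / (m - a) * (m - a) \<le> (b - a) / (m - a) * (t - a)"
      using assms that by (intro mult_left_mono) auto
    then show ?thesis using assms by (simp add: \<tau>_def)
  qed
  have \<tau>r: "\<tau> t \<in> {a..b}" if "t \<in> {a..b}" for t using assms that by (auto simp: \<tau>_def)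
  have \<tau>c: "continuous_on S \<tau>" for S unfolding \<tau>_def[abs_def] using assms by (intro continuous_intros) auto
  have cl: "continuous_on {a..b} (\<lambda>t. closest_point (l t) v)" for v using l by (simp add: lag_path_def)
  have lagl: "lag (l t)" if "t \<in> {a..b}" for t using l that by (simp add: lag_path_def)
  define k where "k t = l (\<tau> t)" for t
  have hk: "lag_homotopic \<omega> n l k a b"
  proof (rule lag_homotopicI[where H = "\<lambda>s t. l ((1 - s) * t + s * \<tau> t)"])
    have r: "(1 - s) * t + s * \<tau> t \<in> {a..b}" if "s \<in> {0..1}" "t \<in> {a..b}" for s t
      using convexD[OF convex_real_interval(5)[of a b] that(2) \<tau>r[OF that(2)], of "1 - s" s] that(1) by simp
    show "lag (l ((1 - s) * t + s * \<tau> t))" if "s \<in> {0..1}" "t \<in> {a..b}" for s t by (rule lagl[OF r[OF that]])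
    show "continuous_on ({0..1} \<times> {a..b}) (\<lambda>z. closest_point (l ((1 - fst z) * snd z + fst z * \<tau> (snd z))) v)" for v
    proof (rule continuous_on_compose2[OF cl])
      have "continuous_on ({0..1} \<times> {a..b}) (\<lambda>z. \<tau> (snd z))"
        by (rule continuous_on_compose2[OF \<tau>c[of UNIV]]) (auto intro!: continuous_intros)
      then show "continuous_on ({0..1} \<times> {a..b}) (\<lambda>z. (1 - fst z) * snd z + fst z * \<tau> (snd z))"
        by (intro continuous_intros)
      show "(\<lambda>z. (1 - fst z) * snd z + fst z * \<tau> (snd z)) ` ({0..1} \<times> {a..b}) \<subseteq> {a..b}" using r by auto
    qed
  qed (use \<tau>a \<tau>m[of b] assms in \<open>auto simp: k_def algebra_simps\<close>)
  have pk: "lag_continuous k {a..b}"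
  proof (rule lag_path_continuous)
    show "lag_path \<omega> n k a b"
      unfolding lag_path_def k_def using lagl \<tau>r
      by (auto intro!: continuous_on_compose2[OF cl \<tau>c])
  qed
  then have "lag_continuous k {a..m}" by (rule lag_continuous_subset) (use assms in auto)
  then obtain q where q: "lag_homotopic \<omega> n k q a m" "flat_C1 {a, m} q a m"
    using flat_path_exists[of a m k] assms by auto
  have kb: "k t = l b" if "m \<le> t" for t using \<tau>m[OF that] by (simp add: k_def)
  have qm: "q m = l b" using lag_homotopic_ends(2)[OF q(1)] assms kb[of m] by simp
  define p where "p t = (if t \<le> m then q t else l b)" for t
  have lb: "lag (l b)" using lagl[of b] assms by simp
  have "lag_homotopic \<omega> n k (\<lambda>t. l b) m b"
    by (rule lag_homotopic_cong[OF lag_homotopic_const[OF lb]]) (use kb assms in auto)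
  then have "lag_homotopic \<omega> n k p a b"
    unfolding p_def[abs_def] using assms by (intro lag_homotopic_glue[OF q(1)]) auto
  then have "lag_homotopic \<omega> n l p a b" using hk assms by (intro lag_homotopic_trans[of l k a b p]) auto
  moreover have "flat_C1 (insert a {m..b}) p a b"
    unfolding p_def[abs_def] using assms qm by (intro flat_C1_glue[OF q(2) flat_C1_const]) auto
  then have "flat_C1 {m..b} p a b" by (rule flat_C1_mono) auto
  moreover have "p t = l b" if "t \<in> {m..b}" for t using that qm by (cases "t = m") (auto simp: p_def)
  ultimately show ?thesis by blast
qed

end

section \<open>Rotation by a compatible complex structure\<close>

definition rot :: "('v::real_vector \<Rightarrow> 'v) \<Rightarrow> real \<Rightarrow> 'v \<Rightarrow> 'v" where
  "rot J \<theta> v = cos \<theta> *\<^sub>R v + sin \<theta> *\<^sub>R J v"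

context symplectic_space
begin

context
  fixes L0 J
  assumes J: "compatible L0 J" and L0: "lag L0"
begin

lemma linear_J: "linear J" using J by (simp add: compatible_def)

lemma J_J: "J (J v) = - v" using J by (simp add: compatible_def)

lemma \<omega>_J_J: "\<omega> (J u) (J v) = \<omega> u v" using J by (simp add: compatible_def)

lemma \<omega>_J_pos: "v \<noteq> 0 \<Longrightarrow> \<omega> v (J v) > 0" using J by (simp add: compatible_def)

lemmas J_simps = linear_add[OF linear_J] linear_cmul[OF linear_J] linear_neg[OF linear_J] linear_diff[OF linear_J] J_J

lemma linear_rot: "linear (rot J \<theta>)"
  by (rule linearI) (simp_all add: rot_def J_simps algebra_simps)

lemma rot_0 [simp]: "rot J 0 v = v" by (simp add: rot_def)

lemma rot_rot: "rot J \<theta> (rot J \<phi> v) = rot J (\<theta> + \<phi>) v"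
  by (simp add: rot_def J_simps cos_add sin_add algebra_simps)

lemma J_rot: "J (rot J \<theta> v) = rot J \<theta> (J v)"
  by (simp add: rot_def J_simps)

lemma \<omega>_rot: "\<omega> (rot J \<theta> u) (rot J \<theta> v) = \<omega> u v"
proof -
  have "\<omega> (J u) v = - \<omega> u (J v)" using \<omega>_J_J[of u "J v"] by (simp add: J_J \<omega>_simps)
  then have "\<omega> (rot J \<theta> u) (rot J \<theta> v) = cos \<theta> * (cos \<theta> * \<omega> u v) + sin \<theta> * (sin \<theta> * \<omega> u v)"
    by (simp add: rot_def \<omega>_simps \<omega>_J_J algebra_simps)
  also have "\<dots> = ((cos \<theta>)\<^sup>2 + (sin \<theta>)\<^sup>2) * \<omega> u v"
    by (simp only: power2_eq_square distrib_right mult.assoc)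
  finally show ?thesis by simp
qed

lemma inj_rot: "inj_on (rot J \<theta>) S"
  by (rule inj_on_inverseI[where g = "rot J (- \<theta>)"]) (simp add: rot_rot)

lemma lag_rot: "lag L \<Longrightarrow> lag (rot J \<theta> ` L)"
proof -
  assume L: "lag L"
  have "dim (rot J \<theta> ` L) = n"
    using dim_image_subspace[OF linear_rot lag_subspace[OF L] inj_rot] lag_dim[OF L] by simp
  then show ?thesis
    using linear_subspace_image[OF linear_rot lag_subspace[OF L]] lag_iso[OF L]
    unfolding lagrangian_def by (auto simp: \<omega>_rot)
qed

lemma rot_periodic: "rot J (\<theta> + 2 * pi * real k) = rot J \<theta>"
proof -
  have "cos (\<theta> + 2 * pi * real k) = cos \<theta>" "sin (\<theta> + 2 * pi * real k) = sin \<theta>"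
    using sin.plus_of_nat[of \<theta> k] cos.plus_of_nat[of \<theta> k] by (simp_all add: mult_ac)
  then show ?thesis by (simp add: rot_def[abs_def])
qed

text \<open>For \<open>c\<close> minus the cotangent of \<open>\<theta>\<close>, rotating
  \<open>L0\<close> back by \<open>\<theta>\<close> gives \<open>tilt J L0 c\<close>, so a tilt
  transversal to \<open>L\<close> provides an angle.\<close>

lemma rot_transversal_exists:
  assumes L: "lag L" obtains \<theta> where "rot J \<theta> ` L \<inter> L0 = {0}"
proof -
  obtain c where c: "tilt J L0 c \<inter> L = {0}"
    using ex_new_if_finite[OF infinite_UNIV_char_0 finite_tilt[OF L0 J L]] by blast
  have pos: "1 + c\<^sup>2 > 0" by (simp add: add_pos_nonneg)
  have "(- c / sqrt (1 + c\<^sup>2))\<^sup>2 + (1 / sqrt (1 + c\<^sup>2))\<^sup>2 = 1"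
    using pos by (simp add: power_divide add_divide_distrib[symmetric] add.commute)
  \<comment> \<open>The pair is normalised to the unit circle, and its second entry keeps the sine
    away from 0.\<close>
  then obtain \<theta> where \<theta>: "- c / sqrt (1 + c\<^sup>2) = cos \<theta>" "1 / sqrt (1 + c\<^sup>2) = sin \<theta>"
    using sincos_total_2pi by blast
  have s0: "sin \<theta> \<noteq> 0" using \<theta>(2) pos by (metis divide_eq_0_iff less_irrefl real_sqrt_eq_zero_cancel_iff zero_neq_one)
  have cs: "cos \<theta> = - c * sin \<theta>" using \<theta> by (metis divide_inverse mult.left_neutral)
  have "y = 0" if y: "y \<in> L0" "y \<in> rot J \<theta> ` L" for y
  proof -
    obtain x where x: "x \<in> L" "y = rot J \<theta> x" using y by blast
    have "x = rot J (- \<theta>) y" by (simp add: x rot_rot)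
    also have "\<dots> = - sin \<theta> *\<^sub>R (c *\<^sub>R y + J y)" by (simp add: rot_def cs algebra_simps)
    finally have e: "x = - sin \<theta> *\<^sub>R (c *\<^sub>R y + J y)" .
    then have "c *\<^sub>R y + J y = (- 1 / sin \<theta>) *\<^sub>R x" using s0 by simp
    also have "\<dots> \<in> L" using x(1) lag_subspace[OF L] by (simp add: subspace_scale subspace_neg)
    finally have "c *\<^sub>R y + J y \<in> tilt J L0 c \<inter> L" using y(1) by (auto simp: tilt_def)
    then have "c *\<^sub>R y + J y = 0" using c by blast
    then have "x = 0" using e by simp
    then show ?thesis using x linear_0[OF linear_rot] by simp
  qed
  moreover have "0 \<in> L0" "0 \<in> rot J \<theta> ` L"
    using L0 lag_rot[OF L] by (auto simp: lag_subspace subspace_0)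
  ultimately show thesis using that[of \<theta>] by blast
qed

text \<open>With \<open>u\<close> the vector rotated back, the crossing form is the speed of the
  angle times \<open>\<omega> u (J u)\<close> plus the crossing form of \<open>p\<close>. While
  \<open>p\<close> moves, the speed outweighs the bound \<open>M\<close>; on the tail only the first
  term remains, and its factor vanishes solely at the midpoint, where no crossing occurs. So at a
  crossing there are no nonzero null vectors.\<close>

lemma regular_rotation:
  assumes "a < b" and hp: "lag_homotopic \<omega> n l p a b" and fp: "flat_C1 {m..b} p a b"
    and pm: "\<And>t. t \<in> {m..b} \<Longrightarrow> p t = l b" and m: "m = a + (b - a) / 4"
  shows "\<exists>l'. lag_homotopic \<omega> n l l' a b \<and> regular_path \<omega> n L0 l' a b"
proof -
  obtain H :: "real \<Rightarrow> real \<Rightarrow> 'v set" where H: "\<And>s t. s \<in> {0..1} \<Longrightarrow> t \<in> {a..b} \<Longrightarrow> lag (H s t)"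
    "\<And>v. continuous_on ({0..1} \<times> {a..b}) (\<lambda>z. closest_point (H (fst z) (snd z)) v)"
    "\<And>t. t \<in> {a..b} \<Longrightarrow> H 0 t = l t" "\<And>t. t \<in> {a..b} \<Longrightarrow> H 1 t = p t"
    "\<And>s. s \<in> {0..1} \<Longrightarrow> H s a = l a" "\<And>s. s \<in> {0..1} \<Longrightarrow> H s b = l b"
    using lag_homotopicE[OF hp] by blast
  have lagp: "lag (p t)" if "t \<in> {a..b}" for t using H(1)[of 1 t] H(4)[of t] that by simp
  have sp: "subspace (p t)" if "t \<in> {a..b}" for t by (rule lag_subspace[OF lagp[OF that]])
  have "\<forall>v. \<exists>D. (\<forall>t\<in>{a..b}. ((\<lambda>s. closest_point (p s) v) has_vector_derivative D t) (at t within {a..b}))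
     \<and> continuous_on {a..b} D \<and> (\<forall>t\<in>{m..b}. D t = 0)" using fp by (simp add: flat_C1_def)
  then obtain D where D': "\<forall>v. (\<forall>t\<in>{a..b}. ((\<lambda>s. closest_point (p s) v) has_vector_derivative D v t) (at t within {a..b}))
     \<and> continuous_on {a..b} (D v) \<and> (\<forall>t\<in>{m..b}. D v t = 0)" by (rule choice[THEN exE])
  have D: "((\<lambda>s. closest_point (p s) v) has_vector_derivative D v t) (at t within {a..b})" if "t \<in> {a..b}" for v t
    using D' that by blast
  have Dc: "continuous_on {a..b} (D v)" and D0: "t \<in> {m..b} \<Longrightarrow> D v t = 0" for v t using D' by blast+
  have linD: "linear (\<lambda>v. D v t)" if t: "t \<in> {a..b}" for t
    by (rule linear_closest_point_derivative[OF \<open>a < b\<close> t sp D[OF t]])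
  have pC1: "C1_on {a..b} (\<lambda>t. closest_point (p t) v)" for v by (rule C1_onI[OF D Dc])
  \<comment> \<open>The bound that the angular speed has to exceed: on the compact interval the
    velocity of \<open>p\<close> is bounded, and the positive form of \<open>J\<close> dominates the
    squared norm.\<close>
  have "\<exists>M>0. \<forall>t\<in>{a..b}. \<forall>u. \<bar>\<omega> u (D u t)\<bar> \<le> M * \<omega> u (J u)"
  proof -
    obtain B where B: "B > 0" "\<And>x y. \<bar>\<omega> x y\<bar> \<le> B * norm x * norm y"
      using bilinear_bounded_pos[OF bil] by (auto simp: real_norm_def)
    have "\<exists>K. \<forall>t\<in>{a..b}. norm (D v t) \<le> K" for v
      using compact_imp_bounded[OF compact_continuous_image[OF Dc compact_Icc]] unfolding bounded_iff by blast
    then obtain K where K: "\<And>v t. t \<in> {a..b} \<Longrightarrow> norm (D v t) \<le> K v" by metis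
    define N where "N = (\<Sum>i\<in>Basis. K i) + 1"
    have K0: "0 \<le> K v" for v using K[of a v] \<open>a < b\<close> norm_ge_zero[of "D v a"] by (meson atLeastAtMost_iff less_imp_le order_refl order_trans)
    have N: "N > 0" using sum_nonneg[of Basis K] K0 by (simp add: N_def add_nonneg_pos)
    have Dn: "norm (D u t) \<le> N * norm u" if t: "t \<in> {a..b}" for u t
    proof -
      have "D u t = (\<Sum>i\<in>Basis. (u \<bullet> i) *\<^sub>R D i t)"
        using linear_sum[OF linD[OF t], of "\<lambda>i. (u \<bullet> i) *\<^sub>R i" Basis]
        by (simp add: linear_cmul[OF linD[OF t]] euclidean_representation)
      then have "norm (D u t) \<le> (\<Sum>i\<in>Basis. \<bar>u \<bullet> i\<bar> * norm (D i t))" by (simp add: sum_norm_le)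
      also have "\<dots> \<le> (\<Sum>i\<in>Basis. norm u * K i)"
        by (intro sum_mono mult_mono Basis_le_norm K[OF t]) auto
      also have "\<dots> = norm u * (\<Sum>i\<in>Basis. K i)" by (simp add: sum_distrib_left)
      also have "\<dots> \<le> norm u * N" by (intro mult_left_mono) (auto simp: N_def)
      finally show ?thesis by (simp add: mult.commute)
    qed
    define G where "G u v = \<omega> u (J v)" for u v
    have "bilinear G" unfolding G_def bilinear_def
      by (auto intro!: linearI simp: J_simps \<omega>_simps)
    then obtain c where c: "c > 0" "\<And>u. c * (norm u)\<^sup>2 \<le> G u u"
      using pos_def_lower_bound[of G UNIV] \<omega>_J_pos by (auto simp: G_def)
    have "\<bar>\<omega> u (D u t)\<bar> \<le> (B * N / c) * \<omega> u (J u)" if t: "t \<in> {a..b}" for u t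
    proof -
      have "\<bar>\<omega> u (D u t)\<bar> \<le> B * norm u * norm (D u t)" by (rule B(2))
      also have "\<dots> \<le> B * norm u * (N * norm u)" using B(1) Dn[OF t] by (intro mult_left_mono) auto
      also have "\<dots> = (B * N / c) * (c * (norm u)\<^sup>2)" using c(1) by (simp add: power2_eq_square)
      also have "\<dots> \<le> (B * N / c) * \<omega> u (J u)"
        using c(2)[of u] B(1) N c(1) by (intro mult_left_mono) (auto simp: G_def)
      finally show ?thesis .
    qed
    then show ?thesis using B(1) N c(1) by (intro exI[of _ "B * N / c"]) auto
  qed
  then obtain M where M: "M > 0" "\<And>t u. t \<in> {a..b} \<Longrightarrow> \<bar>\<omega> u (D u t)\<bar> \<le> M * \<omega> u (J u)" by blast
  have "b \<in> {m..b}" using \<open>a < b\<close> by (simp add: m field_simps)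
  then have lb: "lag (l b)" using lagp[of b] pm[of b] \<open>a < b\<close> by simp
  obtain \<theta>0 where \<theta>0: "rot J \<theta>0 ` l b \<inter> L0 = {0}" by (rule rot_transversal_exists[OF lb])
  \<comment> \<open>Full turns leave the Lagrangian at the turning point unchanged; enough of them
    are added to make the rotation fast.\<close>
  obtain k :: nat where k: "(2 * M / (b - a)) * ((b - a)\<^sup>2 / 4) - \<theta>0 < real k * (2 * pi)"
    using reals_Archimedean3[of "2 * pi"] pi_gt_zero by (auto simp: mult.commute)
  \<comment> \<open>Chosen such that the parabola \<open>\<theta>\<close> reaches exactly
    \<open>\<theta>0\<close> plus the full turns at its vertex, the midpoint of the
    interval.\<close>
  define \<kappa> where "\<kappa> = (\<theta>0 + 2 * pi * real k) * 4 / (b - a)\<^sup>2"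
  have ba: "(b - a)\<^sup>2 > 0" using \<open>a < b\<close> by simp
  have \<kappa>\<theta>: "\<kappa> * ((b - a)\<^sup>2 / 4) = \<theta>0 + 2 * pi * real k" using ba by (simp add: \<kappa>_def)
  have "(2 * M / (b - a)) * ((b - a)\<^sup>2 / 4) < \<kappa> * ((b - a)\<^sup>2 / 4)" using k unfolding \<kappa>\<theta> by (simp add: mult_ac)
  then have "2 * M / (b - a) < \<kappa>" by (rule mult_right_less_imp_less) (use ba in simp)
  then have \<kappa>M: "M < \<kappa> * (b - a) / 2" using \<open>a < b\<close> by (simp add: field_simps)
  then have "0 < \<kappa> * (b - a)" using M(1) by linarith
  then have \<kappa>0: "\<kappa> > 0" using \<open>a < b\<close> by (simp add: zero_less_mult_iff)
  define \<theta> where "\<theta> t = \<kappa> * ((t - a) * (b - t))" for t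
  define \<theta>' where "\<theta>' t = \<kappa> * (a + b - 2 * t)" for t
  have \<theta>d: "(\<theta> has_real_derivative \<theta>' t) (at t within S)" for t S
    unfolding \<theta>_def[abs_def] \<theta>'_def by (auto intro!: derivative_eq_intros simp: algebra_simps)
  have \<theta>c: "continuous_on S \<theta>" "continuous_on S \<theta>'" for S
    unfolding \<theta>_def[abs_def] \<theta>'_def[abs_def] by (auto intro!: continuous_intros)
  define l' where "l' t = rot J (\<theta> t) ` p t" for t
  have lagl': "lag (l' t)" if "t \<in> {a..b}" for t unfolding l'_def by (rule lag_rot[OF lagp[OF that]])
  have bJ: "bounded_linear J" using linear_J by (simp add: linear_conv_bounded_linear)
  have hom: "lag_homotopic \<omega> n p l' a b"
  proof (rule lag_homotopicI[where H = "\<lambda>s t. rot J (s * \<theta> t) ` p t"])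
    show "lag (rot J (s * \<theta> t) ` p t)" if "t \<in> {a..b}" for s t by (rule lag_rot[OF lagp[OF that]])
    fix v
    show "continuous_on ({0..1} \<times> {a..b}) (\<lambda>z. closest_point (rot J (fst z * \<theta> (snd z)) ` p (snd z)) v)"
      unfolding continuous_on_def
    proof
      fix z0 :: "real \<times> real" assume z0: "z0 \<in> {0..1} \<times> {a..b}"
      then have t0: "snd z0 \<in> {a..b}" by auto
      let ?T = "\<lambda>z x. rot J (fst z * \<theta> (snd z)) (closest_point (p (snd z)) x)"
      have lin: "linear (?T z)" if "snd z \<in> {a..b}" for z
        using linear_compose[OF linear_closest_point[OF sp[OF that]] linear_rot] by (simp add: o_def)
      have sub: "?T z ` p (snd z0) \<subseteq> rot J (fst z * \<theta> (snd z)) ` p (snd z)" if "snd z \<in> {a..b}" for z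
        using closest_point_subspace(1)[OF sp[OF that]] by blast
      have dm: "dim (rot J r ` p t) \<le> dim (p (snd z0))" if "t \<in> {a..b}" for r t
        using lag_dim[OF lag_rot[OF lagp[OF that]]] lag_dim[OF lagp[OF t0]] by simp
      have ss: "subspace (rot J r ` p t)" if "t \<in> {a..b}" for r t
        by (rule lag_subspace[OF lag_rot[OF lagp[OF that]]])
      show "((\<lambda>z. closest_point (rot J (fst z * \<theta> (snd z)) ` p (snd z)) v) \<longlongrightarrow>
        closest_point (rot J (fst z0 * \<theta> (snd z0)) ` p (snd z0)) v) (at z0 within {0..1} \<times> {a..b})"
      proof (rule tendsto_closest_point_image[where X = "p (snd z0)" and T = ?T and ?T0.0 = "?T z0"])
        show "eventually (\<lambda>z. linear (?T z)) (at z0 within {0..1} \<times> {a..b})"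
          using eventually_at_within_mem by eventually_elim (use lin in auto)
        show "linear (?T z0)" by (rule lin[OF t0])
        show "((\<lambda>z. ?T z x) \<longlongrightarrow> ?T z0 x) (at z0 within {0..1} \<times> {a..b})" for x
        proof -
          have c1: "continuous_on ({0..1} \<times> {a..b}) (\<lambda>z. closest_point (p (snd z)) x)"
            by (rule continuous_on_compose2[OF C1_on_continuous[OF pC1]]) (auto intro!: continuous_intros)
          have c2: "continuous_on ({0..1} \<times> {a..b}) (\<lambda>z. \<theta> (snd z))"
            by (rule continuous_on_compose2[OF \<theta>c(1)[of UNIV]]) (auto intro!: continuous_intros)
          have "continuous_on ({0..1} \<times> {a..b}) (\<lambda>z. ?T z x)"
            unfolding rot_def by (intro continuous_intros c1 c2 bounded_linear.continuous_on[OF bJ])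
          then show ?thesis using z0 unfolding continuous_on_def by blast
        qed
        show "subspace (p (snd z0))" by (rule sp[OF t0])
        show "inj_on (?T z0) (p (snd z0))"
        proof (rule inj_onI)
          fix x y assume xy: "x \<in> p (snd z0)" "y \<in> p (snd z0)" "?T z0 x = ?T z0 y"
          then have "rot J (fst z0 * \<theta> (snd z0)) x = rot J (fst z0 * \<theta> (snd z0)) y" by (simp add: closest_point_self)
          then show "x = y" using inj_rot[of _ UNIV] by (meson UNIV_I inj_onD)
        qed
        show "eventually (\<lambda>z. subspace (rot J (fst z * \<theta> (snd z)) ` p (snd z)) \<and> ?T z ` p (snd z0) \<subseteq> rot J (fst z * \<theta> (snd z)) ` p (snd z)
          \<and> dim (rot J (fst z * \<theta> (snd z)) ` p (snd z)) \<le> dim (p (snd z0))) (at z0 within {0..1} \<times> {a..b})"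
          using eventually_at_within_mem
        proof eventually_elim
          case (elim z)
          then have t: "snd z \<in> {a..b}" by auto
          show ?case using ss[OF t] sub[OF t] dm[OF t] by blast
        qed
      qed (use ss[OF t0] sub[OF t0] dm[OF t0] in auto)
    qed
  qed (auto simp: \<theta>_def l'_def)
  have C1: "lag_path_C1 \<omega> n l' a b"
  proof -
    have "C1_on {a..b} (\<lambda>t. closest_point (l' t) v)" for v
    proof (rule C1_on_closest_point_image[OF \<open>a < b\<close>])
      show "subspace (l' t)" if "t \<in> {a..b}" for t by (rule lag_subspace[OF lagl'[OF that]])
      fix t0 assume t0: "t0 \<in> {a..b}"
      let ?T = "\<lambda>t x. rot J (\<theta> t) (closest_point (p t) x)"
      have lin: "linear (?T t)" "?T t ` p t0 \<subseteq> l' t" "dim (l' t) \<le> dim (p t0)" if t: "t \<in> {a..b}" for t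
        using linear_compose[OF linear_closest_point[OF sp[OF t]] linear_rot] closest_point_subspace(1)[OF sp[OF t]]
          lag_dim[OF lagl'[OF t]] lag_dim[OF lagp[OF t0]] by (auto simp: o_def l'_def)
      have trig: "C1_on {a..b} (\<lambda>t. cos (\<theta> t))" "C1_on {a..b} (\<lambda>t. sin (\<theta> t))"
      proof -
        show "C1_on {a..b} (\<lambda>t. cos (\<theta> t))"
        proof (rule C1_onI[where D = "\<lambda>t. - sin (\<theta> t) * \<theta>' t"])
          show "((\<lambda>t. cos (\<theta> t)) has_vector_derivative - sin (\<theta> t) * \<theta>' t) (at t within {a..b})" for t
            unfolding has_real_derivative_iff_has_vector_derivative[symmetric]
            by (auto intro!: derivative_eq_intros \<theta>d)
        qed (intro continuous_intros \<theta>c)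
        show "C1_on {a..b} (\<lambda>t. sin (\<theta> t))"
        proof (rule C1_onI[where D = "\<lambda>t. cos (\<theta> t) * \<theta>' t"])
          show "((\<lambda>t. sin (\<theta> t)) has_vector_derivative cos (\<theta> t) * \<theta>' t) (at t within {a..b})" for t
            unfolding has_real_derivative_iff_has_vector_derivative[symmetric]
            by (auto intro!: derivative_eq_intros \<theta>d)
        qed (intro continuous_intros \<theta>c)
      qed
      have "C1_on {a..b} (\<lambda>t. ?T t x)" for x
        unfolding rot_def by (intro C1_on_add C1_on_scaleR trig pC1 C1_on_bounded_linear[OF bJ])
      moreover have "inj_on (?T t0) (p t0)"
      proof (rule inj_onI)
        fix x y assume xy: "x \<in> p t0" "y \<in> p t0" "?T t0 x = ?T t0 y"
        then have "rot J (\<theta> t0) x = rot J (\<theta> t0) y" by (simp add: closest_point_self)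
        then show "x = y" using inj_rot[of _ UNIV] by (meson UNIV_I inj_onD)
      qed
      ultimately show "\<exists>X T. subspace X \<and> (\<forall>t\<in>{a..b}. linear (T t) \<and> T t ` X \<subseteq> l' t \<and> dim (l' t) \<le> dim X)
        \<and> (\<forall>x::'v. C1_on {a..b} (\<lambda>t. T t x)) \<and> inj_on (T t0) X"
        using sp[OF t0] lin by (intro exI[of _ "p t0"] exI[of _ ?T]) blast
    qed
    then show ?thesis using lagl' unfolding lag_path_C1_def C1_on_def by blast
  qed
  have reg: "nondegenerate (crossing_form \<omega> n l' a b t0) (l' t0 \<inter> L0)" if t0': "t0 \<in> crossings l' L0 a b" for t0
  proof -
    have t0: "t0 \<in> {a..b}" and cross: "l' t0 \<inter> L0 \<noteq> {0}" using t0' by (auto simp: crossings_def)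
    let ?u = "\<lambda>v. rot J (- \<theta> t0) v"
    define q where "q v = \<theta>' t0 * \<omega> (?u v) (J (?u v)) + \<omega> (?u v) (D (?u v) t0)" for v
    have Q: "crossing_form \<omega> n l' a b t0 v = q v" if v: "v \<in> l' t0" for v
    proof -
      define u where "u = ?u v"
      \<comment> \<open>A curve in \<open>l'\<close> through \<open>v\<close>: the projection of the
        fixed vector \<open>u\<close> to \<open>p t\<close>, rotated.\<close>
      define x where "x t = rot J (\<theta> t) (closest_point (p t) u)" for t
      have u: "u \<in> p t0" using v by (auto simp: u_def l'_def rot_rot)
      have vu: "v = rot J (\<theta> t0) u" by (simp add: u_def rot_rot)
      have cu: "closest_point (p t0) u = u" by (rule closest_point_self[OF u])
      have xt0: "x t0 = v" by (simp add: x_def cu vu)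
      have "(x has_vector_derivative
          (cos (\<theta> t0) *\<^sub>R D u t0 + (- sin (\<theta> t0) * \<theta>' t0) *\<^sub>R closest_point (p t0) u)
          + (sin (\<theta> t0) *\<^sub>R J (D u t0) + (cos (\<theta> t0) * \<theta>' t0) *\<^sub>R J (closest_point (p t0) u))) (at t0 within {a..b})"
        unfolding x_def[abs_def] rot_def
        by (intro has_vector_derivative_add has_vector_derivative_scaleR D[OF t0] bounded_linear.has_vector_derivative[OF bJ])
          (auto intro!: derivative_eq_intros \<theta>d)
      moreover have "(cos (\<theta> t0) *\<^sub>R D u t0 + (- sin (\<theta> t0) * \<theta>' t0) *\<^sub>R closest_point (p t0) u)
          + (sin (\<theta> t0) *\<^sub>R J (D u t0) + (cos (\<theta> t0) * \<theta>' t0) *\<^sub>R J (closest_point (p t0) u))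
        = rot J (\<theta> t0) (D u t0) + \<theta>' t0 *\<^sub>R J v"
        unfolding cu vu by (simp add: rot_def J_simps algebra_simps)
      ultimately have x': "(x has_vector_derivative (rot J (\<theta> t0) (D u t0) + \<theta>' t0 *\<^sub>R J v)) (at t0 within {a..b})" by simp
      have "x t \<in> l' t" if "t \<in> {a..b}" for t
        unfolding x_def l'_def by (rule imageI[OF closest_point_subspace(1)[OF sp[OF that]]])
      then have "crossing_form \<omega> n l' a b t0 (x t0) = \<omega> (x t0) (rot J (\<theta> t0) (D u t0) + \<theta>' t0 *\<^sub>R J v)"
        by (rule crossing_form_eq[OF lag_path_C1_continuous[OF C1] \<open>a < b\<close> t0 _ x'])
      moreover have "\<omega> v (J v) = \<omega> u (J u)" unfolding vu J_rot \<omega>_rot ..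
      moreover have "\<omega> v (rot J (\<theta> t0) (D u t0)) = \<omega> u (D u t0)" unfolding vu \<omega>_rot ..
      ultimately show ?thesis by (simp add: xt0 \<omega>_simps u_def q_def)
    qed
    have qnz: "q v \<noteq> 0" if v: "v \<in> l' t0" "v \<noteq> 0" for v
    proof -
      define u where "u = ?u v"
      have "u \<noteq> 0"
      proof
        assume "u = 0"
        then have "rot J (\<theta> t0) u = 0" using linear_0[OF linear_rot] by simp
        then show False using v(2) by (simp add: u_def rot_rot)
      qed
      then have g: "\<omega> u (J u) > 0" by (rule \<omega>_J_pos)
      have "\<theta>' t0 * \<omega> u (J u) + \<omega> u (D u t0) \<noteq> 0"
      proof (cases "t0 \<le> m")
        case True
        \<comment> \<open>On the first quarter of the interval the parabola keeps at least half of
          its initial slope \<open>\<kappa> * (b - a)\<close>, and this half exceeds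
          \<open>M\<close>.\<close>
        then have "(b - a) / 2 \<le> a + b - 2 * t0" unfolding m by (simp add: field_simps)
        then have "\<kappa> * ((b - a) / 2) \<le> \<theta>' t0" unfolding \<theta>'_def using \<kappa>0 by (intro mult_left_mono) auto
        then have "M < \<theta>' t0" using \<kappa>M by simp
        then have "M * \<omega> u (J u) < \<theta>' t0 * \<omega> u (J u)" using g by (rule mult_strict_right_mono)
        then show ?thesis using M(2)[OF t0, of u] by linarith
      next
        case False
        then have t0m: "t0 \<in> {m..b}" using t0 by auto
        have "\<theta>' t0 \<noteq> 0"
        proof
          assume "\<theta>' t0 = 0"
          \<comment> \<open>At the turning point the path rests at \<open>l b\<close>, rotated by
            \<open>\<theta>0\<close> up to full turns, and so is transversal to
            \<open>L0\<close>.\<close>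
          then have e: "t0 = (a + b) / 2" using \<kappa>0 by (simp add: \<theta>'_def)
          have "\<theta> t0 = \<kappa> * ((b - a)\<^sup>2 / 4)" unfolding \<theta>_def e by (simp add: power2_eq_square field_simps)
          then have "l' t0 = rot J \<theta>0 ` l b" by (simp only: l'_def pm[OF t0m] \<kappa>\<theta> rot_periodic)
          then show False using \<theta>0 cross by simp
        qed
        then show ?thesis using g D0[OF t0m, of u] by (simp add: \<omega>_simps)
      qed
      then show ?thesis by (simp add: u_def q_def)
    qed
    show ?thesis
      unfolding nondegenerate_def
    proof (intro ballI impI, rule ccontr)
      fix v assume v: "v \<in> l' t0 \<inter> L0" "v \<noteq> 0"
        and z: "\<forall>w\<in>l' t0 \<inter> L0. crossing_form \<omega> n l' a b t0 (v + w) - crossing_form \<omega> n l' a b t0 v - crossing_form \<omega> n l' a b t0 w = 0"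
      have v1: "v \<in> l' t0" using v by blast
      have vv: "v + v \<in> l' t0" by (rule subspace_add[OF lag_subspace[OF lagl'[OF t0]] v1 v1])
      \<comment> \<open>The polar form at \<open>v, v\<close> is twice the value at
        \<open>v\<close>, so a vector of the radical would be null.\<close>
      have "q (v + v) = 4 * q v"
        by (simp add: q_def linear_add[OF linear_rot] linear_add[OF linD[OF t0]] J_simps \<omega>_simps algebra_simps)
      moreover have "crossing_form \<omega> n l' a b t0 (v + v) - crossing_form \<omega> n l' a b t0 v - crossing_form \<omega> n l' a b t0 v = 0"
        using z v(1) by blast
      ultimately have "q v = 0" using Q[OF v1] Q[OF vv] by linarith
      then show False using qnz[OF v1 v(2)] by blast
    qed
  qed
  have "lag_homotopic \<omega> n l l' a b" using \<open>a < b\<close> by (intro lag_homotopic_trans[OF hp hom]) simp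
  then show ?thesis using C1 reg by (auto simp: regular_path_def)
qed

end

lemma regular_representative:
  assumes "a < b" and L0: "lag L0" and l: "lag_path \<omega> n l a b"
  shows "\<exists>l'. lag_homotopic \<omega> n l l' a b \<and> regular_path \<omega> n L0 l' a b"
proof -
  obtain J where J: "compatible L0 J" using compatible_exists[OF L0] by blast
  define m where "m = a + (b - a) / 4"
  have "a < m" "m < b" using \<open>a < b\<close> by (auto simp: m_def field_simps)
  then obtain p where p: "lag_homotopic \<omega> n l p a b" "flat_C1 {m..b} p a b" "\<forall>t\<in>{m..b}. p t = l b"
    using flat_path_constant_tail[OF _ _ l] by blast
  show ?thesis by (rule regular_rotation[OF J L0 \<open>a < b\<close> p(1,2) p(3)[rule_format] m_def])
qed

section \<open>Comparison of the two indices\<close>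

text \<open>Two numbers in the ranges from 0 to \<open>n - d1\<close> and from 0 to
  \<open>n - d2\<close> differ by at most \<open>n - min d1 d2\<close>; hence the minima. The triple
  indices at the two ends of the path give one such bound, the cocycle identity rewrites the same
  difference to give the other, and having both yields the maximum.\<close>

theorem clm_index_difference_bound:
  assumes "a < b" and l: "lag_path \<omega> n l a b" and m: "lag \<mu>1" "lag \<mu>2"
  shows "\<bar>clm_index \<omega> n \<mu>2 l a b - clm_index \<omega> n \<mu>1 l a b\<bar>
    \<le> int n - int (max (min (dim (ssum (l a \<inter> l b) (l b \<inter> \<mu>1))) (dim (ssum (l a \<inter> l b) (l b \<inter> \<mu>2))))
        (min (dim (ssum (l a \<inter> \<mu>1) (\<mu>1 \<inter> \<mu>2))) (dim (ssum (l b \<inter> \<mu>1) (\<mu>1 \<inter> \<mu>2)))))"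
proof -
  have lc: "lag_continuous l {a..b}" by (rule lag_path_continuous[OF l])
  have ab: "a \<le> b" and la: "lag (l a)" and lb: "lag (l b)"
    using \<open>a < b\<close> lag_continuous_lag[OF lc, of a] lag_continuous_lag[OF lc, of b] by auto
  obtain f1 where f1: "index_fun \<mu>1 l {a..b} f1" using index_fun_exists[OF m(1) lc ab] by blast
  obtain f2 where f2: "index_fun \<mu>2 l {a..b} f2" using index_fun_exists[OF m(2) lc ab] by blast
  have "clm_index \<omega> n \<mu>2 l a b - clm_index \<omega> n \<mu>1 l a b = triple (l a) \<mu>1 \<mu>2 - triple (l b) \<mu>1 \<mu>2"
    unfolding clm_index_eq[OF m(1) \<open>a < b\<close> lc f1 regular_representative[OF \<open>a < b\<close> m(1) l]]
      clm_index_eq[OF m(2) \<open>a < b\<close> lc f2 regular_representative[OF \<open>a < b\<close> m(2) l]]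
    by (rule index_fun_difference[OF lc ab m f1 f2])
  moreover have "triple (l a) \<mu>1 \<mu>2 - triple (l b) \<mu>1 \<mu>2 = triple (l a) (l b) \<mu>2 - triple (l a) (l b) \<mu>1"
    by (rule triple_cocycle[OF la lb m])
  ultimately show ?thesis
    using triple_bounds[OF la m] triple_bounds[OF lb m] triple_bounds[OF la lb m(1)] triple_bounds[OF la lb m(2)]
    by linarith
qed

end

theorem theorem2p1:
  fixes \<omega> :: "'v::euclidean_space \<Rightarrow> 'v \<Rightarrow> real" and n :: nat
    and lam :: "real \<Rightarrow> 'v set" and \<mu>1 \<mu>2 :: "'v set" and a b :: real
  assumes "symplectic_form \<omega>" and "DIM('v) = 2 * n"
    and "a < b"
    and "lag_path \<omega> n lam a b"
    and "lagrangian \<omega> n \<mu>1" and "lagrangian \<omega> n \<mu>2"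
  shows "let \<epsilon>1 = ssum (lam a \<inter> lam b) (lam b \<inter> \<mu>1);
             \<epsilon>2 = ssum (lam a \<inter> lam b) (lam b \<inter> \<mu>2);
             \<delta>1 = ssum (lam a \<inter> \<mu>1) (\<mu>1 \<inter> \<mu>2);
             \<delta>2 = ssum (lam b \<inter> \<mu>1) (\<mu>1 \<inter> \<mu>2);
             k1 = min (dim \<epsilon>1) (dim \<epsilon>2);
             k2 = min (dim \<delta>1) (dim \<delta>2);
             k = max k1 k2
         in \<bar>clm_index \<omega> n \<mu>2 lam a b - clm_index \<omega> n \<mu>1 lam a b\<bar> \<le> int n - int k"
proof -
  interpret symplectic_space \<omega> n by unfold_locales (fact assms)+
  show ?thesis
    unfolding Let_def by (rule clm_index_difference_bound[OF assms(3-6)])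
qed

end
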